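(* Let $n=2r+1$ with $r\ge1$. Let $k\in\mathbb N^*$ and $a_1,\dots,a_k\in\mathbb C^*$ be such that $\frac{a_i}{a_j}\notin q^{2\mathbb Z}$ for each $i<j$. Then the tensor product $$V=V\begin{pmatrix}\boxed1\\ \vdots\\ \boxed{r+1}\end{pmatrix}_{a_1}\otimes V\begin{pmatrix}\boxed1\\ \vdots\\ \boxed{r+1}\end{pmatrix}_{a_2}\otimes\cdots\otimes V\begin{pmatrix}\boxed1\\ \vdots\\ \boxed{r+1}\end{pmatrix}_{a_k}$$ (with the action given by the Drinfeld coproduct $\Delta_D$) is an irreducible and thin extremal loop weight $\mathcal U_q(sl_{n+1}^{tor})$-module of $\ell$-weight $$e^{k\varpi_{r+1}}\,Y_{r+1,a_1}\cdots Y_{r+1,a_k}\,Y_{0,a_1q^{r+1}}^{-1}\cdots Y_{0,a_kq^{r+1}}^{-1}.$$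
   Context: Here $n=2r+1$, $r\ge1$. $I=\{0,\dots,n\}$ is identified with $\mathbb Z/(n+1)\mathbb Z$ ($\bar j$ is the class of $j\in\mathbb Z$); $C=(C_{i,j})_{i,j\in I}$ is the Cartan matrix of type $A_n^{(1)}$ ($C_{i,i}=2$, $C_{i,i\pm1}=-1$, $C_{i,j}=0$ otherwise). Fix $t\in\mathbb C$ such that $q=e^t$ is not a root of unity; $[l]_q=\frac{q^l-q^{-l}}{q-q^{-1}}$, $[s]_q!=[s]_q\cdots[1]_q$. $\mathfrak h=\mathbb Qh_0\oplus\dots\oplus\mathbb Qh_n\oplus\mathbb Qd$; $\alpha_i,\Lambda_i\in\mathfrak h^*$: $\alpha_i(h_j)=C_{j,i}$, $\alpha_i(d)=\delta_{0,i}$, $\Lambda_i(h_j)=\delta_{i,j}$, $\Lambda_i(d)=0$; $P=\{\lambda\in\mathfrak h^*:\lambda(h_i)\in\mathbb Z\ \forall i\}$; $\varpi_\ell=\Lambda_\ell-\Lambda_0$ for $1\le\ell\le n$. $\mathcal U_q(sl_{n+1}^{tor})$ is the $\mathbb C$-algebra with generators $x_{i,s}^\pm$ ($i\in I,s\in\mathbb Z$), $k_h$ ($h\in\mathfrak h$), $h_{i,m}$ ($i\in I$, $m\in\mathbb Z\setminus\{0\}$). Put $x_i^\pm(z)=\sum_{s\in\mathbb Z}x_{i,s}^\pm z^s$, $\delta(z)=\sum_{s\in\mathbb Z}z^s$, $k_i^{\pm1}=k_{\pm h_i}$, $\phi_i^\pm(z)=\sum_{m\ge0}\phi^\pm_{i,\pm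 m}z^{\pm m}=k_i^{\pm1}\exp(\pm(q-q^{-1})\sum_{m\ge1}h_{i,\pm m}z^{\pm m})$. Relations: $k_hk_{h'}=k_{h+h'}$, $k_0=1$; $\phi_i^\pm(z)\phi_j^\pm(w)=\phi_j^\pm(w)\phi_i^\pm(z)$, $\phi_i^-(z)\phi_j^+(w)=\phi_j^+(w)\phi_i^-(z)$; $(w-q^{\pm C_{ij}}z)\phi_i^{\epsilon}(z)x_j^\pm(w)=(q^{\pm C_{ij}}w-z)x_j^\pm(w)\phi_i^{\epsilon}(z)$ for $\epsilon=+,-$; $[x_i^+(z),x_j^-(w)]=\frac{\delta_{i,j}}{q-q^{-1}}(\delta(\frac wz)\phi_i^+(w)-\delta(\frac zw)\phi_i^-(z))$; $(z-q^{\pm C_{ij}}w)x_i^\pm(z)x_j^\pm(w)=(q^{\pm C_{ij}}z-w)x_j^\pm(w)x_i^\pm(z)$; for $j=i\pm1$: $x_i^\pm(z_1)x_i^\pm(z_2)x_j^\pm(w)-(q+q^{-1})x_i^\pm(z_1)x_j^\pm(w)x_i^\pm(z_2)+x_j^\pm(w)x_i^\pm(z_1)x_i^\pm(z_2)+(z_1\leftrightarrow z_2)=0$; $[x_i^\pm(z),x_j^\pm(w)]=0$ for $i\ne j,j+1,j-1$. Let $\psi(z)=\frac{q-q^{-1}z}{1-z}$; rational functions describing $\phi_i^+$ (resp. $\phi_i^-$) are expanded at $z=0$ (resp. $z=\infty$). Monomials are $m=e^{\omega}\prod_{i\in I,c\in\mathbb C^*}Y_{i,c}^{u_{i,c}}$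 (finite product, $\omega\in P$, $\sum_cu_{i,c}=\omega(h_i)$). For $b\in\mathbb C^*$, the vector representation $V(\boxed1_b)$ is the extremal loop weight module of $\ell$-weight $e^{\varpi_1}Y_{1,b}Y_{0,bq}^{-1}$ (see below for the definition) with basis $\boxed{j}_b$, $j\in\mathbb Z$, and action $x_i^+(z)\boxed j_b=\delta_{i,\overline{j-1}}\,\delta(bq^{j-1}z)\boxed{j-1}_b$, $x_i^-(z)\boxed j_b=\delta_{i,\bar j}\,\delta(bq^jz)\boxed{j+1}_b$, $\phi_i^\pm(z)\boxed j_b=\psi(bq^jz)\boxed j_b$ if $i=\bar j$, $=\psi(bq^{j+1}z)^{-1}\boxed j_b$ if $i=\overline{j-1}$, $=\boxed j_b$ otherwise. Drinfeld coproduct: $\Delta_D(x_i^+(z))=x_i^+(z)\otimes1+\phi_i^-(z)\otimes x_i^+(z)$, $\Delta_D(x_i^-(z))=x_i^-(z)\otimes\phi_i^+(z)+1\otimes x_i^-(z)$, $\Delta_D(\phi_i^\pm(z))=\phi_i^\pm(z)\otimes\phi_i^\pm(z)$, $\Delta_D(k_h)=k_h\otimes k_h$, iterated for several factors. It involves infinite sums; it defines an action on a space of tensors when these sums are well-defined there. For $a\in\mathbb C^*$, $\tilde V_a$ is the vector subspace of $V(\boxed1_a)\otimes V(\boxed1_{aq^{-2}})\otimes\cdots\otimes V(\boxed1_{aq^{-2r}})$ spanned by the vectors $\boxed{i_1}_a\otimes\boxed{i_2}_{aq^{-2}}\otimes\cdots\otimes\boxed{i_{r+1}}_{aq^{-2r}}$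 with $i_1<i_2<\cdots<i_{r+1}$; it is a $\mathcal U_q(sl_{n+1}^{tor})$-module via $\Delta_D$. $V\begin{pmatrix}\boxed1\\ \vdots\\ \boxed{r+1}\end{pmatrix}_a\subset\tilde V_a$ is the span of those vectors with moreover $i_{r+1}-i_1\le n$; it is a module with $x_i^\pm(z),\phi_i^\pm(z)$ acting by $\mathrm{pr}\circ\Delta_D(x_i^\pm(z))$, $\mathrm{pr}\circ\Delta_D(\phi_i^\pm(z))$, where $\mathrm{pr}$ is the projection of $\tilde V_a$ killing the remaining spanning vectors. Integrable module: direct sum of its weight spaces $V_\lambda=\{v:k_hv=q^{\lambda(h)}v\ \forall h\}$, $\lambda\in P$, with all $x_{i,0}^\pm$ acting locally nilpotently. For a monomial $m$, $V_m$ is the subspace of $V_\omega$ on which the $\phi^\pm_{i,\pm s}$ act with generalized eigenvalues the coefficients of the expansions of $\prod_c\psi(cqz)^{u_{i,c}}$. A module is thin if the subalgebra generated by the $k_h$ and $h_{i,m}$ acts by diagonalizable operators with simple joint spectrum. A vector $w$ of weight $\lambda$ is $i$-extremal if $x_{i,0}^{\pm}w=0$ when $\pm\lambda(h_i)\ge0$; then $S_i(w)=\frac{(x_{i,0}^\mp)^{\pm\lambda(h_i)}}{[\pm\lambda(h_i)]_q!}w$. It is extremal for the horizontal subalgebra (generated by the $x_{i,0}^\pm$, $k_h$) if every $S_{i_1}\circ\cdots\circ S_{i_l}(w)$ ($l\ge0$) is $i$-extremal for every $i$. An extremal loop weight module of $\ell$-weight $m$ is an integrable module $V$ with a $v\in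 V_m$ such that (i) $v$ generates $V$; (ii) $v$ is extremal for the horizontal subalgebra; (iii) for each $j\in I$ and $w\in V$, $\mathcal U_q^{v,j}(sl_{n+1}^{tor})\cdot w$ is finite-dimensional, where $\mathcal U_q^{v,j}(sl_{n+1}^{tor})$ is the subalgebra generated by $x_{i,s}^\pm,h_{i,m}$ ($i\ne j$) and $k_h$, $h\in\bigoplus_{i\ne j}\mathbb Qh_i$.
   Formalization: The ℓ-weight is stated with a_i replaced by a_i q^{-r} (the printed one never occurs for factors a, aq^{-2},…,aq^{-2r}), and the quadratic x–x relation has z and w swapped in its scalar factors, since the printed relation fails in the vector representation. *)

theory Defs
  imports
    Complex_Main
    "HOL-Library.Poly_Mapping"
    "HOL-Computational_Algebra.Computational_Algebra"
    "Berlekamp_Zassenhaus.Finite_Field"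
begin

section \<open>Rational functions in one variable\<close>

text \<open>
  Rational functions are elements of the field \<open>complex poly fract\<close>.  Values and expansions do not
  depend on the chosen representative \<open>P / Q\<close>.
\<close>

definition rf_regular :: "complex poly fract \<Rightarrow> complex \<Rightarrow> bool" where
  "rf_regular f c \<longleftrightarrow> (\<exists>P Q. f = Fract P Q \<and> poly Q c \<noteq> 0)"

definition rf_eval :: "complex poly fract \<Rightarrow> complex \<Rightarrow> complex" where
  "rf_eval f c = (THE v. \<exists>P Q. f = Fract P Q \<and> poly Q c \<noteq> 0 \<and> v = poly P c / poly Q c)"

text \<open>Expansion at \<open>0\<close>, a power series in \<open>z\<close> (for \<open>f\<close> regular at \<open>0\<close>).\<close>

definition rf_expand_0 :: "complex poly fract \<Rightarrow> complex fps" where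
  "rf_expand_0 f = (THE F. \<exists>P Q. Q \<noteq> 0 \<and> f = Fract P Q \<and> F * fps_of_poly Q = fps_of_poly P)"

text \<open>
  Expansion at \<open>\<infinity>\<close>, a power series in \<open>w = 1/z\<close> (for \<open>f\<close> regular at \<open>\<infinity>\<close>): if \<open>p\<close>, \<open>q\<close> are the
  degrees of \<open>P\<close>, \<open>Q\<close>, then \<open>P (1/w) / Q (1/w) = (w^q * reflect_poly P w) / (w^p * reflect_poly Q w)\<close>.
\<close>

definition rf_expand_inf :: "complex poly fract \<Rightarrow> complex fps" where
  "rf_expand_inf f = (THE F. \<exists>P Q. Q \<noteq> 0 \<and> f = Fract P Q \<and>
     F * fps_of_poly (Polynomial.monom 1 (Polynomial.degree P) * reflect_poly Q)
       = fps_of_poly (Polynomial.monom 1 (Polynomial.degree Q) * reflect_poly P))"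

lemma rf_eval_Fract:
  assumes "poly Q c \<noteq> 0"
  shows "rf_eval (Fract P Q) c = poly P c / poly Q c"
  unfolding rf_eval_def
proof (rule the_equality)
  show "\<exists>P' Q'. Fract P Q = Fract P' Q' \<and> poly Q' c \<noteq> 0 \<and> poly P c / poly Q c = poly P' c / poly Q' c"
    using assms by blast
next
  fix v
  assume "\<exists>P' Q'. Fract P Q = Fract P' Q' \<and> poly Q' c \<noteq> 0 \<and> v = poly P' c / poly Q' c"
  then obtain P' Q' where e: "Fract P Q = Fract P' Q'" "poly Q' c \<noteq> 0" "v = poly P' c / poly Q' c"
    by blast
  have "Q \<noteq> 0" "Q' \<noteq> 0" using assms e(2) by auto
  then have "P * Q' = P' * Q" using e(1) by (simp add: eq_fract)
  then have "poly P c * poly Q' c = poly P' c * poly Q c" by (metis poly_mult)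
  then show "v = poly P c / poly Q c" using assms e(2,3) by (simp add: frac_eq_eq)
qed

lemma rf_expand_0_eqI:
  assumes "Q \<noteq> 0" and "F * fps_of_poly Q = fps_of_poly P"
  shows "rf_expand_0 (Fract P Q) = F"
  unfolding rf_expand_0_def
proof (rule the_equality)
  show "\<exists>P' Q'. Q' \<noteq> 0 \<and> Fract P Q = Fract P' Q' \<and> F * fps_of_poly Q' = fps_of_poly P'"
    using assms by blast
next
  fix G
  assume "\<exists>P' Q'. Q' \<noteq> 0 \<and> Fract P Q = Fract P' Q' \<and> G * fps_of_poly Q' = fps_of_poly P'"
  then obtain P' Q' where e: "Q' \<noteq> 0" "Fract P Q = Fract P' Q'" "G * fps_of_poly Q' = fps_of_poly P'"
    by blast
  have "P * Q' = P' * Q" using e assms(1) by (simp add: eq_fract)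
  then have "F * fps_of_poly Q * fps_of_poly Q' = G * fps_of_poly Q' * fps_of_poly Q"
    using assms(2) e(3) by (metis fps_of_poly_mult)
  then have "(F - G) * (fps_of_poly Q * fps_of_poly Q') = 0" by (simp add: algebra_simps)
  then show "G = F" using assms(1) e(1) by simp
qed

section \<open>The Cartan data of type \<open>A\<close>, untwisted affine\<close>

text \<open>
  The index set \<open>I = \<int>/(n+1)\<int>\<close> is \<open>'n mod_ring\<close> with \<open>CARD('n) = n + 1\<close>; the class of an integer
  \<open>j\<close> is \<open>of_int j\<close>.  An element of \<open>\<hh>\<close> is given by its coefficients in the basis
  \<open>h\<^sub>0, \<dots>, h\<^sub>n, d\<close> and an element of the dual space by its values on this basis;
  \<open>Some i\<close> stands for \<open>h\<^sub>i\<close> and \<open>None\<close> for \<open>d\<close>.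
\<close>

type_synonym 'i cartan = "'i option \<Rightarrow> rat"
type_synonym 'i weight = "'i option \<Rightarrow> rat"

definition pairing :: "'i::finite weight \<Rightarrow> 'i cartan \<Rightarrow> rat" where
  "pairing \<nu> h = (\<Sum>x\<in>UNIV. \<nu> x * h x)"

definition hvec :: "'i \<Rightarrow> 'i cartan" where
  "hvec i x = (if x = Some i then 1 else 0)"

definition cartan_matrix :: "'n::nontriv mod_ring \<Rightarrow> 'n mod_ring \<Rightarrow> int" where
  "cartan_matrix i j = (if i = j then 2 else if i = j + 1 \<or> i = j - 1 then -1 else 0)"

definition simple_root :: "'n::nontriv mod_ring \<Rightarrow> 'n mod_ring weight" where
  "simple_root i x = (case x of Some j \<Rightarrow> of_int (cartan_matrix j i) | None \<Rightarrow> if i = 0 then 1 else 0)"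

definition fund_weight :: "'i \<Rightarrow> 'i weight" where
  "fund_weight i x = (if x = Some i then 1 else 0)"

definition weight_lattice :: "'i weight set" where
  "weight_lattice = {\<nu>. \<forall>i. \<nu> (Some i) \<in> \<int>}"

definition varpi :: "'n::nontriv mod_ring \<Rightarrow> 'n mod_ring weight" where
  "varpi l x = fund_weight l x - fund_weight 0 x"

definition reflection :: "'n::nontriv mod_ring \<Rightarrow> 'n mod_ring weight \<Rightarrow> 'n mod_ring weight" where
  "reflection i \<nu> x = \<nu> x - \<nu> (Some i) * simple_root i x"

section \<open>Complex vector spaces with a basis\<close>

text \<open>Modules live on subspaces of the free complex vector space \<open>'b \<Rightarrow>\<^sub>0 complex\<close> on a type \<open>'b\<close>.\<close>

definition cscale :: "complex \<Rightarrow> ('b \<Rightarrow>\<^sub>0 complex) \<Rightarrow> ('b \<Rightarrow>\<^sub>0 complex)" (infixr "*\<^sub>C" 75) where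
  "c *\<^sub>C v = Poly_Mapping.map (\<lambda>x. c * x) v"

global_interpretation cv: vector_space cscale
  defines cspan = cv.span and csubspace = cv.subspace
proof -
  have l: "Poly_Mapping.lookup (c *\<^sub>C v) b = c * Poly_Mapping.lookup v b"
    for c and v :: "'b \<Rightarrow>\<^sub>0 complex" and b
    by (simp add: cscale_def Poly_Mapping.map.rep_eq when_def)
  show "vector_space (cscale :: complex \<Rightarrow> ('b \<Rightarrow>\<^sub>0 complex) \<Rightarrow> _)"
    by standard (auto intro!: poly_mapping_eqI simp: l lookup_add algebra_simps)
qed

definition linear_on :: "('b \<Rightarrow>\<^sub>0 complex) set \<Rightarrow> (('b \<Rightarrow>\<^sub>0 complex) \<Rightarrow> ('b \<Rightarrow>\<^sub>0 complex)) \<Rightarrow> bool" where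
  "linear_on V f \<longleftrightarrow> (\<forall>v\<in>V. f v \<in> V) \<and> (\<forall>u\<in>V. \<forall>v\<in>V. f (u + v) = f u + f v)
     \<and> (\<forall>c. \<forall>v\<in>V. f (c *\<^sub>C v) = c *\<^sub>C f v)"

section \<open>Modules over the quantum toroidal algebra\<close>

datatype sign = Plus | Minus

fun sg :: "sign \<Rightarrow> int" where
  "sg Plus = 1"
| "sg Minus = -1"

text \<open>
  Generators \<open>x\<^sup>\<plusminus>\<^bsub>i,s\<^esub>\<close>, \<open>k\<^sub>h\<close> and \<open>h\<^bsub>i,m\<^esub>\<close>; the symbol \<open>H i 0\<close> is not a generator and is
  excluded from \<open>generators\<close>.
\<close>

datatype 'i gen = X sign 'i int | K "'i cartan" | H 'i int

definition generators :: "'i gen set" where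
  "generators = {g. \<forall>i. g \<noteq> H i 0}"

type_synonym ('i, 'b) action = "'i gen \<Rightarrow> ('b \<Rightarrow>\<^sub>0 complex) \<Rightarrow> ('b \<Rightarrow>\<^sub>0 complex)"

text \<open>The coefficient of \<open>z^(\<epsilon>m)\<close> in the \<open>l\<close>-th power of the sum of all \<open>h\<^bsub>i,\<epsilon>p\<^esub> z^(\<epsilon>p)\<close>, \<open>p \<ge> 1\<close>.\<close>

primrec h_power :: "('i, 'b) action \<Rightarrow> sign \<Rightarrow> 'i \<Rightarrow> nat \<Rightarrow> nat \<Rightarrow> ('b \<Rightarrow>\<^sub>0 complex) \<Rightarrow> ('b \<Rightarrow>\<^sub>0 complex)" where
  "h_power \<rho> \<epsilon> i 0 m v = (if m = 0 then v else 0)"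
| "h_power \<rho> \<epsilon> i (Suc l) m v = (\<Sum>p = 1..m. \<rho> (H i (sg \<epsilon> * int p)) (h_power \<rho> \<epsilon> i l (m - p) v))"

text \<open>
  \<open>phi_op t \<rho> \<epsilon> i p\<close> is the coefficient of \<open>z^p\<close> in \<open>\<phi>\<^sub>i\<^sup>\<epsilon>(z)\<close>; it vanishes if \<open>p\<close> has the wrong sign.
  Throughout \<open>q = exp t\<close>.
\<close>

definition phi_op :: "complex \<Rightarrow> ('i, 'b) action \<Rightarrow> sign \<Rightarrow> 'i \<Rightarrow> int \<Rightarrow> ('b \<Rightarrow>\<^sub>0 complex) \<Rightarrow> ('b \<Rightarrow>\<^sub>0 complex)" where
  "phi_op t \<rho> \<epsilon> i p v =
     (if sg \<epsilon> * p \<ge> 0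
      then \<rho> (K (\<lambda>x. of_int (sg \<epsilon>) * hvec i x))
             (\<Sum>l\<le>nat \<bar>p\<bar>. ((of_int (sg \<epsilon>) * (exp t - inverse (exp t))) ^ l / fact l)
                              *\<^sub>C h_power \<rho> \<epsilon> i l (nat \<bar>p\<bar>) v)
      else 0)"

text \<open>
  The defining relations between formal series, written as equalities of coefficients of \<open>z^p w^s\<close>
  (of \<open>z\<^sub>1^p z\<^sub>2^p' w^s\<close> in the Serre relations).

  The quadratic relation between \<open>x\<^sub>i\<^sup>\<plusminus>(z)\<close> and \<open>x\<^sub>j\<^sup>\<plusminus>(w)\<close> is
  \<open>(w - q\<^bsup>\<plusminus>C\<^esup> z) x\<^sub>i\<^sup>\<plusminus>(z) x\<^sub>j\<^sup>\<plusminus>(w) = (q\<^bsup>\<plusminus>C\<^esup> w - z) x\<^sub>j\<^sup>\<plusminus>(w) x\<^sub>i\<^sup>\<plusminus>(z)\<close>, as is forced by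
  the convention \<open>x\<^sub>i\<^sup>\<plusminus>(z) = \<Sum> x\<^sup>\<plusminus>\<^bsub>i,s\<^esub> z^s\<close> and by the relation between \<open>\<phi>\<^sub>i\<close> and \<open>x\<^sub>j\<close>.  The variant
  with \<open>z\<close> and \<open>w\<close> exchanged in the two scalar factors belongs to the convention
  \<open>\<Sum> x\<^sup>\<plusminus>\<^bsub>i,s\<^esub> z^(-s)\<close>; it does not hold in the vector representation below.
\<close>

definition toroidal_relations ::
  "complex \<Rightarrow> ('b \<Rightarrow>\<^sub>0 complex) set \<Rightarrow> ('n::nontriv mod_ring, 'b) action \<Rightarrow> bool" where
  "toroidal_relations t V \<rho> \<longleftrightarrow>
    (let q = exp t;
         x = (\<lambda>\<epsilon> i s. \<rho> (X \<epsilon> i s));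
         \<phi> = phi_op t \<rho>;
         Q = (\<lambda>\<epsilon> i j. q powi (sg \<epsilon> * cartan_matrix i j))
     in (\<forall>v\<in>V.
      (\<forall>h h'. \<rho> (K h) (\<rho> (K h') v) = \<rho> (K (\<lambda>y. h y + h' y)) v) \<and>
      \<rho> (K (\<lambda>_. 0)) v = v \<and>
      (\<forall>\<epsilon> \<epsilon>' i j p s. \<phi> \<epsilon> i p (\<phi> \<epsilon>' j s v) = \<phi> \<epsilon>' j s (\<phi> \<epsilon> i p v)) \<and>
      (\<forall>\<epsilon>' \<epsilon> i j p s.
         \<phi> \<epsilon>' i p (x \<epsilon> j (s - 1) v) - Q \<epsilon> i j *\<^sub>C \<phi> \<epsilon>' i (p - 1) (x \<epsilon> j s v)
         = Q \<epsilon> i j *\<^sub>C x \<epsilon> j (s - 1) (\<phi> \<epsilon>' i p v) - x \<epsilon> j s (\<phi> \<epsilon>' i (p - 1) v)) \<and>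
      (\<forall>i j p s.
         x Plus i p (x Minus j s v) - x Minus j s (x Plus i p v)
         = (if i = j
            then (1 / (q - inverse q)) *\<^sub>C (\<phi> Plus i (p + s) v - \<phi> Minus i (p + s) v)
            else 0)) \<and>
      (\<forall>\<epsilon> i j p s.
         x \<epsilon> i p (x \<epsilon> j (s - 1) v) - Q \<epsilon> i j *\<^sub>C x \<epsilon> i (p - 1) (x \<epsilon> j s v)
         = Q \<epsilon> i j *\<^sub>C x \<epsilon> j (s - 1) (x \<epsilon> i p v) - x \<epsilon> j s (x \<epsilon> i (p - 1) v)) \<and>
      (\<forall>\<epsilon> i j p p' s. j = i + 1 \<or> j = i - 1 \<longrightarrow>
         (x \<epsilon> i p (x \<epsilon> i p' (x \<epsilon> j s v)) - (q + inverse q) *\<^sub>C x \<epsilon> i p (x \<epsilon> j s (x \<epsilon> i p' v))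
            + x \<epsilon> j s (x \<epsilon> i p (x \<epsilon> i p' v)))
         + (x \<epsilon> i p' (x \<epsilon> i p (x \<epsilon> j s v)) - (q + inverse q) *\<^sub>C x \<epsilon> i p' (x \<epsilon> j s (x \<epsilon> i p v))
            + x \<epsilon> j s (x \<epsilon> i p' (x \<epsilon> i p v))) = 0) \<and>
      (\<forall>\<epsilon> i j p s. i \<noteq> j \<and> i \<noteq> j + 1 \<and> i \<noteq> j - 1 \<longrightarrow>
         x \<epsilon> i p (x \<epsilon> j s v) = x \<epsilon> j s (x \<epsilon> i p v))))"

definition toroidal_module ::
  "complex \<Rightarrow> ('b \<Rightarrow>\<^sub>0 complex) set \<Rightarrow> ('n::nontriv mod_ring, 'b) action \<Rightarrow> bool" where
  "toroidal_module t V \<rho> \<longleftrightarrow>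
     csubspace V \<and> (\<forall>g\<in>generators. linear_on V (\<rho> g)) \<and> toroidal_relations t V \<rho>"

text \<open>\<open>A \<cdot> w\<close>, for \<open>A\<close> the subalgebra generated by the set \<open>S\<close> of generators.\<close>

definition subalgebra_orbit ::
  "('i, 'b) action \<Rightarrow> 'i gen set \<Rightarrow> ('b \<Rightarrow>\<^sub>0 complex) \<Rightarrow> ('b \<Rightarrow>\<^sub>0 complex) set" where
  "subalgebra_orbit \<rho> S w = cspan {foldr \<rho> gs w | gs. set gs \<subseteq> S}"

definition irreducible_module :: "('b \<Rightarrow>\<^sub>0 complex) set \<Rightarrow> ('i, 'b) action \<Rightarrow> bool" where
  "irreducible_module V \<rho> \<longleftrightarrow> V \<noteq> {0} \<and>
     (\<forall>U. csubspace U \<and> U \<subseteq> V \<and> (\<forall>g\<in>generators. \<forall>u\<in>U. \<rho> g u \<in> U) \<longrightarrow> U = {0} \<or> U = V)"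

definition joint_eigenspace ::
  "('b \<Rightarrow>\<^sub>0 complex) set \<Rightarrow> ('i, 'b) action \<Rightarrow> ('i gen \<Rightarrow> complex) \<Rightarrow> ('b \<Rightarrow>\<^sub>0 complex) set" where
  "joint_eigenspace V \<rho> \<chi> =
     {v\<in>V. (\<forall>h. \<rho> (K h) v = \<chi> (K h) *\<^sub>C v) \<and> (\<forall>i m. m \<noteq> 0 \<longrightarrow> \<rho> (H i m) v = \<chi> (H i m) *\<^sub>C v)}"

definition thin_module :: "('b \<Rightarrow>\<^sub>0 complex) set \<Rightarrow> ('i, 'b) action \<Rightarrow> bool" where
  "thin_module V \<rho> \<longleftrightarrow>
     cspan (\<Union>\<chi>. joint_eigenspace V \<rho> \<chi>) = V \<and>
     (\<forall>\<chi>. \<forall>u\<in>joint_eigenspace V \<rho> \<chi>. \<forall>v\<in>joint_eigenspace V \<rho> \<chi>. u \<noteq> 0 \<longrightarrow> (\<exists>c. v = c *\<^sub>C u))"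

definition q_weight :: "complex \<Rightarrow> 'i::finite weight \<Rightarrow> 'i cartan \<Rightarrow> complex" where
  "q_weight t \<nu> h = exp (t * of_rat (pairing \<nu> h))"

definition weight_space ::
  "complex \<Rightarrow> ('b \<Rightarrow>\<^sub>0 complex) set \<Rightarrow> ('i::finite, 'b) action \<Rightarrow> 'i weight \<Rightarrow> ('b \<Rightarrow>\<^sub>0 complex) set" where
  "weight_space t V \<rho> \<nu> = {v\<in>V. \<forall>h. \<rho> (K h) v = q_weight t \<nu> h *\<^sub>C v}"

definition integrable_module ::
  "complex \<Rightarrow> ('b \<Rightarrow>\<^sub>0 complex) set \<Rightarrow> ('i::finite, 'b) action \<Rightarrow> bool" where
  "integrable_module t V \<rho> \<longleftrightarrow>
     cspan (\<Union>\<nu>\<in>weight_lattice. weight_space t V \<rho> \<nu>) = V \<and>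
     (\<forall>S f. finite S \<and> S \<subseteq> weight_lattice \<and> (\<forall>\<nu>\<in>S. f \<nu> \<in> weight_space t V \<rho> \<nu>) \<and> (\<Sum>\<nu>\<in>S. f \<nu>) = 0
        \<longrightarrow> (\<forall>\<nu>\<in>S. f \<nu> = 0)) \<and>
     (\<forall>\<epsilon> i. \<forall>v\<in>V. \<exists>N. (\<rho> (X \<epsilon> i 0) ^^ N) v = 0)"

section \<open>Monomials, \<open>\<ell>\<close>-weights and extremal loop weight modules\<close>

text \<open>The rational function \<open>\<psi>(cz)\<close>, where \<open>\<psi>(z) = (q - q\<^sup>-\<^sup>1 z) / (1 - z)\<close>.\<close>

definition psi :: "complex \<Rightarrow> complex \<Rightarrow> complex poly fract" where
  "psi t c = Fract [:exp t, - (inverse (exp t) * c):] [:1, - c:]"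

text \<open>The coefficient of \<open>z^p\<close> in the expansion of \<open>f\<close> at \<open>0\<close> (for \<open>Plus\<close>) or at \<open>\<infinity>\<close> (for \<open>Minus\<close>).\<close>

definition rf_coeff :: "sign \<Rightarrow> complex poly fract \<Rightarrow> int \<Rightarrow> complex" where
  "rf_coeff \<epsilon> f p =
     (if sg \<epsilon> * p \<ge> 0
      then fps_nth (case \<epsilon> of Plus \<Rightarrow> rf_expand_0 f | Minus \<Rightarrow> rf_expand_inf f) (nat \<bar>p\<bar>)
      else 0)"

text \<open>\<open>Monomial \<omega> u\<close> is the monomial with weight \<open>\<omega>\<close> and exponent \<open>u i c\<close> of \<open>Y\<^bsub>i,c\<^esub>\<close>.\<close>

datatype 'i monomial = Monomial (mono_weight: "'i weight") (mono_exp: "'i \<Rightarrow> complex \<Rightarrow> int")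

definition is_monomial :: "'i monomial \<Rightarrow> bool" where
  "is_monomial m \<longleftrightarrow> mono_weight m \<in> weight_lattice \<and>
     (\<forall>i. finite {c. mono_exp m i c \<noteq> 0} \<and> mono_exp m i 0 = 0 \<and>
          of_int (\<Sum>c | mono_exp m i c \<noteq> 0. mono_exp m i c) = mono_weight m (Some i))"

definition mono_eigenvalue :: "complex \<Rightarrow> 'i monomial \<Rightarrow> 'i \<Rightarrow> complex poly fract" where
  "mono_eigenvalue t m i = (\<Prod>c | mono_exp m i c \<noteq> 0. psi t (c * exp t) powi mono_exp m i c)"

definition lweight_space ::
  "complex \<Rightarrow> ('b \<Rightarrow>\<^sub>0 complex) set \<Rightarrow> ('i::finite, 'b) action \<Rightarrow> 'i monomial \<Rightarrow> ('b \<Rightarrow>\<^sub>0 complex) set" where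
  "lweight_space t V \<rho> m =
     {v \<in> weight_space t V \<rho> (mono_weight m).
        \<forall>\<epsilon> i. \<forall>s::nat. \<exists>N.
          ((\<lambda>u. phi_op t \<rho> \<epsilon> i (sg \<epsilon> * int s) u
                 - rf_coeff \<epsilon> (mono_eigenvalue t m i) (sg \<epsilon> * int s) *\<^sub>C u) ^^ N) v = 0}"

definition q_int :: "complex \<Rightarrow> nat \<Rightarrow> complex" where
  "q_int t l = (exp t ^ l - inverse (exp t ^ l)) / (exp t - inverse (exp t))"

definition q_fact :: "complex \<Rightarrow> nat \<Rightarrow> complex" where
  "q_fact t s = (\<Prod>l = 1..s. q_int t l)"

definition i_extremal ::
  "complex \<Rightarrow> ('b \<Rightarrow>\<^sub>0 complex) set \<Rightarrow> ('i::finite, 'b) action \<Rightarrow> 'i \<Rightarrow> 'i weight \<Rightarrow> ('b \<Rightarrow>\<^sub>0 complex) \<Rightarrow> bool" where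
  "i_extremal t V \<rho> i \<nu> w \<longleftrightarrow> w \<in> weight_space t V \<rho> \<nu> \<and>
     (\<nu> (Some i) \<ge> 0 \<longrightarrow> \<rho> (X Plus i 0) w = 0) \<and>
     (\<nu> (Some i) \<le> 0 \<longrightarrow> \<rho> (X Minus i 0) w = 0)"

definition S_op ::
  "complex \<Rightarrow> ('i, 'b) action \<Rightarrow> 'i \<Rightarrow> 'i weight \<Rightarrow> ('b \<Rightarrow>\<^sub>0 complex) \<Rightarrow> ('b \<Rightarrow>\<^sub>0 complex)" where
  "S_op t \<rho> i \<nu> w =
     (let s = nat \<bar>\<lfloor>\<nu> (Some i)\<rfloor>\<bar>
      in (1 / q_fact t s) *\<^sub>C (\<rho> (X (if \<nu> (Some i) \<ge> 0 then Minus else Plus) i 0) ^^ s) w)"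

text \<open>
  \<open>S_iter t \<rho> [i\<^sub>1, \<dots>, i\<^sub>l] \<nu> v\<close> is \<open>S\<^bsub>i\<^sub>1\<^esub> (\<dots> (S\<^bsub>i\<^sub>l\<^esub> v))\<close> together with its weight:
  \<open>S\<^sub>i\<close> maps weight \<open>\<nu>\<close> to weight \<open>s\<^sub>i \<nu> = \<nu> - \<nu>(h\<^sub>i) \<alpha>\<^sub>i\<close>.
\<close>

primrec S_iter ::
  "complex \<Rightarrow> ('n::nontriv mod_ring, 'b) action \<Rightarrow> 'n mod_ring list \<Rightarrow> 'n mod_ring weight \<Rightarrow>
   ('b \<Rightarrow>\<^sub>0 complex) \<Rightarrow> 'n mod_ring weight \<times> ('b \<Rightarrow>\<^sub>0 complex)" where
  "S_iter t \<rho> [] \<nu> v = (\<nu>, v)"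
| "S_iter t \<rho> (i # is) \<nu> v =
     (let (\<mu>, u) = S_iter t \<rho> is \<nu> v in (reflection i \<mu>, S_op t \<rho> i \<mu> u))"

definition extremal_vector ::
  "complex \<Rightarrow> ('b \<Rightarrow>\<^sub>0 complex) set \<Rightarrow> ('n::nontriv mod_ring, 'b) action \<Rightarrow>
   'n mod_ring weight \<Rightarrow> ('b \<Rightarrow>\<^sub>0 complex) \<Rightarrow> bool" where
  "extremal_vector t V \<rho> \<nu> v \<longleftrightarrow>
     (\<forall>is i. case S_iter t \<rho> is \<nu> v of (\<mu>, u) \<Rightarrow> i_extremal t V \<rho> i \<mu> u)"

definition vertical_generators :: "'i \<Rightarrow> 'i gen set" where
  "vertical_generators j =
     {X \<epsilon> i s | \<epsilon> i s. i \<noteq> j} \<union> {H i m | i m. i \<noteq> j \<and> m \<noteq> 0}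
     \<union> {K h | h. h None = 0 \<and> h (Some j) = 0}"

definition extremal_loop_weight_module ::
  "complex \<Rightarrow> ('b \<Rightarrow>\<^sub>0 complex) set \<Rightarrow> ('n::nontriv mod_ring, 'b) action \<Rightarrow> 'n mod_ring monomial \<Rightarrow> bool" where
  "extremal_loop_weight_module t V \<rho> m \<longleftrightarrow>
     toroidal_module t V \<rho> \<and> integrable_module t V \<rho> \<and> is_monomial m \<and>
     (\<exists>v \<in> lweight_space t V \<rho> m.
        subalgebra_orbit \<rho> generators v = V \<and>
        extremal_vector t V \<rho> (mono_weight m) v \<and>
        (\<forall>j. \<forall>w\<in>V. \<exists>B. finite B \<and> subalgebra_orbit \<rho> (vertical_generators j) w \<subseteq> cspan B))"

section \<open>Modules given by delta functions, and the Drinfeld coproduct\<close>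

text \<open>
  All modules considered below have a basis \<open>b \<in> basis\<close> of weight vectors on which
  \<^item> \<open>\<phi>\<^sub>i\<^sup>\<plusminus>(z) b = f(z) b\<close> with \<open>f = phi_eig i b\<close> a rational function, expanded at \<open>0\<close> resp. \<open>\<infinity>\<close>;
  \<^item> \<open>x\<^sub>i\<^sup>\<epsilon>(z) b = \<Sum>\<^bsub>b'\<^esub> \<Sum>\<^bsub>\<gamma>\<^esub> x_coeff \<epsilon> i b b' \<gamma> \<delta>(\<gamma>z) b'\<close>, where \<open>b'\<close> runs over the basis and the
    sum over \<open>\<gamma>\<close> has finitely many nonzero terms.
\<close>

record ('i, 'b) loop_data =
  basis :: "'b set"
  wt :: "'b \<Rightarrow> 'i weight"
  phi_eig :: "'i \<Rightarrow> 'b \<Rightarrow> complex poly fract"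
  x_coeff :: "sign \<Rightarrow> 'i \<Rightarrow> 'b \<Rightarrow> 'b \<Rightarrow> complex \<Rightarrow> complex"

definition underlying_space :: "('i, 'b) loop_data \<Rightarrow> ('b \<Rightarrow>\<^sub>0 complex) set" where
  "underlying_space M = {v. Poly_Mapping.keys v \<subseteq> basis M}"

text \<open>
  The action of the \<open>h\<^bsub>i,m\<^esub>\<close> is not listed: it is determined by that of \<open>\<phi>\<^sub>i\<^sup>\<plusminus>(z)\<close>, since
  \<open>q - q\<^sup>-\<^sup>1 \<noteq> 0\<close> and \<open>k\<^sub>i\<close> is invertible.
\<close>

definition has_action :: "complex \<Rightarrow> ('i::finite, 'b) loop_data \<Rightarrow> ('i, 'b) action \<Rightarrow> bool" where
  "has_action t M \<rho> \<longleftrightarrow>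
     (\<forall>g\<in>generators. linear_on (underlying_space M) (\<rho> g)) \<and>
     (\<forall>b\<in>basis M.
        (\<forall>h. \<rho> (K h) (Poly_Mapping.single b 1) = Poly_Mapping.single b (q_weight t (wt M b) h)) \<and>
        (\<forall>\<epsilon> i p. phi_op t \<rho> \<epsilon> i p (Poly_Mapping.single b 1)
                  = Poly_Mapping.single b (rf_coeff \<epsilon> (phi_eig M i b) p)) \<and>
        (\<forall>\<epsilon> i s. \<forall>b'\<in>basis M.
           Poly_Mapping.lookup (\<rho> (X \<epsilon> i s) (Poly_Mapping.single b 1)) b'
           = (\<Sum>\<gamma> | x_coeff M \<epsilon> i b b' \<gamma> \<noteq> 0. x_coeff M \<epsilon> i b b' \<gamma> * \<gamma> powi s)))"

text \<open>
  Iterated Drinfeld coproduct on \<open>M\<^sub>0 \<otimes> \<dots> \<otimes> M\<^bsub>l-1\<^esub>\<close>, the basis vector \<open>b\<^sub>0 \<otimes> \<dots> \<otimes> b\<^bsub>l-1\<^esub>\<close> being the list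
  \<open>[b\<^sub>0, \<dots>, b\<^bsub>l-1\<^esub>]\<close>:
  \<open>x\<^sub>i\<^sup>+(z) \<mapsto> \<Sum>\<^sub>s \<phi>\<^sub>i\<^sup>-(z) \<otimes> \<dots> \<otimes> \<phi>\<^sub>i\<^sup>-(z) \<otimes> x\<^sub>i\<^sup>+(z) \<otimes> 1 \<otimes> \<dots> \<otimes> 1\<close> and
  \<open>x\<^sub>i\<^sup>-(z) \<mapsto> \<Sum>\<^sub>s 1 \<otimes> \<dots> \<otimes> 1 \<otimes> x\<^sub>i\<^sup>-(z) \<otimes> \<phi>\<^sub>i\<^sup>+(z) \<otimes> \<dots> \<otimes> \<phi>\<^sub>i\<^sup>+(z)\<close>, with \<open>x\<^sub>i\<^sup>\<plusminus>\<close> in position \<open>s\<close>.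
  The infinite sums are products of a rational function \<open>f\<close>, the eigenvalue \<open>coproduct_factor\<close> of the
  tensor product of the \<open>\<phi>\<^sub>i\<close>, with a \<open>\<delta>(\<gamma>z)\<close>.  As usual
  \<open>f(z) \<delta>(\<gamma>z) = f(\<gamma>\<^sup>-\<^sup>1) \<delta>(\<gamma>z)\<close>, and this is well-defined if \<open>f\<close> has no pole at \<open>\<gamma>\<^sup>-\<^sup>1\<close>.
\<close>

definition coproduct_factor ::
  "('i, 'b) loop_data list \<Rightarrow> sign \<Rightarrow> 'i \<Rightarrow> 'b list \<Rightarrow> nat \<Rightarrow> complex poly fract" where
  "coproduct_factor Ms \<epsilon> i bs s =
     (\<Prod>p\<in>(case \<epsilon> of Plus \<Rightarrow> {..<s} | Minus \<Rightarrow> {s<..<length Ms}). phi_eig (Ms ! p) i (bs ! p))"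

definition tensor :: "('i, 'b) loop_data list \<Rightarrow> ('i, 'b list) loop_data" where
  "tensor Ms =
     \<lparr> basis = {bs. length bs = length Ms \<and> (\<forall>s<length Ms. bs ! s \<in> basis (Ms ! s))},
       wt = (\<lambda>bs y. \<Sum>s<length Ms. wt (Ms ! s) (bs ! s) y),
       phi_eig = (\<lambda>i bs. \<Prod>s<length Ms. phi_eig (Ms ! s) i (bs ! s)),
       x_coeff = (\<lambda>\<epsilon> i bs bs' \<gamma>. \<Sum>s<length Ms.
          if bs' = bs[s := bs' ! s]
          then rf_eval (coproduct_factor Ms \<epsilon> i bs s) (inverse \<gamma>)
                 * x_coeff (Ms ! s) \<epsilon> i (bs ! s) (bs' ! s) \<gamma>
          else 0) \<rparr>"

definition coproduct_well_defined :: "('i, 'b) loop_data list \<Rightarrow> bool" where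
  "coproduct_well_defined Ms \<longleftrightarrow>
     (\<forall>bs\<in>basis (tensor Ms). \<forall>s<length Ms. \<forall>\<epsilon> i \<gamma>. \<forall>b'\<in>basis (Ms ! s).
        x_coeff (Ms ! s) \<epsilon> i (bs ! s) b' \<gamma> \<noteq> 0 \<longrightarrow>
        rf_regular (coproduct_factor Ms \<epsilon> i bs s) (inverse \<gamma>))"

text \<open>
  \<open>restrict_basis M B\<close> has basis \<open>basis M \<inter> B\<close>, and the operators are followed by the projection killing
  all other basis vectors (by \<open>has_action\<close>, only coefficients at elements of the basis are used).  If the
  span of \<open>basis M \<inter> B\<close> is stable, this is the submodule.
\<close>

definition restrict_basis :: "('i, 'b) loop_data \<Rightarrow> 'b set \<Rightarrow> ('i, 'b) loop_data" where
  "restrict_basis M B = M\<lparr>basis := basis M \<inter> B\<rparr>"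

section \<open>The vector representation and the column modules\<close>

text \<open>
  The weight of the box \<open>j\<close>: the box \<open>1\<close> has weight \<open>\<varpi>\<^sub>1\<close> and \<open>x\<^sub>i\<^sup>-\<close>, \<open>i\<close> the class of \<open>j\<close>, maps the
  box \<open>j\<close> to a multiple of the box \<open>j + 1\<close>, which thus has weight \<open>wt j - \<alpha>\<^sub>i\<close>.
\<close>

definition box_weight :: "int \<Rightarrow> 'n::nontriv mod_ring weight" where
  "box_weight j x = varpi 1 x
     - (\<Sum>l\<in>{1..<j}. simple_root (of_int l) x) + (\<Sum>l\<in>{j..<1}. simple_root (of_int l) x)"

definition vector_rep :: "complex \<Rightarrow> complex \<Rightarrow> ('n::nontriv mod_ring, int) loop_data" where
  "vector_rep t b =
     \<lparr> basis = UNIV,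
       wt = box_weight,
       phi_eig = (\<lambda>i j. if i = of_int j then psi t (b * exp t powi j)
                        else if i = of_int (j - 1) then inverse (psi t (b * exp t powi (j + 1)))
                        else 1),
       x_coeff = (\<lambda>\<epsilon> i j j' \<gamma>. case \<epsilon> of
            Plus \<Rightarrow> if i = of_int (j - 1) \<and> j' = j - 1 \<and> \<gamma> = b * exp t powi (j - 1) then 1 else 0
          | Minus \<Rightarrow> if i = of_int j \<and> j' = j + 1 \<and> \<gamma> = b * exp t powi j then 1 else 0) \<rparr>"

text \<open>
  The tensor product of vector representations with parameters \<open>a, a q\<^sup>-\<^sup>2, \<dots>, a q\<^bsup>-2r\<^esup>\<close>, on the vectors
  \<open>i\<^sub>1 < \<dots> < i\<^bsub>r+1\<^esub>\<close>.  On these vectors, if \<open>CARD('n) = 2 r + 2\<close> and \<open>q\<close> is not a root of unity, no pole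
  occurs in the coproduct and the span is stable.
\<close>

definition Vtilde :: "complex \<Rightarrow> nat \<Rightarrow> complex \<Rightarrow> ('n::nontriv mod_ring, int list) loop_data" where
  "Vtilde t r a =
     restrict_basis (tensor (map (\<lambda>s. vector_rep t (a * exp t powi (- 2 * int s))) [0..<r + 1]))
       {js. sorted_wrt (<) js}"

definition column_module :: "complex \<Rightarrow> nat \<Rightarrow> complex \<Rightarrow> ('n::nontriv mod_ring, int list) loop_data" where
  "column_module t r a = restrict_basis (Vtilde t r a) {js. last js - hd js \<le> int CARD('n) - 1}"

text \<open>
  The monomial \<open>e\<^bsup>k\<varpi>\<^bsub>r+1\<^esub>\<^esup> \<Prod>\<^bsub>s=1..k\<^esub> Y\<^bsub>r+1,c\<^sub>s\<^esub> Y\<^bsub>0,c\<^sub>s q\<^bsup>r+1\<^esup>\<^esub>\<^sup>-\<^sup>1\<close>.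

  For \<open>k = 1\<close> the vector \<open>1 \<otimes> 2 \<otimes> \<dots> \<otimes> (r+1)\<close> of \<open>column_module t r a\<close> has this \<open>\<ell>\<close>-weight with
  \<open>c\<^sub>1 = a q\<^bsup>-r\<^esup>\<close>: the eigenvalues of \<open>\<phi>\<^bsub>r+1\<^esub>\<close> and \<open>\<phi>\<^sub>0\<close> come from the last and the first factor and are
  \<open>\<psi>(a q\<^bsup>-2r\<^esup> q\<^bsup>r+1\<^esup> z)\<close> and \<open>\<psi>(a q\<^sup>2 z)\<^sup>-\<^sup>1\<close>, i.e. \<open>\<psi>(c\<^sub>1 q z)\<close> and \<open>\<psi>(c\<^sub>1 q\<^bsup>r+1\<^esup> q z)\<^sup>-\<^sup>1\<close>.
\<close>

definition top_monomial :: "complex \<Rightarrow> nat \<Rightarrow> nat \<Rightarrow> (nat \<Rightarrow> complex) \<Rightarrow> 'n::nontriv mod_ring monomial" where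
  "top_monomial t r k c =
     Monomial (\<lambda>x. of_nat k * varpi (of_nat (r + 1)) x)
          (\<lambda>i b. \<Sum>s\<in>{1..k}. (if i = of_nat (r + 1) \<and> b = c s then 1 else 0)
                            - (if i = 0 \<and> b = c s * exp t ^ (r + 1) then 1 else 0))"

end

theory Submission
  imports Defs
begin

text \<open>
  A column is a subset of \<open>\<int>\<close> with \<open>r + 1\<close> elements modulo the period \<open>2r + 2\<close>. On it every \<open>\<phi>\<^sub>i\<close> has the
  eigenvalue \<open>\<psi>(\<gamma>z)\<close>, \<open>\<psi>(\<gamma>q\<^sup>2z)\<^sup>-\<^sup>1\<close> or \<open>1\<close>, and \<open>x\<^sub>i\<^sup>\<plusminus>(z)\<close> moves at most one box, with coefficient \<open>\<delta>(\<gamma>z)\<close>.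
  As \<open>n + 1\<close> is even, \<open>\<gamma>\<close> is determined up to \<open>q\<^sup>2\<^sup>\<int>\<close> by the node and the tensor factor, so the assumption
  on \<open>a\<^sub>i / a\<^sub>j\<close> puts the parameters of different factors into different cosets. Hence the factors
  created by the coproduct are finite and nonzero. A move with parameter \<open>\<gamma>\<close> multiplies the
  eigenvalues by \<open>(Q - \<gamma>z) / (1 - Q\<gamma>z)\<close>, where \<open>Q\<close> is a power of \<open>q\<close>; this gives the exchange relations,
  the commutator relation is a partial fraction decomposition, and the Serre relation reduces to a
  polynomial identity.

  The poles and zeros of the eigenvalues separate the basis vectors, which gives thinness; since
  every basis vector is reachable from every other one by moves, the module is irreducible. The
  orbit of the highest column tuple under the \<open>S\<^sub>i\<close> consists of tuples of equal columns. The
  subalgebra without the node \<open>j\<close> only reaches finitely many vectors because no box passes \<open>j\<close>.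
\<close>

section \<open>Linear extensions\<close>

text \<open>The height r + 1 is half of the period 2r + 2, and this is what makes columns tractable.
  The box in position s carries the parameter a q^(-2s), so continuing a column by translates, r + 1
  positions and 2r + 2 units further on, leaves j - 2s unchanged: the spectral parameter seen by a
  node does not jump at the end of the column. Hence boxes in neighbouring classes contribute
  cancelling eigenvalues, even if one is the last and the other the first box, and every node sees
  at most one simple pole.

  The argument for tensor products uses only the facts collected in the locale
  \<open>column_system\<close> and never looks inside a column. As the coproduct is not symmetric,
  interchanging moves in two factors changes their coefficients; this asymmetry is confined to the
  scalars \<open>theta\<close>, whose denominators are nonzero by genericity.

  The generators h_{i,m} have no formula of their own: their eigenvalues are read off from the
  logarithms of the expansions of the \<phi> eigenvalues at 0 and at infinity, after division by the
  constant term.\<close>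

lemma lookup_cscale [simp]: "Poly_Mapping.lookup (c *\<^sub>C v) b = c * Poly_Mapping.lookup v b"
  by (simp add: cscale_def Poly_Mapping.map.rep_eq when_def)

lemma cscale_simps [simp]:
  "0 *\<^sub>C v = 0" "1 *\<^sub>C v = v" "c *\<^sub>C 0 = 0" "c *\<^sub>C d *\<^sub>C v = (c * d) *\<^sub>C v"
  by (simp_all add: cv.scale_scale)

lemma cscale_single [simp]: "c *\<^sub>C Poly_Mapping.single b d = Poly_Mapping.single b (c * d)"
  by (rule poly_mapping_eqI) (simp add: lookup_single when_def)

text \<open>All operators below are linear extensions of maps on basis vectors. An identity between
  composites is brought into the form \<open>lin f v = lin g v\<close> by the rules that follow and
  is then checked on basis vectors.\<close>

definition lin :: "('a \<Rightarrow> ('b \<Rightarrow>\<^sub>0 complex)) \<Rightarrow> ('a \<Rightarrow>\<^sub>0 complex) \<Rightarrow> ('b \<Rightarrow>\<^sub>0 complex)" where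
  "lin f v = (\<Sum>b\<in>Poly_Mapping.keys v. Poly_Mapping.lookup v b *\<^sub>C f b)"

lemma lin_superset:
  assumes "finite A" "Poly_Mapping.keys v \<subseteq> A"
  shows "lin f v = (\<Sum>b\<in>A. Poly_Mapping.lookup v b *\<^sub>C f b)"
  unfolding lin_def using assms
  by (intro sum.mono_neutral_left) (auto simp: in_keys_iff)

lemma lin_single [simp]: "lin f (Poly_Mapping.single b c) = c *\<^sub>C f b"
  by (simp add: lin_superset[where A = "{b}"])

lemma lin_zero [simp]: "lin f 0 = 0"
  by (simp add: lin_def)

lemma lin_zero_fun [simp]: "lin (\<lambda>b. 0) v = 0"
  by (simp add: lin_def)

lemma lin_add: "lin f (u + v) = lin f u + lin f v"
proof -
  let ?A = "Poly_Mapping.keys u \<union> Poly_Mapping.keys v"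
  have "Poly_Mapping.keys (u + v) \<subseteq> ?A" by (rule keys_add)
  then show ?thesis
    by (simp add: lin_superset[where A = ?A] lookup_add cv.scale_left_distrib sum.distrib)
qed

lemma lin_scale: "lin f (c *\<^sub>C v) = c *\<^sub>C lin f v"
proof -
  have "Poly_Mapping.keys (c *\<^sub>C v) \<subseteq> Poly_Mapping.keys v" by (auto simp: in_keys_iff)
  then show ?thesis
    by (simp add: lin_superset[where A = "Poly_Mapping.keys v"] cv.scale_sum_right)
qed

lemma lin_sum: "lin f (\<Sum>x\<in>A. g x) = (\<Sum>x\<in>A. lin f (g x))"
  by (induction A rule: infinite_finite_induct) (simp_all add: lin_add)

lemma lin_lin: "lin f (lin g v) = lin (\<lambda>b. lin f (g b)) v"
  by (simp add: lin_def[of g] lin_def[of "\<lambda>b. lin f (g b)"] lin_sum lin_scale)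

lemma lin_plus_fun: "lin f v + lin g v = lin (\<lambda>b. f b + g b) v"
  by (simp add: lin_def sum.distrib cv.scale_right_distrib)

lemma lin_minus_fun: "lin f v - lin g v = lin (\<lambda>b. f b - g b) v"
  by (simp add: lin_def sum_subtractf cv.scale_right_diff_distrib)

lemma lin_scale_fun: "c *\<^sub>C lin f v = lin (\<lambda>b. c *\<^sub>C f b) v"
  by (simp add: lin_def cv.scale_sum_right mult.commute)

lemma lin_sum_fun: "(\<Sum>x\<in>A. lin (f x) v) = lin (\<lambda>b. \<Sum>x\<in>A. f x b) v"
  by (simp add: lin_def cv.scale_sum_right sum.swap[of _ A])

lemma lin_cong: "(\<And>b. b \<in> Poly_Mapping.keys v \<Longrightarrow> f b = g b) \<Longrightarrow> lin f v = lin g v"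
  by (simp add: lin_def)

lemma lin_id [simp]: "lin (\<lambda>b. Poly_Mapping.single b 1) v = v"
proof (rule poly_mapping_eqI)
  fix b
  show "Poly_Mapping.lookup (lin (\<lambda>b. Poly_Mapping.single b 1) v) b = Poly_Mapping.lookup v b"
    by (simp add: lin_def lookup_sum lookup_single when_def in_keys_iff if_distrib cong: if_cong)
qed

lemma lookup_lin_diag [simp]:
  "Poly_Mapping.lookup (lin (\<lambda>b. Poly_Mapping.single b (w b)) v) b = w b * Poly_Mapping.lookup v b"
  by (simp add: lin_def lookup_sum lookup_single when_def in_keys_iff if_distrib mult.commute cong: if_cong)

lemma lin_diag_diag:
  "lin (\<lambda>b. Poly_Mapping.single b (w b)) (lin (\<lambda>b. Poly_Mapping.single b (w' b)) v) =
   lin (\<lambda>b. Poly_Mapping.single b (w b * w' b)) v"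
  by (rule poly_mapping_eqI) simp

lemma csubspace_iff:
  "csubspace V \<longleftrightarrow> 0 \<in> V \<and> (\<forall>u\<in>V. \<forall>v\<in>V. u + v \<in> V) \<and> (\<forall>c. \<forall>v\<in>V. c *\<^sub>C v \<in> V)"
  by (simp add: cv.subspace_def)

lemma csubspace_keys: "csubspace {v. Poly_Mapping.keys v \<subseteq> B}"
  unfolding csubspace_iff by (auto simp: subset_iff in_keys_iff lookup_add) (metis add.right_neutral)

lemma lin_in_subspace:
  assumes "csubspace V" "\<And>b. b \<in> Poly_Mapping.keys v \<Longrightarrow> f b \<in> V"
  shows "lin f v \<in> V"
  unfolding lin_def using assms by (intro cv.subspace_sum cv.subspace_scale) auto

lemma in_cspan_singles:
  assumes "Poly_Mapping.keys v \<subseteq> B"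
  shows "v \<in> cspan ((\<lambda>b. Poly_Mapping.single b 1) ` B)"
proof -
  have "lin (\<lambda>b. Poly_Mapping.single b 1) v \<in> cspan ((\<lambda>b. Poly_Mapping.single b 1) ` B)"
    using assms by (intro lin_in_subspace cv.subspace_span) (auto intro: cv.span_base)
  then show ?thesis by simp
qed

section \<open>Expansions of rational functions\<close>

text \<open>Cross-multiplication works because P Q' = P' Q forces deg P + deg Q' = deg P' + deg Q,
  so the monomial factors of both sides agree. Degrees do not add for the zero polynomial, which is
  therefore treated apart.\<close>

lemma rf_expand_inf_unique:
  assumes "Q \<noteq> 0" "Q' \<noteq> 0" "P * Q' = P' * Q"
    and F: "F * fps_of_poly (Polynomial.monom 1 (Polynomial.degree P) * reflect_poly Q)
       = fps_of_poly (Polynomial.monom 1 (Polynomial.degree Q) * reflect_poly P)"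
    and G: "G * fps_of_poly (Polynomial.monom 1 (Polynomial.degree P') * reflect_poly Q')
       = fps_of_poly (Polynomial.monom 1 (Polynomial.degree Q') * reflect_poly P')"
  shows "G = (F :: complex fps)"
proof (cases "P = 0")
  case True
  then have "P' = 0" using assms by auto
  have "F = 0" using F True assms(1) by (simp add: fps_of_poly_mult fps_of_poly_monom)
  moreover have "G = 0" using G \<open>P' = 0\<close> assms(2) by (simp add: fps_of_poly_mult fps_of_poly_monom)
  ultimately show ?thesis by simp
next
  case False
  then have "P' \<noteq> 0" using assms by auto
  have deg: "Polynomial.degree P + Polynomial.degree Q' = Polynomial.degree P' + Polynomial.degree Q"
    using assms(1-3) False \<open>P' \<noteq> 0\<close> by (metis degree_mult_eq)
  have refl: "reflect_poly P * reflect_poly Q' = reflect_poly P' * reflect_poly Q"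
    using assms(3) by (metis reflect_poly_mult)
  let ?m = "\<lambda>n. Polynomial.monom (1::complex) n"
  have mm: "?m (Polynomial.degree P) * ?m (Polynomial.degree Q') = ?m (Polynomial.degree P') * ?m (Polynomial.degree Q)"
    by (simp add: mult_monom deg)
  let ?d = "fps_of_poly (?m (Polynomial.degree P) * reflect_poly Q)"
  let ?d' = "fps_of_poly (?m (Polynomial.degree P') * reflect_poly Q')"
  have "F * ?d * ?d' = G * ?d' * ?d"
  proof -
    have "(?m (Polynomial.degree Q) * reflect_poly P) * (?m (Polynomial.degree P') * reflect_poly Q')
        = (?m (Polynomial.degree P') * ?m (Polynomial.degree Q)) * (reflect_poly P * reflect_poly Q')"
      by (simp add: algebra_simps)
    also have "\<dots> = (?m (Polynomial.degree P) * ?m (Polynomial.degree Q')) * (reflect_poly P' * reflect_poly Q)"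
      by (simp only: mm refl)
    also have "\<dots> = (?m (Polynomial.degree Q') * reflect_poly P') * (?m (Polynomial.degree P) * reflect_poly Q)"
      by (simp add: algebra_simps)
    finally show ?thesis unfolding F G fps_of_poly_mult[symmetric] by simp
  qed
  then have "(F - G) * (?d * ?d') = 0" by (simp add: algebra_simps)
  moreover have "?d * ?d' \<noteq> 0"
    using assms(1,2) by (simp add: fps_of_poly_mult fps_of_poly_monom)
  ultimately show ?thesis by auto
qed

lemma rf_expand_inf_eqI:
  assumes "Q \<noteq> 0"
    and "F * fps_of_poly (Polynomial.monom 1 (Polynomial.degree P) * reflect_poly Q)
       = fps_of_poly (Polynomial.monom 1 (Polynomial.degree Q) * reflect_poly P)"
  shows "rf_expand_inf (Fract P Q) = F"
  unfolding rf_expand_inf_def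
proof (rule the_equality)
  show "\<exists>P' Q'. Q' \<noteq> 0 \<and> Fract P Q = Fract P' Q' \<and>
     F * fps_of_poly (Polynomial.monom 1 (Polynomial.degree P') * reflect_poly Q')
       = fps_of_poly (Polynomial.monom 1 (Polynomial.degree Q') * reflect_poly P')"
    using assms by blast
next
  fix G
  assume "\<exists>P' Q'. Q' \<noteq> 0 \<and> Fract P Q = Fract P' Q' \<and>
     G * fps_of_poly (Polynomial.monom 1 (Polynomial.degree P') * reflect_poly Q')
       = fps_of_poly (Polynomial.monom 1 (Polynomial.degree Q') * reflect_poly P')"
  then obtain P' Q' where e: "Q' \<noteq> 0" "Fract P Q = Fract P' Q'"
     "G * fps_of_poly (Polynomial.monom 1 (Polynomial.degree P') * reflect_poly Q')
       = fps_of_poly (Polynomial.monom 1 (Polynomial.degree Q') * reflect_poly P')"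
    by blast
  have "P * Q' = P' * Q" using e assms(1) by (simp add: eq_fract)
  then show "G = F" using rf_expand_inf_unique[of Q Q' P P' F G] assms e by blast
qed

text \<open>For u = 1, 0, -1 this is \<psi>(gz), 1 and \<psi>(g q^2 z)^(-1). The shift by q^2 in the
  last case puts the pole at z = 1/g in both nontrivial cases, so that one parameter serves for
  either sign of the weight.\<close>

definition phi_factor :: "complex \<Rightarrow> int \<Rightarrow> complex \<Rightarrow> complex poly fract" where
  "phi_factor t u g = Fract [:exp t powi u, - (exp t powi (- u) * g):] [:1, - g:]"

lemma psi_eq_phi_factor: "psi t c = phi_factor t 1 c"
  by (simp add: psi_def phi_factor_def power_int_minus)

lemma phi_factor_0 [simp]: "phi_factor t 0 c = 1"
  by (simp add: phi_factor_def One_fract_def eq_fract)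

lemma inverse_psi_eq_phi_factor:
  assumes "d = c * exp t ^ 2"
  shows "inverse (psi t d) = phi_factor t (-1) c"
  by (simp add: psi_def phi_factor_def eq_fract assms power_int_minus power2_eq_square mult.assoc)

lemma rf_regular_phi_factor:
  assumes "g * x \<noteq> 1"
  shows "rf_regular (phi_factor t u g) x"
  unfolding rf_regular_def phi_factor_def using assms
  by (intro exI[of _ "[:exp t powi u, - (exp t powi (- u) * g):]"] exI[of _ "[:1, - g:]"])
     (auto simp: mult.commute)

lemma rf_regular_1 [simp]: "rf_regular 1 x"
  unfolding rf_regular_def by (rule exI[of _ 1], rule exI[of _ 1]) (simp add: One_fract_def)

lemma rf_eval_1 [simp]: "rf_eval 1 x = 1"
  using rf_eval_Fract[of 1 x 1] by (simp add: One_fract_def)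

lemma rf_regular_mult:
  assumes "rf_regular f x" "rf_regular g x"
  shows "rf_regular (f * g) x" and "rf_eval (f * g) x = rf_eval f x * rf_eval g x"
proof -
  from assms obtain P Q P' Q' where *: "f = Fract P Q" "poly Q x \<noteq> 0" "g = Fract P' Q'" "poly Q' x \<noteq> 0"
    unfolding rf_regular_def by blast
  then have fg: "f * g = Fract (P * P') (Q * Q')" "poly (Q * Q') x \<noteq> 0" by auto
  show "rf_regular (f * g) x" unfolding rf_regular_def using fg by blast
  show "rf_eval (f * g) x = rf_eval f x * rf_eval g x"
    using * fg by (simp add: rf_eval_Fract)
qed

lemma rf_regular_prod:
  assumes "\<And>p. p \<in> A \<Longrightarrow> rf_regular (f p) x"
  shows "rf_regular (\<Prod>p\<in>A. f p) x" and "rf_eval (\<Prod>p\<in>A. f p) x = (\<Prod>p\<in>A. rf_eval (f p) x)"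
  using assms by (induction A rule: infinite_finite_induct) (simp_all add: rf_regular_mult)

definition phi_value :: "complex \<Rightarrow> int \<Rightarrow> complex \<Rightarrow> complex" where
  "phi_value t u y = (exp t powi u - exp t powi (- u) * y) / (1 - y)"

lemma rf_eval_phi_factor:
  assumes "g * x \<noteq> 1"
  shows "rf_eval (phi_factor t u g) x = phi_value t u (g * x)"
  using assms by (simp add: phi_factor_def rf_eval_Fract phi_value_def algebra_simps)

lemma phi_value_0 [simp]: "y \<noteq> 1 \<Longrightarrow> phi_value t 0 y = 1"
  by (simp add: phi_value_def)

definition rf_expand :: "sign \<Rightarrow> complex poly fract \<Rightarrow> complex fps" where
  "rf_expand \<epsilon> f = (case \<epsilon> of Plus \<Rightarrow> rf_expand_0 f | Minus \<Rightarrow> rf_expand_inf f)"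

text \<open>The index p is always the exponent of z; for \<open>Minus\<close> the series is one in
  1/z and only p \<le> 0 contributes.\<close>

definition series_coeff :: "sign \<Rightarrow> complex fps \<Rightarrow> int \<Rightarrow> complex" where
  "series_coeff \<epsilon> F p = (if sg \<epsilon> * p \<ge> 0 then fps_nth F (nat \<bar>p\<bar>) else 0)"

lemma rf_coeff_eq: "rf_coeff \<epsilon> f p = series_coeff \<epsilon> (rf_expand \<epsilon> f) p"
  by (simp add: rf_coeff_def series_coeff_def rf_expand_def)

text \<open>
  Homogeneous coordinates for \<open>z\<close>: the point \<open>z = hom_z / hom_1\<close> is \<open>X\<close> at \<open>0\<close> and \<open>1/X\<close> at \<open>\<infinity>\<close>, so
  that identities between both kinds of expansions can be proved simultaneously.
\<close>

definition hom_1 :: "sign \<Rightarrow> complex fps" where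
  "hom_1 \<epsilon> = (case \<epsilon> of Plus \<Rightarrow> 1 | Minus \<Rightarrow> fps_X)"

definition hom_z :: "sign \<Rightarrow> complex fps" where
  "hom_z \<epsilon> = (case \<epsilon> of Plus \<Rightarrow> fps_X | Minus \<Rightarrow> 1)"

definition phi_series :: "complex \<Rightarrow> sign \<Rightarrow> int \<Rightarrow> complex \<Rightarrow> complex fps" where
  "phi_series t \<epsilon> u g =
     (fps_const (exp t powi u) * hom_1 \<epsilon> - fps_const (exp t powi (- u) * g) * hom_z \<epsilon>)
       / (hom_1 \<epsilon> - fps_const g * hom_z \<epsilon>)"

lemma hom_denominator_unit:
  assumes "g \<noteq> 0"
  shows "fps_nth (hom_1 \<epsilon> - fps_const g * hom_z \<epsilon>) 0 \<noteq> 0"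
  using assms by (cases \<epsilon>) (simp_all add: hom_1_def hom_z_def)

lemma hom_denominator_nonzero:
  assumes "g \<noteq> 0"
  shows "hom_1 \<epsilon> - fps_const g * hom_z \<epsilon> \<noteq> 0"
  using hom_denominator_unit[OF assms, of \<epsilon>] by auto

lemma fps_divide_unit_times: "fps_nth b 0 \<noteq> 0 \<Longrightarrow> a / b * b = (a :: complex fps)"
  by (simp add: fps_divide_unit mult.assoc inverse_mult_eq_1)

lemma phi_series_times:
  assumes "g \<noteq> 0"
  shows "phi_series t \<epsilon> u g * (hom_1 \<epsilon> - fps_const g * hom_z \<epsilon>)
    = fps_const (exp t powi u) * hom_1 \<epsilon> - fps_const (exp t powi (- u) * g) * hom_z \<epsilon>"
  unfolding phi_series_def by (rule fps_divide_unit_times[OF hom_denominator_unit[OF assms]])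

lemma phi_series_nth_0:
  assumes "g \<noteq> 0"
  shows "fps_nth (phi_series t \<epsilon> u g) 0 = exp t powi (sg \<epsilon> * u)"
  using arg_cong[OF phi_series_times[OF assms, of t \<epsilon> u], of "\<lambda>F. fps_nth F 0"] assms
  by (cases \<epsilon>) (simp_all add: hom_1_def hom_z_def)

lemma phi_series_0 [simp]: "g \<noteq> 0 \<Longrightarrow> phi_series t \<epsilon> 0 g = 1"
  using phi_series_times[of g t \<epsilon> 0] hom_denominator_nonzero[of g \<epsilon>]
  by simp

lemma prod_phi_factor:
  "(\<Prod>p\<in>A. phi_factor t (u p) (g p)) =
    Fract (\<Prod>p\<in>A. [:exp t powi u p, - (exp t powi (- u p) * g p):]) (\<Prod>p\<in>A. [:1, - g p:])"
  by (induction A rule: infinite_finite_induct) (simp_all add: phi_factor_def One_fract_def)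

lemma phi_series_prod_times_poly:
  assumes "\<And>p. p \<in> A \<Longrightarrow> g p \<noteq> 0"
  shows "(\<Prod>p\<in>A. phi_series t Plus (u p) (g p)) * fps_of_poly (\<Prod>p\<in>A. [:1, - g p:])
    = fps_of_poly (\<Prod>p\<in>A. [:exp t powi u p, - (exp t powi (- u p) * g p):])"
  unfolding fps_of_poly_prod prod.distrib[symmetric]
proof (intro prod.cong refl)
  fix p assume "p \<in> A"
  then show "phi_series t Plus (u p) (g p) * fps_of_poly [:1, - g p:] = fps_of_poly [:exp t powi u p, - (exp t powi - u p * g p):]"
    using phi_series_times[OF assms[of p], of t Plus "u p"]
    by (simp add: hom_1_def hom_z_def fps_of_poly_pCons flip: fps_const_neg)
qed

text \<open>At infinity the numerator and the denominator have equal degree, since no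
  \<open>g p\<close> is zero, so the two monomials in the definition of the expansion cancel and the
  expansion is multiplicative as at 0.\<close>

lemma rf_expand_prod_phi_factor:
  assumes "finite A" "\<And>p. p \<in> A \<Longrightarrow> g p \<noteq> 0"
  shows "rf_expand \<epsilon> (\<Prod>p\<in>A. phi_factor t (u p) (g p)) = (\<Prod>p\<in>A. phi_series t \<epsilon> (u p) (g p))"
proof -
  let ?P = "\<lambda>p. [:exp t powi u p, - (exp t powi (- u p) * g p):]" and ?Q = "\<lambda>p. [:1, - g p:]"
  have Q0: "(\<Prod>p\<in>A. ?Q p) \<noteq> 0" using assms by simp
  show ?thesis
  proof (cases \<epsilon>)
    case Plus
    show ?thesis
      by (simp add: Plus rf_expand_def prod_phi_factor
        rf_expand_0_eqI[OF Q0 phi_series_prod_times_poly[OF assms(2)]])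
  next
    case Minus
    have deg: "Polynomial.degree (\<Prod>p\<in>A. ?Q p) = Polynomial.degree (\<Prod>p\<in>A. ?P p)"
      using assms by (subst (1 2) degree_prod_eq_sum_degree) auto
    have "(\<Prod>p\<in>A. phi_series t Minus (u p) (g p)) * fps_of_poly (reflect_poly (\<Prod>p\<in>A. ?Q p))
      = (\<Prod>p\<in>A. phi_series t Minus (u p) (g p) * fps_of_poly (reflect_poly (?Q p)))"
      by (simp only: fps_of_poly_prod prod.distrib reflect_poly_prod)
    also have "\<dots> = (\<Prod>p\<in>A. fps_of_poly (reflect_poly (?P p)))"
    proof (intro prod.cong refl)
      fix p assume "p \<in> A"
      then show "phi_series t Minus (u p) (g p) * fps_of_poly (reflect_poly (?Q p)) = fps_of_poly (reflect_poly (?P p))"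
        using phi_series_times[OF assms(2)[of p], of t Minus "u p"] assms(2)[of p]
        by (simp add: hom_1_def hom_z_def fps_of_poly_pCons reflect_poly_pCons flip: fps_const_neg)
    qed
    finally have "(\<Prod>p\<in>A. phi_series t Minus (u p) (g p)) * fps_of_poly (reflect_poly (\<Prod>p\<in>A. ?Q p))
      = fps_of_poly (reflect_poly (\<Prod>p\<in>A. ?P p))"
      by (simp only: fps_of_poly_prod reflect_poly_prod)
    then show ?thesis
      by (simp add: Minus rf_expand_def prod_phi_factor rf_expand_inf_eqI[OF Q0] fps_of_poly_mult deg)
  qed
qed

text \<open>Relative to \<open>hom_1\<close>, multiplication by \<open>hom_z\<close> raises the
  exponent of z by one in either kind of expansion. One equation between series therefore yields the
  same recursion for the coefficients of z^p in both cases.\<close>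

lemma series_coeff_shift:
  assumes "(hom_1 \<epsilon> - fps_const a * hom_z \<epsilon>) * F = (fps_const b * hom_1 \<epsilon> - fps_const c * hom_z \<epsilon>) * G"
  shows "series_coeff \<epsilon> F p - a * series_coeff \<epsilon> F (p - 1)
    = b * series_coeff \<epsilon> G p - c * series_coeff \<epsilon> G (p - 1)"
proof (cases \<epsilon>)
  case Plus
  have eq: "fps_nth (F - fps_const a * (fps_X * F)) n = fps_nth (fps_const b * G - fps_const c * (fps_X * G)) n" for n
    using assms Plus by (simp add: hom_1_def hom_z_def left_diff_distrib mult.assoc del: fps_sub_nth fps_mult_fps_X_commute)
  show ?thesis
  proof (cases "p \<ge> 0")
    case True
    then show ?thesis using eq[of "nat p"] Plus
      by (auto simp: series_coeff_def nat_diff_distrib split: if_splits)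
  next
    case False
    then show ?thesis using Plus by (simp add: series_coeff_def)
  qed
next
  case Minus
  have eq: "fps_nth (fps_X * F - fps_const a * F) n = fps_nth (fps_const b * (fps_X * G) - fps_const c * G) n" for n
    using assms Minus by (simp add: hom_1_def hom_z_def left_diff_distrib mult.assoc del: fps_sub_nth fps_mult_fps_X_commute)
  show ?thesis
  \<comment> \<open>The bound is 1 and not 0: at p = 1 the coefficients with index p vanish, but
    those with index p - 1 are the constant terms of the series in 1/z.\<close>
  proof (cases "p \<le> 1")
    case True
    have "nat \<bar>p\<bar> = nat (1 - p) - 1" if "p \<le> 0" using that by auto
    moreover have "nat \<bar>p - 1\<bar> = nat (1 - p)" using True by auto
    ultimately show ?thesis using eq[of "nat (1 - p)"] Minus True
      by (auto simp: series_coeff_def split: if_splits)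
  next
    case False
    then show ?thesis using Minus by (simp add: series_coeff_def)
  qed
qed



section \<open>Partial fractions and the difference of the two expansions\<close>

lemma fps_const_prod: "fps_const (\<Prod>x\<in>A. f x) = (\<Prod>x\<in>A. fps_const (f x :: complex))"
  by (induction A rule: infinite_finite_induct) (simp_all flip: fps_const_mult)

lemma fps_const_sum: "fps_const (\<Sum>x\<in>A. f x) = (\<Sum>x\<in>A. fps_const (f x :: complex))"
  by (induction A rule: infinite_finite_induct) (simp_all flip: fps_const_add)

text \<open>With z = X1/X0, \<open>E p\<close> is the eigenvalue factor with pole 1/g, and
  \<open>G p\<close> is 1/(1 - gz). The additive constant is the limit at z = infinity, and each
  simple pole carries the product of the other factors at that pole. The series X0 and X1 are
  arbitrary because the statement is applied to the expansions at 0 and at infinity and, inside its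
  own induction, to a single point given by constant series.\<close>

lemma partial_fractions:
  fixes u :: "'a \<Rightarrow> int" and g :: "'a \<Rightarrow> complex" and X0 X1 :: "complex fps" and E G :: "'a \<Rightarrow> complex fps"
  assumes "finite A" "\<And>p. p \<in> A \<Longrightarrow> g p \<noteq> 0"
    and "\<And>p p'. p \<in> A \<Longrightarrow> p' \<in> A \<Longrightarrow> p \<noteq> p' \<Longrightarrow> g p \<noteq> g p'"
    and "\<And>p. p \<in> A \<Longrightarrow> X0 - fps_const (g p) * X1 \<noteq> 0"
    and "\<And>p. p \<in> A \<Longrightarrow> E p * (X0 - fps_const (g p) * X1)
            = fps_const (exp t powi u p) * X0 - fps_const (exp t powi (- u p) * g p) * X1"
    and "\<And>p. p \<in> A \<Longrightarrow> G p * (X0 - fps_const (g p) * X1) = X0"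
  shows "(\<Prod>p\<in>A. E p) = fps_const (\<Prod>p\<in>A. exp t powi (- u p)) +
     (\<Sum>p\<in>A. fps_const ((exp t powi u p - exp t powi (- u p)) *
          (\<Prod>p'\<in>A - {p}. phi_value t (u p') (g p' / g p))) * G p)"
  using assms
proof (induction A arbitrary: X0 X1 E G rule: finite_induct)
  case empty
  then show ?case by simp
next
  case (insert x0 A)
  define \<kappa> where "\<kappa> = (\<Prod>p\<in>A. exp t powi (- u p))"
  define R where "R = (\<lambda>p. (exp t powi u p - exp t powi (- u p)) *
          (\<Prod>p'\<in>A - {p}. phi_value t (u p') (g p' / g p)))"
  define d where "d = exp t powi u x0 - exp t powi (- u x0)"
  have ne: "g p \<noteq> g x0" if "p \<in> A" for p using insert.prems(2)[of p x0] insert.hyps that by auto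
  have IH: "(\<Prod>p\<in>A. E' p) = fps_const \<kappa> + (\<Sum>p\<in>A. fps_const (R p) * G' p)"
    if "\<And>p. p \<in> A \<Longrightarrow> Y0 - fps_const (g p) * Y1 \<noteq> 0"
    and "\<And>p. p \<in> A \<Longrightarrow> E' p * (Y0 - fps_const (g p) * Y1)
            = fps_const (exp t powi u p) * Y0 - fps_const (exp t powi (- u p) * g p) * Y1"
    and "\<And>p. p \<in> A \<Longrightarrow> G' p * (Y0 - fps_const (g p) * Y1) = Y0" for Y0 Y1 E' G'
    unfolding \<kappa>_def R_def using insert.prems(1,2) that by (intro insert.IH) auto
  \<comment> \<open>the identity for \<open>A\<close> at the point \<open>z = 1 / g x0\<close>\<close>
  have val: "(\<Prod>p\<in>A. phi_value t (u p) (g p / g x0)) = \<kappa> + (\<Sum>p\<in>A. R p * (g x0 / (g x0 - g p)))"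
  proof -
    have g0: "g x0 \<noteq> 0" using insert.prems(1) by simp
    have ne': "1 - g p / g x0 \<noteq> 0" if "p \<in> A" for p using ne[OF that] g0 by (auto simp: field_simps)
    have "(\<Prod>p\<in>A. fps_const (phi_value t (u p) (g p / g x0)))
      = fps_const \<kappa> + (\<Sum>p\<in>A. fps_const (R p) * fps_const (g x0 / (g x0 - g p)))"
    proof (rule IH[of 1 "fps_const (1 / g x0)"])
      fix p assume p: "p \<in> A"
      have "fps_nth (1 - fps_const (g p) * fps_const (1 / g x0)) 0 \<noteq> 0" using ne'[OF p] by simp
      then show "1 - fps_const (g p) * fps_const (1 / g x0) \<noteq> 0" by (metis fps_zero_nth)
      show "fps_const (phi_value t (u p) (g p / g x0)) * (1 - fps_const (g p) * fps_const (1 / g x0)) =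
         fps_const (exp t powi u p) * 1 - fps_const (exp t powi - u p * g p) * fps_const (1 / g x0)"
        using ne'[OF p] by (simp add: phi_value_def flip: fps_const_1_eq_1)
      show "fps_const (g x0 / (g x0 - g p)) * (1 - fps_const (g p) * fps_const (1 / g x0)) = 1"
        using ne[OF p] g0 by (simp add: field_simps flip: fps_const_1_eq_1)
    qed
    then have "fps_const (\<Prod>p\<in>A. phi_value t (u p) (g p / g x0)) =
        fps_const (\<kappa> + (\<Sum>p\<in>A. R p * (g x0 / (g x0 - g p))))"
      by (simp add: fps_const_prod flip: fps_const_sum)
    then show ?thesis by simp
  qed
  have dec: "E x0 = fps_const (exp t powi (- u x0)) + fps_const d * G x0"
  proof -
    let ?D = "X0 - fps_const (g x0) * X1"
    have "(fps_const (exp t powi (- u x0)) + fps_const d * G x0) * ?D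
      = fps_const (exp t powi (- u x0)) * ?D + fps_const d * X0"
      using insert.prems(5)[of x0] by (simp add: distrib_right mult.assoc)
    also have "\<dots> = E x0 * ?D"
      using insert.prems(4)[of x0] unfolding d_def
      by (simp add: algebra_simps flip: fps_const_sub fps_const_mult)
    finally show ?thesis using insert.prems(3)[of x0] by simp
  qed
  \<comment> \<open>The product of two distinct simple poles is a linear combination of the two;
    this turns the product of the new factor with the old expansion into an expansion of the same
    kind.\<close>
  have GG: "G x0 * G p = fps_const (g p / (g p - g x0)) * G p - fps_const (g x0 / (g p - g x0)) * G x0"
    if p: "p \<in> A" for p
  proof -
    let ?D = "X0 - fps_const (g x0) * X1" and ?Dp = "X0 - fps_const (g p) * X1"
    define e where "e = 1 / (g p - g x0)"
    have e: "e * (g p - g x0) = 1" using ne[OF p] by (simp add: e_def)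
    have ec: "fps_const e * (fps_const (g p) - fps_const (g x0)) = 1"
      using e by (simp flip: fps_const_1_eq_1)
    have 1: "G x0 * ?D = X0" "G p * ?Dp = X0" using insert.prems(5) p by auto
    have "(fps_const (g p * e) * G p - fps_const (g x0 * e) * G x0) * (?D * ?Dp)
      = fps_const (g p * e) * (G p * ?Dp) * ?D - fps_const (g x0 * e) * (G x0 * ?D) * ?Dp"
      by (simp only: algebra_simps)
    also have "\<dots> = (fps_const e * (fps_const (g p) - fps_const (g x0))) * X0 * X0"
      unfolding 1 by (simp add: algebra_simps flip: fps_const_mult del: fps_const_sub)
    also have "\<dots> = (G x0 * ?D) * (G p * ?Dp)" unfolding ec 1 by simp
    also have "\<dots> = (G x0 * G p) * (?D * ?Dp)" by (simp only: algebra_simps)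
    finally show ?thesis using insert.prems(3) p by (simp add: e_def)
  qed
  have R': "R p * phi_value t (u x0) (g x0 / g p) = R p * exp t powi (- u x0) + d * R p * (g p / (g p - g x0))"
    if p: "p \<in> A" for p
    using ne[OF p] insert.prems(1)[of p] p
    by (simp add: phi_value_def d_def divide_simps) (simp add: algebra_simps)
  define \<sigma> where "\<sigma> = (\<Sum>p\<in>A. R p * (g x0 / (g p - g x0)))"
  have "(\<Prod>p\<in>insert x0 A. E p) = E x0 * (fps_const \<kappa> + (\<Sum>p\<in>A. fps_const (R p) * G p))"
    using insert.hyps insert.prems by (subst IH[of X0 X1, symmetric]) auto
  also have "\<dots> = fps_const (exp t powi (- u x0)) * (fps_const \<kappa> + (\<Sum>p\<in>A. fps_const (R p) * G p))
      + (fps_const d * fps_const \<kappa> * G x0 + fps_const d * (\<Sum>p\<in>A. fps_const (R p) * (G x0 * G p)))"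
    unfolding dec by (simp add: algebra_simps sum_distrib_left)
  also have "(\<Sum>p\<in>A. fps_const (R p) * (G x0 * G p)) =
      (\<Sum>p\<in>A. fps_const (R p * (g p / (g p - g x0))) * G p) - fps_const \<sigma> * G x0"
     proof -
    have "(\<Sum>p\<in>A. fps_const (R p) * (G x0 * G p)) = (\<Sum>p\<in>A. fps_const (R p * (g p / (g p - g x0))) * G p
        - fps_const (R p * (g x0 / (g p - g x0))) * G x0)"
      by (intro sum.cong refl) (simp only: GG right_diff_distrib fps_const_mult[symmetric] mult.assoc)
    then show ?thesis
      by (simp add: sum_subtractf \<sigma>_def fps_const_sum sum_distrib_right)
  qed
  also have "fps_const (exp t powi (- u x0)) * (fps_const \<kappa> + (\<Sum>p\<in>A. fps_const (R p) * G p))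
      + (fps_const d * fps_const \<kappa> * G x0 + fps_const d * \<dots>)
    = fps_const (exp t powi (- u x0) * \<kappa>)
      + (fps_const (d * (\<kappa> - \<sigma>)) * G x0
      + (\<Sum>p\<in>A. fps_const (R p * exp t powi (- u x0) + d * R p * (g p / (g p - g x0))) * G p))"
  proof -
    have "(\<Sum>p\<in>A. fps_const (R p * exp t powi (- u x0) + d * R p * (g p / (g p - g x0))) * G p)
      = fps_const (exp t powi (- u x0)) * (\<Sum>p\<in>A. fps_const (R p) * G p)
        + fps_const d * (\<Sum>p\<in>A. fps_const (R p * (g p / (g p - g x0))) * G p)"
      unfolding sum_distrib_left sum.distrib[symmetric]
      by (intro sum.cong refl) (simp add: algebra_simps flip: fps_const_mult fps_const_add)
    then show ?thesis
      by (simp add: algebra_simps flip: fps_const_mult fps_const_sub)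
  qed
  \<comment> \<open>The coefficient collected at the new pole is the old decomposition evaluated at
    z = 1/\<open>g x0\<close>, hence by \<open>val\<close> the product of the old factors
    there.\<close>
  also have "\<kappa> - \<sigma> = (\<Prod>p\<in>A. phi_value t (u p) (g p / g x0))"
  proof -
    have "R p * (g x0 / (g x0 - g p)) = - (R p * (g x0 / (g p - g x0)))" for p
      by (metis minus_diff_eq minus_divide_right mult_minus_right)
    then show ?thesis unfolding val \<sigma>_def by (simp add: sum_negf)
  qed
  also have "(\<Sum>p\<in>A. fps_const (R p * exp t powi (- u x0) + d * R p * (g p / (g p - g x0))) * G p)
    = (\<Sum>p\<in>A. fps_const ((exp t powi u p - exp t powi (- u p)) *
          (\<Prod>p'\<in>insert x0 A - {p}. phi_value t (u p') (g p' / g p))) * G p)"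
  proof (intro sum.cong refl)
    fix p assume p: "p \<in> A"
    then have "insert x0 A - {p} = insert x0 (A - {p})" using insert.hyps by auto
    then have "(\<Prod>p'\<in>insert x0 A - {p}. phi_value t (u p') (g p' / g p))
       = phi_value t (u x0) (g x0 / g p) * (\<Prod>p'\<in>A - {p}. phi_value t (u p') (g p' / g p))"
      using insert.hyps by simp
    then show "fps_const (R p * exp t powi (- u x0) + d * R p * (g p / (g p - g x0))) * G p =
      fps_const ((exp t powi u p - exp t powi (- u p)) *
          (\<Prod>p'\<in>insert x0 A - {p}. phi_value t (u p') (g p' / g p))) * G p"
      unfolding R'[OF p, symmetric] by (simp add: R_def mult_ac)
  qed
  finally show ?case
    using insert.hyps by (simp add: \<kappa>_def d_def)
qed

text \<open>The expansions of 1/(1 - gz) in z and in 1/z. They differ by the sum of all g^m z^m, m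
  an integer, which is \<delta>(gz).\<close>

definition pole_series :: "sign \<Rightarrow> complex \<Rightarrow> complex fps" where
  "pole_series \<epsilon> g = (case \<epsilon> of Plus \<Rightarrow> Abs_fps (\<lambda>n. g ^ n)
     | Minus \<Rightarrow> Abs_fps (\<lambda>n. if n = 0 then 0 else - (inverse g ^ n)))"

lemma pole_series_times:
  assumes "g \<noteq> 0"
  shows "pole_series \<epsilon> g * (hom_1 \<epsilon> - fps_const g * hom_z \<epsilon>) = hom_1 \<epsilon>"
proof (cases \<epsilon>)
  case Plus
  have "Abs_fps (\<lambda>n. g ^ n) - fps_const g * (fps_X * Abs_fps (\<lambda>n. g ^ n)) = 1"
    by (rule fps_ext) (auto simp: power_eq_if)
  then show ?thesis using Plus by (simp add: pole_series_def hom_1_def hom_z_def algebra_simps)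
next
  case Minus
  let ?F = "Abs_fps (\<lambda>n. if n = 0 then 0 else - (inverse g ^ n))"
  have "fps_X * ?F - fps_const g * ?F = fps_X"
    using assms by (intro fps_ext) (auto simp: power_eq_if)
  then show ?thesis using Minus by (simp add: pole_series_def hom_1_def hom_z_def algebra_simps)
qed

lemma series_coeff_linear:
  "series_coeff \<epsilon> (F + G) p = series_coeff \<epsilon> F p + series_coeff \<epsilon> G p"
  "series_coeff \<epsilon> (fps_const c * F) p = c * series_coeff \<epsilon> F p"
  "series_coeff \<epsilon> (\<Sum>x\<in>A. f x) p = (\<Sum>x\<in>A. series_coeff \<epsilon> (f x) p)"
  by (simp_all add: series_coeff_def fps_sum_nth)

lemma pole_series_diff:
  assumes "g \<noteq> 0"
  shows "series_coeff Plus (pole_series Plus g) m - series_coeff Minus (pole_series Minus g) m = g powi m"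
  using assms by (auto simp: series_coeff_def pole_series_def power_int_def)

text \<open>The additive constant of the partial fraction decomposition is the same in both
  expansions and cancels; each simple pole leaves a delta function weighted by its coefficient. This
  is the shape of the right-hand side of the commutator relation.\<close>

lemma phi_series_prod_diff:
  assumes "finite A" "\<And>p. p \<in> A \<Longrightarrow> g p \<noteq> 0"
    and "\<And>p p'. p \<in> A \<Longrightarrow> p' \<in> A \<Longrightarrow> p \<noteq> p' \<Longrightarrow> g p \<noteq> g p'"
  shows "series_coeff Plus (\<Prod>p\<in>A. phi_series t Plus (u p) (g p)) m
       - series_coeff Minus (\<Prod>p\<in>A. phi_series t Minus (u p) (g p)) m
     = (\<Sum>p\<in>A. (exp t powi u p - exp t powi (- u p)) *
          (\<Prod>p'\<in>A - {p}. phi_value t (u p') (g p' / g p)) * g p powi m)"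
proof -
  have "(\<Prod>p\<in>A. phi_series t \<epsilon> (u p) (g p)) = fps_const (\<Prod>p\<in>A. exp t powi (- u p)) +
     (\<Sum>p\<in>A. fps_const ((exp t powi u p - exp t powi (- u p)) *
          (\<Prod>p'\<in>A - {p}. phi_value t (u p') (g p' / g p))) * pole_series \<epsilon> (g p))" for \<epsilon>
    using assms
    by (intro partial_fractions[where ?X0.0 = "hom_1 \<epsilon>" and ?X1.0 = "hom_z \<epsilon>"])
      (use hom_denominator_nonzero in \<open>auto simp: pole_series_times phi_series_times\<close>)
  moreover have "series_coeff Plus (fps_const c) m = series_coeff Minus (fps_const c) m" for c
    by (auto simp: series_coeff_def)
  ultimately show ?thesis
    using assms(2) pole_series_diff
    by (simp add: series_coeff_linear flip: sum_subtractf right_diff_distrib)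
qed

text \<open>The exponential formula for \<phi> has to be solved for the h_{i,m}. As
  \<open>fps_ln c\<close> is the compositional inverse of exp(cX) - 1, substituting the normalised
  series minus 1 into it gives the logarithm.\<close>

lemma fps_log_exists:
  fixes F :: "complex fps"
  assumes "fps_nth F 0 \<noteq> 0" "c \<noteq> 0"
  shows "\<exists>A. fps_nth A 0 = 0 \<and> F = fps_const (fps_nth F 0) * (fps_exp c oo A)"
proof -
  define G where "G = fps_const (inverse (fps_nth F 0)) * F - 1"
  have G0: "fps_nth G 0 = 0" using assms by (simp add: G_def)
  have "(fps_exp c - 1) oo fps_ln c = fps_X"
    unfolding fps_ln_fps_exp_inv[OF assms(2)] using assms(2) by (intro fps_inv_right) auto
  then have "(fps_exp c - 1) oo (fps_ln c oo G) = G"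
    using G0 by (simp add: fps_compose_assoc)
  then have "fps_exp c oo (fps_ln c oo G) = 1 + G"
    by (simp add: fps_compose_sub_distrib algebra_simps)
  moreover have "fps_const (fps_nth F 0) * (1 + G) = F"
    using assms by (simp add: G_def flip: mult.assoc)
  ultimately show ?thesis by (intro exI[of _ "fps_ln c oo G"]) simp
qed

lemma h_power_diag:
  assumes "\<And>m v. m \<noteq> 0 \<Longrightarrow> \<rho> (H i m) v = lin (\<lambda>b. Poly_Mapping.single b (w m b)) v"
  shows "h_power \<rho> \<epsilon> i l m v =
    lin (\<lambda>b. Poly_Mapping.single b (fps_nth (Abs_fps (\<lambda>m. if m = 0 then 0 else w (sg \<epsilon> * int m) b) ^ l) m)) v"
proof (induction l arbitrary: m v)
  case 0
  then show ?case by (auto intro!: poly_mapping_eqI)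
next
  case (Suc l)
  have sg0: "sg \<epsilon> \<noteq> 0" by (cases \<epsilon>) auto
  show ?case
  proof (rule poly_mapping_eqI)
    fix b
    let ?F = "Abs_fps (\<lambda>m. if m = 0 then 0 else w (sg \<epsilon> * int m) b)"
    have "{0..m} = insert 0 {1..m}" by auto
    then have "fps_nth (?F * ?F ^ l) m = (\<Sum>p = 1..m. w (sg \<epsilon> * int p) b * fps_nth (?F ^ l) (m - p))"
      by (simp add: fps_mult_nth)
    moreover have "Poly_Mapping.lookup (h_power \<rho> \<epsilon> i (Suc l) m v) b
      = (\<Sum>p = 1..m. w (sg \<epsilon> * int p) b * fps_nth (?F ^ l) (m - p)) * Poly_Mapping.lookup v b"
      using sg0 by (auto simp: Suc assms lin_diag_diag lookup_sum sum_distrib_right intro!: sum.cong)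
    ultimately show "Poly_Mapping.lookup (h_power \<rho> \<epsilon> i (Suc l) m v) b =
       Poly_Mapping.lookup (lin (\<lambda>b. Poly_Mapping.single b (fps_nth (Abs_fps (\<lambda>m. if m = 0 then 0 else w (sg \<epsilon> * int m) b) ^ Suc l) m)) v) b"
      by simp
  qed
qed

text \<open>On simultaneous eigenvectors the operator powers in \<open>phi_op\<close> are powers of
  one scalar series without constant term, so the finite sum over l is a coefficient of the
  composition with the exponential series.\<close>

lemma phi_op_diag:
  assumes "\<And>m v. m \<noteq> 0 \<Longrightarrow> \<rho> (H i m) v = lin (\<lambda>b. Poly_Mapping.single b (w m b)) v"
    and "\<And>h v. \<rho> (K h) v = lin (\<lambda>b. Poly_Mapping.single b (\<kappa> h b)) v"
  shows "phi_op t \<rho> \<epsilon> i p v =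
    lin (\<lambda>b. Poly_Mapping.single b (series_coeff \<epsilon>
      (fps_const (\<kappa> (\<lambda>x. of_int (sg \<epsilon>) * hvec i x) b) *
       (fps_exp (of_int (sg \<epsilon>) * (exp t - inverse (exp t)))
          oo Abs_fps (\<lambda>m. if m = 0 then 0 else w (sg \<epsilon> * int m) b))) p)) v"
proof (rule poly_mapping_eqI)
  fix b
  show "Poly_Mapping.lookup (phi_op t \<rho> \<epsilon> i p v) b = Poly_Mapping.lookup (lin (\<lambda>b. Poly_Mapping.single b (series_coeff \<epsilon>
      (fps_const (\<kappa> (\<lambda>x. of_int (sg \<epsilon>) * hvec i x) b) *
       (fps_exp (of_int (sg \<epsilon>) * (exp t - inverse (exp t)))
          oo Abs_fps (\<lambda>m. if m = 0 then 0 else w (sg \<epsilon> * int m) b))) p)) v) b"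
    by (simp add: phi_op_def assms(2) h_power_diag[of \<rho> i w, OF assms(1)] series_coeff_def lookup_sum
        fps_compose_nth atLeast0AtMost sum_distrib_right mult.assoc)
qed

text \<open>
  The effect on the eigenvalue with parameters \<open>u, g\<close> of a move of sign \<open>e\<close> with spectral parameter
  \<open>g0\<close>, for a node with Cartan integer \<open>C\<close>.
\<close>

definition move_step :: "complex \<Rightarrow> int \<Rightarrow> int \<Rightarrow> complex \<Rightarrow> int \<Rightarrow> complex \<Rightarrow> int \<Rightarrow> complex \<Rightarrow> bool" where
  "move_step t e C g0 u g u' g' \<longleftrightarrow>
     C = 2 \<and> u = - e \<and> u' = e \<and> g = g0 \<and> g' = g0 \<or>
     C = -1 \<and> u = 0 \<and> u' = - e \<and> g' = g0 * exp t powi (- e) \<or>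
     C = -1 \<and> u = e \<and> u' = 0 \<and> g = g0 * exp t powi e \<or>
     C = 0 \<and> u' = u \<and> g' = g"

text \<open>In all four cases E'/E = (Q X0 - g0 X1) / (X0 - Q g0 X1) with Q = q^(eC), stated with
  denominators cleared. As before, X0 and X1 are left open: the expansions give the relation between
  \<phi> and x, while constant series give the change of the coproduct coefficients.\<close>

lemma move_step_hom:
  fixes X0 X1 E E' :: "complex fps"
  assumes step: "move_step t e C g0 u g u' g'"
    and E: "E * (X0 - fps_const g * X1) = fps_const (exp t powi u) * X0 - fps_const (exp t powi (- u) * g) * X1"
    and E': "E' * (X0 - fps_const g' * X1) = fps_const (exp t powi u') * X0 - fps_const (exp t powi (- u') * g') * X1"
    and nz: "X0 - fps_const g * X1 \<noteq> 0" "X0 - fps_const g' * X1 \<noteq> 0"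
  shows "(X0 - fps_const (exp t powi (e * C) * g0) * X1) * E' = (fps_const (exp t powi (e * C)) * X0 - fps_const g0 * X1) * E"
proof -
  \<comment> \<open>Powers of q enter only as the pair \<open>P\<close>, \<open>R\<close> with P R =
    1, so that the identities become polynomial and are settled by rewriting with \<open>PR\<close>
    and \<open>PR'\<close>.\<close>
  define P R where "P = fps_const (exp t powi e)" and "R = fps_const (exp t powi (- e))"
  have PR: "P * R = 1" by (simp add: P_def R_def power_int_minus)
  then have PR': "P * (R * x) = x" for x by (simp flip: mult.assoc)
  have PP: "fps_const (exp t powi (e * 2)) = P * P" by (simp add: P_def power_int_mult power2_eq_square)
  have Pp: "P = fps_const (exp t powi e)" and Rr: "fps_const (exp t powi (- e)) = R" by (auto simp: P_def R_def)
  define G0 where "G0 = fps_const g0"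
  consider "C = 2" "u = - e" "u' = e" "g = g0" "g' = g0"
    | "C = -1" "u = 0" "u' = - e" "g' = g0 * exp t powi (- e)"
    | "C = -1" "u = e" "u' = 0" "g = g0 * exp t powi e"
    | "C = 0" "u' = u" "g' = g"
    using step unfolding move_step_def by blast
  then show ?thesis
  proof cases
    case 1
    have e: "E * (X0 - G0 * X1) = R * X0 - P * G0 * X1" "E' * (X0 - G0 * X1) = P * X0 - R * G0 * X1"
      using E E' 1 by (simp_all add: P_def R_def G0_def)
    have "((X0 - (P * P) * G0 * X1) * E') * (X0 - G0 * X1) = (X0 - (P * P) * G0 * X1) * (P * X0 - R * G0 * X1)"
      unfolding e(2)[symmetric] by (simp add: mult_ac)
    also have "\<dots> = ((P * P) * X0 - G0 * X1) * (R * X0 - P * G0 * X1)"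
      by (simp add: algebra_simps PR PR')
    also have "\<dots> = (((P * P) * X0 - G0 * X1) * E) * (X0 - G0 * X1)"
      unfolding e(1)[symmetric] by (simp add: mult_ac)
    finally have "(X0 - (P * P) * G0 * X1) * E' = ((P * P) * X0 - G0 * X1) * E"
      using nz 1 by (simp add: G0_def)
    then show ?thesis using 1 by (simp add: PP G0_def flip: fps_const_mult)
  next
    case 2
    have "E = 1" using E nz 2 by simp
    moreover have "E' * (X0 - R * G0 * X1) = R * X0 - G0 * X1"
      using E' 2 by (simp add: R_def G0_def power_int_minus mult.commute)
    ultimately show ?thesis using 2 by (simp add: R_def G0_def mult.commute)
  next
    case 3
    have "E' = 1" using E' nz 3 by simp
    have e: "E * (X0 - P * G0 * X1) = P * X0 - G0 * X1"
      using E 3 by (simp add: P_def G0_def power_int_minus mult.commute)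
    have "(X0 - R * G0 * X1) * (X0 - P * G0 * X1) = (R * X0 - G0 * X1) * (P * X0 - G0 * X1)"
      by (simp add: algebra_simps PR PR')
    also have "\<dots> = ((R * X0 - G0 * X1) * E) * (X0 - P * G0 * X1)"
      unfolding e[symmetric] by (simp add: mult_ac)
    finally have "X0 - R * G0 * X1 = (R * X0 - G0 * X1) * E"
      using nz 3 by (simp add: P_def G0_def mult.commute)
    then show ?thesis using 3 \<open>E' = 1\<close> by (simp add: R_def G0_def)
  next
    case 4
    then have "E' * (X0 - fps_const g * X1) = E * (X0 - fps_const g * X1)" using E E' by simp
    then have "E' = E" using nz by simp
    then show ?thesis using 4 by simp
  qed
qed

lemma move_step_series:
  assumes "move_step t e C g0 u g u' g'" "g \<noteq> 0" "g' \<noteq> 0"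
  shows "(hom_1 \<epsilon> - fps_const (exp t powi (e * C) * g0) * hom_z \<epsilon>) * phi_series t \<epsilon> u' g'
    = (fps_const (exp t powi (e * C)) * hom_1 \<epsilon> - fps_const g0 * hom_z \<epsilon>) * phi_series t \<epsilon> u g"
  using assms hom_denominator_nonzero by (intro move_step_hom) (auto simp: phi_series_times)

lemma move_step_value:
  assumes "move_step t e C g0 u g u' g'" "g * x \<noteq> 1" "g' * x \<noteq> 1"
  shows "(1 - exp t powi (e * C) * (g0 * x)) * phi_value t u' (g' * x)
    = (exp t powi (e * C) - g0 * x) * phi_value t u (g * x)"
proof -
  have *: "1 - fps_const y * fps_const x = fps_const (1 - y * x)" for y by (simp flip: fps_const_1_eq_1)
  have "(1 - fps_const (exp t powi (e * C) * g0) * fps_const x) * fps_const (phi_value t u' (g' * x))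
    = (fps_const (exp t powi (e * C)) * 1 - fps_const g0 * fps_const x) * fps_const (phi_value t u (g * x))"
  proof (rule move_step_hom[OF assms(1)])
    show "fps_const (phi_value t u (g * x)) * (1 - fps_const g * fps_const x) =
       fps_const (exp t powi u) * 1 - fps_const (exp t powi (- u) * g) * fps_const x"
      unfolding * using assms by (simp add: phi_value_def mult.assoc)
    show "fps_const (phi_value t u' (g' * x)) * (1 - fps_const g' * fps_const x) =
       fps_const (exp t powi u') * 1 - fps_const (exp t powi (- u') * g') * fps_const x"
      unfolding * using assms by (simp add: phi_value_def mult.assoc)
  qed (use assms in \<open>auto simp: *\<close>)
  then show ?thesis unfolding * by (simp add: mult.assoc)
qed

section \<open>Signs, residue classes and the Cartan matrix\<close>

fun opp :: "sign \<Rightarrow> sign" where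
  "opp Plus = Minus"
| "opp Minus = Plus"

lemma sg_opp [simp]: "sg (opp \<epsilon>) = - sg \<epsilon>"
  by (cases \<epsilon>) auto

lemma opp_opp [simp]: "opp (opp \<epsilon>) = \<epsilon>"
  by (cases \<epsilon>) auto

lemma sg_nonzero [simp]: "sg \<epsilon> \<noteq> 0"
  by (cases \<epsilon>) auto

lemma sg_eq_iff [simp]: "sg \<epsilon> = - sg \<epsilon> \<longleftrightarrow> False" "- sg \<epsilon> = sg \<epsilon> \<longleftrightarrow> False"
  by (cases \<epsilon>; auto)+

lemma of_int_mod_ring_eq_iff:
  "(of_int x :: 'n::nontriv mod_ring) = of_int y \<longleftrightarrow> int CARD('n) dvd x - y"
proof -
  have "(of_int x :: 'n mod_ring) = of_int y \<longleftrightarrow> (of_int (x - y) :: 'n mod_ring) = 0" by simp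
  also have "\<dots> \<longleftrightarrow> int CHAR('n mod_ring) dvd x - y" by (rule of_int_eq_0_iff_char_dvd)
  finally show ?thesis by simp
qed

lemma small_mod_ring_neq:
  assumes "CARD('n::nontriv) \<ge> 4" "0 < x" "x < 4"
  shows "(of_int x :: 'n mod_ring) \<noteq> 0"
  using of_int_mod_ring_eq_iff[of x 0, where 'n = 'n] assms zdvd_not_zless[of x "int CARD('n)"] by auto

lemma cartan_matrix_sym: "cartan_matrix i j = cartan_matrix j i"
  by (auto simp: cartan_matrix_def)

lemma mod_ring_shift: "(i :: 'n::nontriv mod_ring) = j - 1 \<longleftrightarrow> j = i + 1" "i = j + 1 \<longleftrightarrow> j = i - 1"
  by auto

lemma cartan_matrix_0D:
  assumes "cartan_matrix i j = 0"
  shows "j \<noteq> i" "j \<noteq> i + 1" "j \<noteq> i - 1" "i \<noteq> j" "i \<noteq> j + 1" "i \<noteq> j - 1"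
  using assms by (auto simp: cartan_matrix_def split: if_splits)

lemma cartan_matrix_cases:
  obtains "i = j" "cartan_matrix i j = 2" | "i \<noteq> j" "j = i + 1 \<or> j = i - 1" "cartan_matrix i j = -1"
    | "i \<noteq> j" "j \<noteq> i + 1" "j \<noteq> i - 1" "cartan_matrix i j = 0"
proof -
  have "cartan_matrix i j = (if i = j then 2 else if j = i + 1 \<or> j = i - 1 then -1 else 0)"
    using mod_ring_shift[of i j] by (auto simp: cartan_matrix_def)
  then show thesis using that by presburger
qed

section \<open>Tensor products of columns\<close>

text \<open>
  Columns up to the spectral parameter: \<open>u i c\<close> is the weight of \<open>c\<close> at the node \<open>i\<close>, and
  \<open>\<phi>\<^sub>i(z) c = \<psi>(az q^(e i c))\<close> if \<open>u i c = 1\<close>, resp. \<open>\<psi>(az q^(e i c + 2))\<^sup>-\<^sup>1\<close> if \<open>u i c = -1\<close>.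
\<close>

locale column_system =
  fixes Col :: "'c set"
    and u :: "'n::nontriv mod_ring \<Rightarrow> 'c \<Rightarrow> int"
    and e :: "'n mod_ring \<Rightarrow> 'c \<Rightarrow> int"
    and mv :: "sign \<Rightarrow> 'n mod_ring \<Rightarrow> 'c \<Rightarrow> 'c"
    and cw :: "'c \<Rightarrow> 'n mod_ring weight"
  assumes card4: "CARD('n) \<ge> 4"
    and u_range: "c \<in> Col \<Longrightarrow> u i c \<in> {-1, 0, 1}"
    and e_same: "c \<in> Col \<Longrightarrow> c' \<in> Col \<Longrightarrow> even (e i c - e i c')"
    and e_adj: "c \<in> Col \<Longrightarrow> c' \<in> Col \<Longrightarrow> odd (e (i + 1) c - e i c')"
    and mv_Col: "c \<in> Col \<Longrightarrow> u i c = - sg \<epsilon> \<Longrightarrow> mv \<epsilon> i c \<in> Col"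
    and u_mv: "c \<in> Col \<Longrightarrow> u i c = - sg \<epsilon> \<Longrightarrow> u i (mv \<epsilon> i c) = sg \<epsilon>"
    and e_mv: "c \<in> Col \<Longrightarrow> u i c = - sg \<epsilon> \<Longrightarrow> e i (mv \<epsilon> i c) = e i c"
    and mv_mv: "c \<in> Col \<Longrightarrow> u i c = - sg \<epsilon> \<Longrightarrow> mv (opp \<epsilon>) i (mv \<epsilon> i c) = c"
    and mv_adj: "c \<in> Col \<Longrightarrow> u i c = 1 \<Longrightarrow> j = i + 1 \<or> j = i - 1 \<Longrightarrow>
        u j c = 0 \<and> u j (mv Minus i c) = 1 \<and> e j (mv Minus i c) = e i c + 1 \<or>
        u j c = -1 \<and> u j (mv Minus i c) = 0 \<and> e j c = e i c - 1"
    and mv_far: "c \<in> Col \<Longrightarrow> u i c = 1 \<Longrightarrow> j \<noteq> i \<Longrightarrow> j \<noteq> i + 1 \<Longrightarrow> j \<noteq> i - 1 \<Longrightarrow>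
        u j (mv Minus i c) = u j c \<and> e j (mv Minus i c) = e j c"
    and mv_commute: "c \<in> Col \<Longrightarrow> u i c = 1 \<Longrightarrow> u j c = 1 \<Longrightarrow> j \<noteq> i \<Longrightarrow> j \<noteq> i + 1 \<Longrightarrow> j \<noteq> i - 1 \<Longrightarrow>
        mv Minus i (mv Minus j c) = mv Minus j (mv Minus i c)"
    and column_separation: "c \<in> Col \<Longrightarrow> c' \<in> Col \<Longrightarrow> (\<And>i. u i c = u i c') \<Longrightarrow>
        (\<And>i. u i c \<noteq> 0 \<Longrightarrow> e i c = e i c') \<Longrightarrow> c = c'"
    and column_connected: "S \<subseteq> Col \<Longrightarrow> S \<noteq> {} \<Longrightarrow>
        (\<And>\<epsilon> i c. c \<in> S \<Longrightarrow> u i c = - sg \<epsilon> \<Longrightarrow> mv \<epsilon> i c \<in> S) \<Longrightarrow> S = Col"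
    and column_vertical: "c \<in> Col \<Longrightarrow> \<exists>S. finite S \<and> c \<in> S \<and> S \<subseteq> Col \<and>
        (\<forall>\<epsilon> i. \<forall>c'\<in>S. i \<noteq> j \<longrightarrow> u i c' = - sg \<epsilon> \<longrightarrow> mv \<epsilon> i c' \<in> S)"
    and cw_Some: "c \<in> Col \<Longrightarrow> cw c (Some i) = of_int (u i c)"
    and cw_mv: "c \<in> Col \<Longrightarrow> u i c = 1 \<Longrightarrow> cw (mv Minus i c) x = cw c x - simple_root i x"
begin

lemma adjacent_neq: "i + 1 \<noteq> (i :: 'n mod_ring)" "i - 1 \<noteq> (i :: 'n mod_ring)"
  "i + 1 \<noteq> (i - 1 :: 'n mod_ring)"
proof -
  show "i + 1 \<noteq> i" "i - 1 \<noteq> i" by auto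
  have "(i + 1) - (i - 1) = (of_int 2 :: 'n mod_ring)" by simp
  then show "i + 1 \<noteq> i - 1" using small_mod_ring_neq[of 2, OF card4] by (metis diff_self zero_less_numeral rel_simps(28) numeral_less_iff semiring_norm(78) semiring_norm(76))
qed

lemma mv_inverse_Minus:
  assumes "c \<in> Col" "u i c = -1"
  shows "mv Plus i c \<in> Col" "u i (mv Plus i c) = 1" "mv Minus i (mv Plus i c) = c" "e i (mv Plus i c) = e i c"
  using mv_Col[of c i Plus] u_mv[of c i Plus] mv_mv[of c i Plus] e_mv[of c i Plus] assms by auto

text \<open>The axioms describe neighbouring and distant nodes for \<open>Minus\<close> moves only.
  A \<open>Plus\<close> move from c is the inverse of the \<open>Minus\<close> move from
  \<open>mv Plus i c\<close>, which exchanges the roles of source and target.\<close>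

lemma mv_step:
  assumes "c \<in> Col" "u i c = - sg \<epsilon>"
  shows "move_step t (sg \<epsilon>) (cartan_matrix i j) (\<alpha> * exp t powi e i c)
    (u j c) (\<alpha> * exp t powi e j c) (u j (mv \<epsilon> i c)) (\<alpha> * exp t powi e j (mv \<epsilon> i c))"
proof (cases i j rule: cartan_matrix_cases)
  case 1
  then show ?thesis using assms by (auto simp: move_step_def u_mv e_mv)
next
  case 2
  show ?thesis
  proof (cases \<epsilon>)
    case Minus
    with mv_adj[of c i j] assms 2 show ?thesis
      by (auto simp: move_step_def power_int_add power_int_diff power_int_minus divide_inverse mult_ac)
  next
    case Plus
    with mv_adj[of "mv Plus i c" i j] mv_inverse_Minus[of c i] assms 2 show ?thesis
      by (auto simp: move_step_def power_int_add power_int_diff power_int_minus divide_inverse mult_ac)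
  qed
next
  case 3
  show ?thesis
  proof (cases \<epsilon>)
    case Minus
    with mv_far[of c i j] assms 3 show ?thesis by (auto simp: move_step_def)
  next
    case Plus
    with mv_far[of "mv Plus i c" i j] mv_inverse_Minus[of c i] assms 3 show ?thesis by (auto simp: move_step_def)
  qed
qed

lemma mv_far_sign:
  assumes "c \<in> Col" "u i c = - sg \<epsilon>" "cartan_matrix i j = 0"
  shows "u j (mv \<epsilon> i c) = u j c" "e j (mv \<epsilon> i c) = e j c"
proof -
  have ij: "j \<noteq> i" "j \<noteq> i + 1" "j \<noteq> i - 1" using assms(3) by (auto simp: cartan_matrix_def split: if_splits)
  show "u j (mv \<epsilon> i c) = u j c" "e j (mv \<epsilon> i c) = e j c"
    using mv_far[of c i j] mv_far[of "mv Plus i c" i j] mv_inverse_Minus[of c i] assms(1,2) ij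
    by (cases \<epsilon>; force)+
qed

lemma mv_adjacent_sign:
  assumes "c \<in> Col" "u i c = - sg \<epsilon>" "cartan_matrix i j = -1"
  shows "u j c = 0 \<and> u j (mv \<epsilon> i c) = - sg \<epsilon> \<and> e j (mv \<epsilon> i c) = e i c - sg \<epsilon> \<or>
         u j c = sg \<epsilon> \<and> u j (mv \<epsilon> i c) = 0"
proof -
  have ij: "j = i + 1 \<or> j = i - 1" using assms(3) by (auto simp: cartan_matrix_def split: if_splits)
  show ?thesis
    using mv_adj[of c i j] mv_adj[of "mv Plus i c" i j] mv_inverse_Minus[of c i] assms(1,2) ij
    by (cases \<epsilon>; force)
qed

text \<open>Commutation of two \<open>Minus\<close> moves is the axiom; conjugating with an inverse
  move converts one sign at a time, from two \<open>Minus\<close> to mixed signs and then to two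
  \<open>Plus\<close>.\<close>

lemma mv_commute_sign:
  assumes "c \<in> Col" "u i c = - sg \<epsilon>" "u j c = - sg \<epsilon>'" "cartan_matrix i j = 0"
  shows "mv \<epsilon> i (mv \<epsilon>' j c) = mv \<epsilon>' j (mv \<epsilon> i c)"
proof -
  have ij: "j \<noteq> i" "j \<noteq> i + 1" "j \<noteq> i - 1" "i \<noteq> j + 1" "i \<noteq> j - 1"
    and c': "cartan_matrix j i = 0"
    using assms(4) cartan_matrix_sym[of i j] by (auto simp: cartan_matrix_def split: if_splits)
  have up: "mv (opp \<epsilon>1) i1 d = d'" if "d' \<in> Col" "u i1 d' = - sg \<epsilon>1" "mv \<epsilon>1 i1 d' = d" for \<epsilon>1 i1 d d'
    using mv_mv[OF that(1,2)] that(3) by simp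
  \<comment> \<open>The \<open>Plus\<close> move of j1 is undone first: at d =
    \<open>mv Plus j1 c\<close> the hypothesis applies to the \<open>Minus\<close> move leading back
    to c, and distant nodes do not disturb each other's weights.\<close>
  have swap: "mv \<epsilon>1 i1 (mv Plus j1 c) = mv Plus j1 (mv \<epsilon>1 i1 c)"
    if "u i1 c = - sg \<epsilon>1" "u j1 c = -1" "cartan_matrix i1 j1 = 0" 
      and hyp: "\<And>d. d \<in> Col \<Longrightarrow> u i1 d = - sg \<epsilon>1 \<Longrightarrow> u j1 d = 1 \<Longrightarrow>
        mv \<epsilon>1 i1 (mv Minus j1 d) = mv Minus j1 (mv \<epsilon>1 i1 d)"
      and "c \<in> Col" for \<epsilon>1 i1 j1 c
  proof -
    define d where "d = mv Plus j1 c"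
    have d: "d \<in> Col" "u j1 d = 1" "mv Minus j1 d = c"
      using mv_inverse_Minus[of c j1] that by (auto simp: d_def)
    have c0: "cartan_matrix j1 i1 = 0" using that(3) cartan_matrix_sym by metis
    have ud: "u i1 d = - sg \<epsilon>1" using mv_far_sign(1)[of c j1 Plus i1] that c0 by (simp add: d_def)
    have "mv \<epsilon>1 i1 c = mv Minus j1 (mv \<epsilon>1 i1 d)" using hyp[OF d(1) ud d(2)] d(3) by simp
    moreover have "mv \<epsilon>1 i1 d \<in> Col" using mv_Col d ud by simp
    moreover have "u j1 (mv \<epsilon>1 i1 d) = 1" using mv_far_sign(1)[of d i1 \<epsilon>1 j1] d ud that by simp
    ultimately show ?thesis using mv_mv[of "mv \<epsilon>1 i1 d" j1 Minus] by (simp add: d_def)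
  qed
  have MM: "mv Minus i1 (mv Minus j1 c) = mv Minus j1 (mv Minus i1 c)"
    if "cartan_matrix i1 j1 = 0" "u i1 c = 1" "u j1 c = 1" "c \<in> Col" for i1 j1 c
    using mv_commute[of c i1 j1] cartan_matrix_0D[OF that(1)] that by auto
  have MP: "mv Minus i1 (mv Plus j1 c) = mv Plus j1 (mv Minus i1 c)"
    if "cartan_matrix i1 j1 = 0" "u i1 c = 1" "u j1 c = -1" "c \<in> Col" for i1 j1 c
    using that by (intro swap) (auto intro!: MM)
  have PP: "mv Plus i1 (mv Plus j1 c) = mv Plus j1 (mv Plus i1 c)"
    if "cartan_matrix i1 j1 = 0" "u i1 c = -1" "u j1 c = -1" "c \<in> Col" for i1 j1 c
    using that by (intro swap) (auto intro!: MP[symmetric] simp: cartan_matrix_sym[of j1 i1])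
  show ?thesis
    using MM[of i j c] MP[of i j c] MP[of j i c] PP[of i j c] assms c' by (cases \<epsilon>; cases \<epsilon>') auto
qed

end

lemma homogeneous_ratio:
  fixes x y :: complex
  assumes "x \<noteq> 0" "x - Q * y \<noteq> 0" "(1 - Q * (y / x)) * F' = (Q - y / x) * F"
  shows "F' = F * ((Q * x - y) / (x - Q * y))"
proof -
  have "(x - Q * y) * F' = (Q * x - y) * F"
    using assms(1,3) by (simp add: field_simps)
  then show ?thesis using assms(2) by (simp add: field_simps)
qed

section \<open>Coefficients of the Drinfeld coproduct and their change under moves\<close>

locale column_tensor = column_system +
  fixes t :: complex and k :: nat and a :: "nat \<Rightarrow> complex"
  assumes not_root_of_unity: "m > 0 \<Longrightarrow> exp t ^ m \<noteq> 1"
    and a_nonzero: "p < k \<Longrightarrow> a p \<noteq> 0"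
    and a_generic: "p < k \<Longrightarrow> p' < k \<Longrightarrow> p \<noteq> p' \<Longrightarrow> a p \<noteq> a p' * exp t powi (2 * l)"
begin

lemma exp_powi_eq_1_iff: "exp t powi m = 1 \<longleftrightarrow> m = 0"
proof
  assume *: "exp t powi m = 1"
  show "m = 0"
  proof (rule ccontr)
    assume "m \<noteq> 0"
    then consider "m > 0" | "m < 0" by linarith
    then show False
    proof cases
      case 1
      then show False using * not_root_of_unity[of "nat m"] by (simp add: power_int_def)
    next
      case 2
      then show False using * not_root_of_unity[of "nat (- m)"]
        by (simp add: power_int_def inverse_eq_1_iff power_inverse)
    qed
  qed
qed simp

lemma exp_powi_eq_iff: "exp t powi m = exp t powi m' \<longleftrightarrow> m = m'"
proof -
  have "exp t powi m = exp t powi m' \<longleftrightarrow> exp t powi (m - m') = 1" by (simp add: power_int_diff)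
  then show ?thesis using exp_powi_eq_1_iff[of "m - m'"] by auto
qed

definition tbasis :: "'a list set" where
  "tbasis = {b. length b = k \<and> (\<forall>p<k. b ! p \<in> Col)}"

text \<open>The number \<gamma> of the delta function \<delta>(\<gamma>z) with which x_i acts on the
  factor p.\<close>

definition spec :: "'b mod_ring \<Rightarrow> nat \<Rightarrow> 'a list \<Rightarrow> complex" where
  "spec i p b = a p * exp t powi e i (b ! p)"

text \<open>The tensor positions on which the coproduct places \<phi>_i when x_i acts at p; their
  side depends on the sign.\<close>

definition before :: "sign \<Rightarrow> nat \<Rightarrow> nat set" where
  "before \<epsilon> p = (case \<epsilon> of Plus \<Rightarrow> {..<p} | Minus \<Rightarrow> {p<..<k})"

definition active :: "sign \<Rightarrow> 'b mod_ring \<Rightarrow> nat \<Rightarrow> 'a list \<Rightarrow> bool" where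
  "active \<epsilon> i p b \<longleftrightarrow> u i (b ! p) = - sg \<epsilon>"

text \<open>The scalar f(1/\<gamma>) in f(z) \<delta>(\<gamma>z) = f(1/\<gamma>)
  \<delta>(\<gamma>z), where f is the eigenvalue of the \<phi> factors of the coproduct and \<gamma>
  = \<open>spec i p b\<close>.\<close>

definition cf :: "sign \<Rightarrow> 'b mod_ring \<Rightarrow> nat \<Rightarrow> 'a list \<Rightarrow> complex" where
  "cf \<epsilon> i p b = (if active \<epsilon> i p b
     then \<Prod>p'\<in>before \<epsilon> p. phi_value t (u i (b ! p')) (spec i p' b / spec i p b) else 0)"

definition mvp :: "sign \<Rightarrow> 'b mod_ring \<Rightarrow> nat \<Rightarrow> 'a list \<Rightarrow> 'a list" where
  "mvp \<epsilon> i p b = b[p := mv \<epsilon> i (b ! p)]"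

lemma tbasisD: "b \<in> tbasis \<Longrightarrow> length b = k" "b \<in> tbasis \<Longrightarrow> p < k \<Longrightarrow> b ! p \<in> Col"
  by (auto simp: tbasis_def)

lemma spec_nonzero: "p < k \<Longrightarrow> spec i p b \<noteq> 0"
  by (simp add: spec_def a_nonzero)

lemma before_subset: "p < k \<Longrightarrow> before \<epsilon> p \<subseteq> {..<k} - {p}"
  by (cases \<epsilon>) (auto simp: before_def)

lemma finite_before [simp]: "finite (before \<epsilon> p)"
  by (cases \<epsilon>) (auto simp: before_def)

lemma mvp_tbasis: "b \<in> tbasis \<Longrightarrow> p < k \<Longrightarrow> active \<epsilon> i p b \<Longrightarrow> mvp \<epsilon> i p b \<in> tbasis"
  by (auto simp: tbasis_def mvp_def active_def nth_list_update mv_Col)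

lemma mvp_nth: "b \<in> tbasis \<Longrightarrow> p < k \<Longrightarrow> mvp \<epsilon> i p b ! p' = (if p' = p then mv \<epsilon> i (b ! p) else b ! p')"
  by (auto simp: tbasis_def mvp_def nth_list_update)

lemma mvp_swap: "p \<noteq> p' \<Longrightarrow> mvp \<epsilon> i p (mvp \<epsilon>' j p' b) = mvp \<epsilon>' j p' (mvp \<epsilon> i p b)"
  by (simp add: mvp_def list_update_swap)

lemma spec_mvp: "p \<noteq> p' \<Longrightarrow> spec i p (mvp \<epsilon> j p' b) = spec i p b"
  by (simp add: mvp_def spec_def)

lemma active_mvp: "p \<noteq> p' \<Longrightarrow> active \<epsilon> i p (mvp \<epsilon>' j p' b) = active \<epsilon> i p b"
  by (simp add: mvp_def active_def)

text \<open>An equality would express the ratio of \<open>a p\<close> and \<open>a p'\<close> as a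
  power of q with exponent d + e - e', which is even by assumption; this is what genericity
  forbids.\<close>

lemma spec_generic:
  assumes "p < k" "p' < k" "p \<noteq> p'" "even (d + e j (b' ! p') - e i (b ! p))"
  shows "spec j p' b' * exp t powi d \<noteq> spec i p b"
proof
  assume *: "spec j p' b' * exp t powi d = spec i p b"
  obtain l where l: "d + e j (b' ! p') - e i (b ! p) = 2 * l" using assms(4) by blast
  have "a p = a p' * exp t powi (e j (b' ! p') + d) * exp t powi (- e i (b ! p))"
    using * by (simp add: spec_def power_int_add power_int_minus field_simps)
  also have "\<dots> = a p' * exp t powi (2 * l)"
  proof -
    have "exp t powi (e j (b' ! p') + d) * exp t powi (- e i (b ! p)) = exp t powi (e j (b' ! p') + d - e i (b ! p))"
      by (simp add: power_int_diff power_int_minus divide_inverse)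
    then show ?thesis using l by (simp add: mult.assoc add.commute)
  qed
  finally show False using a_generic[of p p' l] assms by simp
qed

lemma spec_neq:
  assumes "b \<in> tbasis" "b' \<in> tbasis" "p < k" "p' < k" "p \<noteq> p'"
  shows "spec i p' b' \<noteq> spec i p b"
  using spec_generic[of p p' 0 i b' i b] e_same[of "b' ! p'" "b ! p" i] tbasisD assms by simp

text \<open>Parity decides: for equal nodes the exponents have the same parity and the Cartan
  integer is 2, for neighbouring nodes both the difference of exponents and the Cartan integer are
  odd. Either way the total shift is even.\<close>

lemma spec_neq_cartan:
  assumes "b \<in> tbasis" "b' \<in> tbasis" "p < k" "p' < k" "p \<noteq> p'" "cartan_matrix i j \<noteq> 0" "s \<in> {1, -1}"
  shows "spec j p' b' * exp t powi (s * cartan_matrix i j) \<noteq> spec i p b"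
proof (rule spec_generic)
  have Col: "b' ! p' \<in> Col" "b ! p \<in> Col" using assms tbasisD by auto
  show "even (s * cartan_matrix i j + e j (b' ! p') - e i (b ! p))"
  proof (cases i j rule: cartan_matrix_cases)
    case 1
    then show ?thesis using e_same[OF Col, of i] assms by auto
  next
    case 2
    have "odd (e j (b' ! p') - e i (b ! p))"
      using e_adj[OF Col, of i] e_adj[OF Col(2,1), of j] 2(2) by auto
    then show ?thesis using 2 assms by auto
  qed (use assms in auto)
qed (use assms in auto)

text \<open>The factor by which the coefficient of a move at p, with parameter x, changes once the
  column p' has moved with parameter y. It is 1 unless p' is among the positions entering that
  coefficient and the nodes interact.\<close>

definition theta :: "sign \<Rightarrow> sign \<Rightarrow> int \<Rightarrow> nat \<Rightarrow> complex \<Rightarrow> nat \<Rightarrow> complex \<Rightarrow> complex" where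
  "theta \<epsilon> \<epsilon>' C p x p' y = (if p' \<in> before \<epsilon> p \<and> C \<noteq> 0
     then (exp t powi (sg \<epsilon>' * C) * x - y) / (x - exp t powi (sg \<epsilon>' * C) * y) else 1)"

lemma sg_in: "sg \<epsilon> \<in> {1, -1}"
  by (cases \<epsilon>) auto

text \<open>A single factor of the product defining \<open>cf\<close> changes, namely the one at p',
  and \<open>move_step_value\<close> at z = 1/\<open>spec i p b\<close> gives the ratio. Genericity
  keeps this point away from the poles and from the zero of the denominator.\<close>

lemma cf_mvp:
  assumes b: "b \<in> tbasis" and p: "p < k" "p' < k" "p \<noteq> p'" and act: "active \<epsilon>' j p' b"
  shows "cf \<epsilon> i p (mvp \<epsilon>' j p' b)
    = cf \<epsilon> i p b * theta \<epsilon> \<epsilon>' (cartan_matrix i j) p (spec i p b) p' (spec j p' b)"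
proof -
  let ?b = "mvp \<epsilon>' j p' b"
  let ?f = "\<lambda>b p''. phi_value t (u i (b ! p'')) (spec i p'' b / spec i p b)"
  have b': "?b \<in> tbasis" using mvp_tbasis assms by simp
  have sp: "spec i p ?b = spec i p b" using p spec_mvp by simp
  have same: "?f ?b p'' = ?f b p''" if "p'' \<noteq> p'" for p''
    using that b p by (simp add: mvp_nth spec_mvp)
  have theta: "?f ?b p' = ?f b p' * theta \<epsilon> \<epsilon>' (cartan_matrix i j) p (spec i p b) p' (spec j p' b)"
    if "p' \<in> before \<epsilon> p"
  proof (cases "cartan_matrix i j = 0")
    case True
    then have "cartan_matrix j i = 0" by (metis cartan_matrix_sym)
    then have "u i (?b ! p') = u i (b ! p')" "spec i p' ?b = spec i p' b"
      using mv_far_sign[of "b ! p'" j \<epsilon>' i] b p act by (auto simp: mvp_nth spec_def tbasisD active_def)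
    then show ?thesis using True by (simp add: theta_def sp)
  next
    case False
    define Q where "Q = exp t powi (sg \<epsilon>' * cartan_matrix i j)"
    let ?x = "1 / spec i p b"
    have ne: "spec j p' b * Q \<noteq> spec i p b"
      using spec_neq_cartan[OF b b p False sg_in] unfolding Q_def by simp
    have "move_step t (sg \<epsilon>') (cartan_matrix j i) (spec j p' b) (u i (b ! p')) (spec i p' b)
       (u i (?b ! p')) (spec i p' ?b)"
      using mv_step[of "b ! p'" j \<epsilon>' t i "a p'"] b p act by (simp add: spec_def mvp_nth tbasisD active_def)
    then have "(1 - Q * (spec j p' b * ?x)) * phi_value t (u i (?b ! p')) (spec i p' ?b * ?x)
      = (Q - spec j p' b * ?x) * phi_value t (u i (b ! p')) (spec i p' b * ?x)"
      unfolding Q_def cartan_matrix_sym[of i j]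
      using spec_neq[OF b b' p] spec_neq[OF b b p] spec_nonzero p by (intro move_step_value) auto
    then have *: "(1 - Q * (spec j p' b / spec i p b)) * ?f ?b p' = (Q - spec j p' b / spec i p b) * ?f b p'"
      by (simp only: sp times_divide_eq_right mult_1_right)
    have "spec i p b - Q * spec j p' b \<noteq> 0" using ne by (simp add: mult.commute)
    from homogeneous_ratio[OF spec_nonzero[OF p(1)] this *]
    have "?f ?b p' = ?f b p' * ((Q * spec i p b - spec j p' b) / (spec i p b - Q * spec j p' b))" .
    then show ?thesis using that False by (simp add: theta_def Q_def)
  qed
  have "(\<Prod>p''\<in>before \<epsilon> p. ?f ?b p'') = (\<Prod>p''\<in>before \<epsilon> p. ?f b p'')
      * theta \<epsilon> \<epsilon>' (cartan_matrix i j) p (spec i p b) p' (spec j p' b)"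
  proof (cases "p' \<in> before \<epsilon> p")
    case True
    have "(\<Prod>p''\<in>before \<epsilon> p - {p'}. ?f ?b p'') = (\<Prod>p''\<in>before \<epsilon> p - {p'}. ?f b p'')"
      by (intro prod.cong refl same) auto
    then show ?thesis using theta[OF True]
      by (simp only: prod.remove[OF finite_before True] mult_ac)
  next
    case False
    have "(\<Prod>p''\<in>before \<epsilon> p. ?f ?b p'') = (\<Prod>p''\<in>before \<epsilon> p. ?f b p'')"
      using False by (intro prod.cong refl same) auto
    then show ?thesis using False by (simp add: theta_def)
  qed
  then show ?thesis
    unfolding cf_def active_mvp[OF p(3)] sp by (cases "active \<epsilon> i p b") (simp_all only: if_True if_False mult_zero_left)
qed


section \<open>The operators of single tensor factors and their quadratic relations\<close>

definition tspace :: "('a list \<Rightarrow>\<^sub>0 complex) set" where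
  "tspace = {v. Poly_Mapping.keys v \<subseteq> tbasis}"

definition Xp :: "sign \<Rightarrow> 'b mod_ring \<Rightarrow> nat \<Rightarrow> int \<Rightarrow> ('a list \<Rightarrow>\<^sub>0 complex) \<Rightarrow> ('a list \<Rightarrow>\<^sub>0 complex)" where
  "Xp \<epsilon> i p s = lin (\<lambda>b. Poly_Mapping.single (mvp \<epsilon> i p b) (cf \<epsilon> i p b * spec i p b powi s))"

abbreviation th :: "sign \<Rightarrow> 'b mod_ring \<Rightarrow> nat \<Rightarrow> sign \<Rightarrow> 'b mod_ring \<Rightarrow> nat \<Rightarrow> 'a list \<Rightarrow> complex" where
  "th \<epsilon> i p \<epsilon>' j p' b \<equiv> theta \<epsilon> \<epsilon>' (cartan_matrix i j) p (spec i p b) p' (spec j p' b)"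

lemma Xp_single:
  "Xp \<epsilon> i p s (Poly_Mapping.single b c) = Poly_Mapping.single (mvp \<epsilon> i p b) (cf \<epsilon> i p b * spec i p b powi s * c)"
  by (simp add: Xp_def mult_ac)

lemma cf_inactive: "\<not> active \<epsilon> i p b \<Longrightarrow> cf \<epsilon> i p b = 0"
  by (simp add: cf_def)

lemma Xp_0 [simp]: "Xp \<epsilon> i p s 0 = 0"
  by (simp add: Xp_def)

lemma Xp_inactive: "\<not> active \<epsilon> i p b \<Longrightarrow> Xp \<epsilon> i p s (Poly_Mapping.single b c) = 0"
  by (simp add: Xp_single cf_inactive)

text \<open>All coefficients and parameters refer to the original vector b, so the order of two
  moves in different factors is visible only in \<open>th\<close>.\<close>

lemma Xp_word2:
  assumes "b \<in> tbasis" "p < k" "p' < k" "p \<noteq> p'"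
  shows "Xp \<epsilon> i p s (Xp \<epsilon>' j p' s' (Poly_Mapping.single b c)) =
    Poly_Mapping.single (mvp \<epsilon> i p (mvp \<epsilon>' j p' b))
      (cf \<epsilon> i p b * cf \<epsilon>' j p' b * th \<epsilon> i p \<epsilon>' j p' b * spec i p b powi s * spec j p' b powi s' * c)"
proof (cases "active \<epsilon>' j p' b")
  case True
  then show ?thesis using assms by (simp add: Xp_single cf_mvp spec_mvp mult_ac)
next
  case False
  then show ?thesis by (simp add: Xp_inactive cf_inactive Xp_def)
qed

text \<open>Exactly one of two distinct positions lies before the other, so one of the two
  \<open>theta\<close> is 1 and the other is the fraction that turns one linear form into the
  other.\<close>

lemma theta_exchange:
  assumes "p < k" "p' < k" "p \<noteq> p'" and "C \<noteq> 0 \<Longrightarrow> x \<noteq> exp t powi (sg \<epsilon> * C) * y"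
    and "C \<noteq> 0 \<Longrightarrow> y \<noteq> exp t powi (sg \<epsilon> * C) * x"
  shows "theta \<epsilon> \<epsilon> C p x p' y * (x - exp t powi (sg \<epsilon> * C) * y) = theta \<epsilon> \<epsilon> C p' y p x * (exp t powi (sg \<epsilon> * C) * x - y)"
proof (cases "C = 0")
  case True
  then show ?thesis by (simp add: theta_def)
next
  case False
  define Q where "Q = exp t powi (sg \<epsilon> * C)"
  have ne: "x - Q * y \<noteq> 0" "y - Q * x \<noteq> 0" using assms(4,5) False by (auto simp: Q_def)
  consider "p \<in> before \<epsilon> p'" "p' \<notin> before \<epsilon> p" | "p' \<in> before \<epsilon> p" "p \<notin> before \<epsilon> p'"
    using assms(1-3) by (cases \<epsilon>; cases "p < p'") (auto simp: before_def)
  then show ?thesis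
  proof cases
    case 1
    then have "theta \<epsilon> \<epsilon> C p x p' y = 1" "theta \<epsilon> \<epsilon> C p' y p x = (Q * y - x) / (y - Q * x)"
      using False by (simp_all add: theta_def Q_def)
    moreover have "(Q * y - x) / (y - Q * x) * (Q * x - y) = x - Q * y"
      using ne by (simp add: divide_simps) (simp add: algebra_simps)
    ultimately show ?thesis by (simp add: Q_def)
  next
    case 2
    then have "theta \<epsilon> \<epsilon> C p' y p x = 1" "theta \<epsilon> \<epsilon> C p x p' y = (Q * x - y) / (x - Q * y)"
      using False by (simp_all add: theta_def Q_def)
    moreover have "(Q * x - y) / (x - Q * y) * (x - Q * y) = Q * x - y"
      using ne by simp
    ultimately show ?thesis by (simp add: Q_def)
  qed
qed

lemma spec_neq_cartan':
  assumes "b \<in> tbasis" "b' \<in> tbasis" "p < k" "p' < k" "p \<noteq> p'" "cartan_matrix i j \<noteq> 0"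
  shows "spec i p b \<noteq> exp t powi (sg \<epsilon> * cartan_matrix i j) * spec j p' b'"
  using spec_neq_cartan[OF assms sg_in[of \<epsilon>]] by (simp add: mult.commute)

lemma th_exchange:
  assumes b: "b \<in> tbasis" and p: "p < k" "p' < k" "p \<noteq> p'"
  shows "th \<epsilon> i p \<epsilon> j p' b * (spec i p b - exp t powi (sg \<epsilon> * cartan_matrix i j) * spec j p' b)
    = th \<epsilon> j p' \<epsilon> i p b * (exp t powi (sg \<epsilon> * cartan_matrix i j) * spec i p b - spec j p' b)"
  unfolding cartan_matrix_sym[of j i]
  using spec_neq_cartan'[OF b b p, of i j \<epsilon>] spec_neq_cartan'[OF b b p(2,1), of j i \<epsilon>] p
  by (intro theta_exchange) (auto simp: cartan_matrix_sym[of j i])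

text \<open>The position p' precedes p for \<open>Plus\<close> exactly when p precedes p' for
  \<open>Minus\<close>, and replacing q by its inverse while exchanging x and y leaves the fraction
  unchanged. Hence opposite moves in different factors commute exactly.\<close>

lemma theta_mixed:
  assumes "p < k" "p' < k" "p \<noteq> p'"
  shows "theta Plus Minus C p x p' y = theta Minus Plus C p' y p x"
proof -
  define R where "R = exp t powi C"
  have R: "R \<noteq> 0" "exp t powi (- C) = inverse R" by (simp_all add: R_def power_int_minus)
  have "(inverse R * x - y) / (x - inverse R * y) = (x - R * y) / (R * x - y)"
    using R(1) by (simp add: divide_simps) (auto simp: algebra_simps)
  also have "\<dots> = (R * y - x) / (y - R * x)"
    by (metis minus_diff_eq minus_divide_divide)
  finally have *: "(inverse R * x - y) / (x - inverse R * y) = (R * y - x) / (y - R * x)" .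
  have "p' \<in> before Plus p \<longleftrightarrow> p \<in> before Minus p'" using assms by (auto simp: before_def)
  then show ?thesis using * by (simp add: theta_def R(2) R_def[symmetric])
qed

lemma Xp_lin_comp: "Xp \<epsilon> i p s (lin f v) = lin (\<lambda>b. Xp \<epsilon> i p s (f b)) v"
  by (simp add: Xp_def lin_lin)

lemma Xp_eq_lin: "Xp \<epsilon> i p s v = lin (\<lambda>b. Xp \<epsilon> i p s (Poly_Mapping.single b 1)) v"
  by (simp add: Xp_def)

lemma Xp_Xp_eq_lin: "Xp \<epsilon> i p s (Xp \<epsilon>' j p' s' v) = lin (\<lambda>b. Xp \<epsilon> i p s (Xp \<epsilon>' j p' s' (Poly_Mapping.single b 1))) v"
  by (subst (1) Xp_eq_lin[of \<epsilon>']) (simp add: Xp_lin_comp)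

lemma Xp_Xp_Xp_eq_lin: "Xp \<epsilon> i p s (Xp \<epsilon>' j p' s' (Xp \<epsilon>'' l p'' s'' v)) =
    lin (\<lambda>b. Xp \<epsilon> i p s (Xp \<epsilon>' j p' s' (Xp \<epsilon>'' l p'' s'' (Poly_Mapping.single b 1)))) v"
  by (subst Xp_Xp_eq_lin) (simp add: Xp_lin_comp)

lemma powi_pred: "x \<noteq> 0 \<Longrightarrow> x powi s = x powi (s - 1) * (x :: complex)"
  by (simp add: power_int_diff)

lemma Xp_twice:
  assumes "b \<in> tbasis" "p < k"
  shows "Xp \<epsilon> i p s (Xp \<epsilon> i p s' (Poly_Mapping.single b c)) = 0"
proof (cases "active \<epsilon> i p b")
  case True
  then have "\<not> active \<epsilon> i p (mvp \<epsilon> i p b)"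
    using assms by (auto simp: active_def mvp_nth u_mv tbasisD)
  then show ?thesis by (simp add: Xp_single cf_inactive)
qed (simp add: Xp_inactive)

lemma adjacent_active:
  assumes "b \<in> tbasis" "p < k" "cartan_matrix i j = -1" "active \<epsilon> j p b" "active \<epsilon> i p (mvp \<epsilon> j p b)"
  shows "spec i p (mvp \<epsilon> j p b) = exp t powi (- sg \<epsilon>) * spec j p b" "u i (b ! p) = 0"
proof -
  have "cartan_matrix j i = -1" using assms(3) cartan_matrix_sym by metis
  with mv_adjacent_sign[of "b ! p" j \<epsilon> i] assms
  have *: "u i (b ! p) = 0" "e i (mv \<epsilon> j (b ! p)) = e j (b ! p) - sg \<epsilon>"
    by (auto simp: active_def mvp_nth tbasisD)
  show "u i (b ! p) = 0" by fact
  show "spec i p (mvp \<epsilon> j p b) = exp t powi (- sg \<epsilon>) * spec j p b"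
    using *(2) assms by (simp add: spec_def mvp_nth power_int_diff power_int_minus divide_inverse mult_ac)
qed

text \<open>If both moves are possible, their parameters are proportional with exactly the scalar of
  the quadratic relation for neighbouring nodes; each side of that relation then vanishes by
  itself.\<close>

lemma Xp_adjacent:
  assumes "b \<in> tbasis" "p < k" "cartan_matrix i j = -1"
  shows "Xp \<epsilon> i p s (Xp \<epsilon> j p (s' - 1) (Poly_Mapping.single b c))
    = exp t powi (- sg \<epsilon>) *\<^sub>C Xp \<epsilon> i p (s - 1) (Xp \<epsilon> j p s' (Poly_Mapping.single b c))"
proof (cases "active \<epsilon> j p b \<and> active \<epsilon> i p (mvp \<epsilon> j p b)")
  case True
  with adjacent_active[OF assms] have sp: "spec i p (mvp \<epsilon> j p b) = exp t powi (- sg \<epsilon>) * spec j p b" by simp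
  have nz: "spec j p b \<noteq> 0" "spec i p (mvp \<epsilon> j p b) \<noteq> 0" using spec_nonzero assms by auto
  have "spec i p (mvp \<epsilon> j p b) powi s * spec j p b powi (s' - 1)
    = exp t powi (- sg \<epsilon>) * (spec i p (mvp \<epsilon> j p b) powi (s - 1) * spec j p b powi s')"
    unfolding powi_pred[OF nz(1), of s'] powi_pred[OF nz(2), of s]
    by (subst (2) sp) (simp add: mult_ac)
  from arg_cong[OF this, of "\<lambda>z. Poly_Mapping.single (mvp \<epsilon> i p (mvp \<epsilon> j p b)) (cf \<epsilon> i p (mvp \<epsilon> j p b) * cf \<epsilon> j p b * c * z)"]
  show ?thesis unfolding Xp_single cscale_single by (simp only: mult_ac)
next
  case False
  then show ?thesis by (auto simp: Xp_single cf_inactive)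
qed

lemma cf_mvp_self:
  assumes "b \<in> tbasis" "p < k" "active \<epsilon> i p b" "active \<epsilon> i p (mvp \<epsilon>' j p b)"
    "spec i p (mvp \<epsilon>' j p b) = spec i p b"
  shows "cf \<epsilon> i p (mvp \<epsilon>' j p b) = cf \<epsilon> i p b"
proof -
  have "p' \<noteq> p" if "p' \<in> before \<epsilon> p" for p' using that before_subset assms(2) by auto
  then have "(\<Prod>p'\<in>before \<epsilon> p. phi_value t (u i (mvp \<epsilon>' j p b ! p')) (spec i p' (mvp \<epsilon>' j p b) / spec i p b))
    = (\<Prod>p'\<in>before \<epsilon> p. phi_value t (u i (b ! p')) (spec i p' b / spec i p b))"
    using assms by (intro prod.cong refl) (simp add: mvp_nth spec_mvp)
  then show ?thesis using assms(3-5) by (simp add: cf_def)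
qed

lemma Xp_far_self:
  assumes b: "b \<in> tbasis" "p < k" and C: "cartan_matrix i j = 0"
  shows "Xp \<epsilon> i p s (Xp \<epsilon>' j p s' (Poly_Mapping.single b c)) = Xp \<epsilon>' j p s' (Xp \<epsilon> i p s (Poly_Mapping.single b c))"
proof -
  have C': "cartan_matrix j i = 0" using C cartan_matrix_sym by metis
  have col: "b ! p \<in> Col" using b tbasisD by simp
  have 1: "active \<epsilon> i p (mvp \<epsilon>' j p b) = active \<epsilon> i p b" "spec i p (mvp \<epsilon>' j p b) = spec i p b"
    if "active \<epsilon>' j p b"
    using mv_far_sign[OF col _ C', of \<epsilon>'] that b by (auto simp: active_def spec_def mvp_nth)
  have 2: "active \<epsilon>' j p (mvp \<epsilon> i p b) = active \<epsilon>' j p b" "spec j p (mvp \<epsilon> i p b) = spec j p b"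
    if "active \<epsilon> i p b"
    using mv_far_sign[OF col _ C, of \<epsilon>] that b by (auto simp: active_def spec_def mvp_nth)
  show ?thesis
  proof (cases "active \<epsilon> i p b \<and> active \<epsilon>' j p b")
    case True
    then have "mvp \<epsilon> i p (mvp \<epsilon>' j p b) = mvp \<epsilon>' j p (mvp \<epsilon> i p b)"
      using mv_commute_sign[OF col _ _ C, of \<epsilon> \<epsilon>'] b by (simp add: mvp_def active_def tbasisD)
    then show ?thesis using True 1 2 b by (simp add: Xp_single cf_mvp_self mult_ac)
  next
    case False
    have "Xp \<epsilon> i p s (Xp \<epsilon>' j p s' (Poly_Mapping.single b c)) = 0"
      using False 1 by (cases "active \<epsilon>' j p b") (simp_all add: Xp_single cf_inactive)
    moreover have "Xp \<epsilon>' j p s' (Xp \<epsilon> i p s (Poly_Mapping.single b c)) = 0"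
      using False 2 by (cases "active \<epsilon> i p b") (simp_all add: Xp_single cf_inactive)
    ultimately show ?thesis by simp
  qed
qed

text \<open>For different factors this is \<open>th_exchange\<close> multiplied by monomials in the
  parameters. Within one factor all words vanish for equal nodes, each side vanishes for
  neighbouring nodes, and distant nodes commute.\<close>

lemma Xp_same_sign_single:
  assumes b: "b \<in> tbasis" and p: "p < k" "p' < k"
  shows "Xp \<epsilon> i p s (Xp \<epsilon> j p' (s' - 1) (Poly_Mapping.single b 1))
       - exp t powi (sg \<epsilon> * cartan_matrix i j) *\<^sub>C Xp \<epsilon> i p (s - 1) (Xp \<epsilon> j p' s' (Poly_Mapping.single b 1))
    = exp t powi (sg \<epsilon> * cartan_matrix i j) *\<^sub>C Xp \<epsilon> j p' (s' - 1) (Xp \<epsilon> i p s (Poly_Mapping.single b 1))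
       - Xp \<epsilon> j p' s' (Xp \<epsilon> i p (s - 1) (Poly_Mapping.single b 1))"
proof (cases "p = p'")
  case False
  define Q where "Q = exp t powi (sg \<epsilon> * cartan_matrix i j)"
  define x y where "x = spec i p b" and "y = spec j p' b"
  have nz: "x \<noteq> 0" "y \<noteq> 0" using spec_nonzero p by (auto simp: x_def y_def)
  have ex: "th \<epsilon> i p \<epsilon> j p' b * (x - Q * y) = th \<epsilon> j p' \<epsilon> i p b * (Q * x - y)"
    using th_exchange[OF b p False] unfolding x_def y_def Q_def .
  have "cf \<epsilon> i p b * cf \<epsilon> j p' b * th \<epsilon> i p \<epsilon> j p' b * x powi s * y powi (s' - 1)
      - Q * (cf \<epsilon> i p b * cf \<epsilon> j p' b * th \<epsilon> i p \<epsilon> j p' b * x powi (s - 1) * y powi s')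
    = (cf \<epsilon> i p b * cf \<epsilon> j p' b * x powi (s - 1) * y powi (s' - 1)) * (th \<epsilon> i p \<epsilon> j p' b * (x - Q * y))"
    unfolding powi_pred[OF nz(1), of s] powi_pred[OF nz(2), of s'] by (simp add: algebra_simps)
  also have "\<dots> = Q * (cf \<epsilon> j p' b * cf \<epsilon> i p b * th \<epsilon> j p' \<epsilon> i p b * y powi (s' - 1) * x powi s)
      - cf \<epsilon> j p' b * cf \<epsilon> i p b * th \<epsilon> j p' \<epsilon> i p b * y powi s' * x powi (s - 1)"
    unfolding ex powi_pred[OF nz(1), of s] powi_pred[OF nz(2), of s'] by (simp add: algebra_simps)
  finally show ?thesis
    unfolding Q_def[symmetric] using b p False mvp_swap[OF False, of \<epsilon> i \<epsilon> j b]
    by (simp add: Xp_word2 x_def[symmetric] y_def[symmetric] flip: single_diff)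
next
  case True
  show ?thesis
  proof (cases i j rule: cartan_matrix_cases)
    case 1
    then show ?thesis using True Xp_twice b p by simp
  next
    case 2
    then have "cartan_matrix j i = -1" using cartan_matrix_sym by metis
    then show ?thesis using Xp_adjacent[OF b p(1), of i j \<epsilon> s s' 1]
      Xp_adjacent[OF b p(1), of j i \<epsilon> s' s 1] True 2 by simp
  next
    case 3
    then show ?thesis using Xp_far_self[OF b p(1) 3(4)] True by simp
  qed
qed

lemma lin_cong_tspace: "v \<in> tspace \<Longrightarrow> (\<And>b. b \<in> tbasis \<Longrightarrow> f b = g b) \<Longrightarrow> lin f v = lin g v"
  by (rule lin_cong) (auto simp: tspace_def)

lemma Xp_same_sign:
  assumes "v \<in> tspace" "p < k" "p' < k"
  shows "Xp \<epsilon> i p s (Xp \<epsilon> j p' (s' - 1) v)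
       - exp t powi (sg \<epsilon> * cartan_matrix i j) *\<^sub>C Xp \<epsilon> i p (s - 1) (Xp \<epsilon> j p' s' v)
    = exp t powi (sg \<epsilon> * cartan_matrix i j) *\<^sub>C Xp \<epsilon> j p' (s' - 1) (Xp \<epsilon> i p s v)
       - Xp \<epsilon> j p' s' (Xp \<epsilon> i p (s - 1) v)"
  unfolding Xp_Xp_eq_lin[of _ _ _ _ _ _ _ _ v] lin_scale_fun lin_minus_fun
  using assms by (intro lin_cong_tspace Xp_same_sign_single)

lemma Xp_far:
  assumes "v \<in> tspace" "p < k" "p' < k" "cartan_matrix i j = 0" "\<epsilon> = \<epsilon>'"
  shows "Xp \<epsilon> i p s (Xp \<epsilon>' j p' s' v) = Xp \<epsilon>' j p' s' (Xp \<epsilon> i p s v)"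
  unfolding Xp_Xp_eq_lin[of _ _ _ _ _ _ _ _ v]
proof (rule lin_cong_tspace[OF assms(1)])
  fix b assume b: "b \<in> tbasis"
  show "Xp \<epsilon> i p s (Xp \<epsilon>' j p' s' (Poly_Mapping.single b 1)) = Xp \<epsilon>' j p' s' (Xp \<epsilon> i p s (Poly_Mapping.single b 1))"
  proof (cases "p = p'")
    case True
    then show ?thesis using Xp_far_self assms b by simp
  next
    case False
    moreover have "cartan_matrix j i = 0" using assms cartan_matrix_sym by metis
    ultimately show ?thesis using b assms mvp_swap[OF False, of \<epsilon> i \<epsilon> j b]
      by (simp add: Xp_word2 theta_def mult_ac)
  qed
qed

lemma Xp_mixed_neq:
  assumes b: "b \<in> tbasis" and p: "p < k" "p' < k" "p \<noteq> p'"
  shows "Xp Plus i p s (Xp Minus j p' s' (Poly_Mapping.single b c)) = Xp Minus j p' s' (Xp Plus i p s (Poly_Mapping.single b c))"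
  using b p mvp_swap[OF p(3), of Plus i Minus j b] theta_mixed[OF p, of "cartan_matrix i j" "spec i p b" "spec j p' b"]
    cartan_matrix_sym[of j i]
  by (simp add: Xp_word2 mult_ac)

text \<open>For neighbouring nodes both words are zero: after a move at one node the weight at the
  other is 0 or has the sign that blocks the opposite move.\<close>

lemma Xp_mixed_self:
  assumes b: "b \<in> tbasis" and p: "p < k" and ij: "i \<noteq> j"
  shows "Xp Plus i p s (Xp Minus j p s' (Poly_Mapping.single b c)) = Xp Minus j p s' (Xp Plus i p s (Poly_Mapping.single b c))"
proof (cases i j rule: cartan_matrix_cases)
  case 1
  then show ?thesis using ij by simp
next
  case 2
  have col: "b ! p \<in> Col" using b p tbasisD by simp
  have C: "cartan_matrix j i = -1" using 2 cartan_matrix_sym by metis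
  have "Xp Plus i p s (Xp Minus j p s' (Poly_Mapping.single b c)) = 0"
    using mv_adjacent_sign[OF col _ C, of Minus] b p
    by (cases "active Minus j p b") (auto simp: Xp_single cf_def active_def mvp_nth)
  moreover have "Xp Minus j p s' (Xp Plus i p s (Poly_Mapping.single b c)) = 0"
    using mv_adjacent_sign[OF col _ 2(3), of Plus] b p
    by (cases "active Plus i p b") (auto simp: Xp_single cf_def active_def mvp_nth)
  ultimately show ?thesis by simp
next
  case 3
  then show ?thesis using Xp_far_self[OF b p 3(4)] by simp
qed

end

section \<open>The Serre relation\<close>

text \<open>Here P and R are q^(+-1) and its inverse, x1 and x2 the parameters of the moves along i,
  and y that of the move along j. Up to a common scalar, the products are the exchange factors of
  the six words when the three moves occur in different tensor factors.\<close>

lemma serre_identity: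
  fixes P R x1 x2 y :: complex
  assumes PR: "P * R = 1"
  shows "(P * P * x1 - x2) * ((R * x1 - y) * (R * x2 - y) - (P + R) * ((R * x1 - y) * (x2 - R * y)) + (x1 - R * y) * (x2 - R * y))
    + (x1 - P * P * x2) * ((R * x1 - y) * (R * x2 - y) - (P + R) * ((R * x2 - y) * (x1 - R * y)) + (x1 - R * y) * (x2 - R * y)) = 0"
proof -
  have PR': "P * (R * x) = x" for x using PR by (simp flip: mult.assoc)
  show ?thesis by (simp add: algebra_simps PR PR')
qed

text \<open>The general identity at x1 = R y, divided by R x1 - y: the case of a column that moves
  along j and then along i, in which the words with the opposite order drop out.\<close>

lemma serre_identity_left:
  fixes P R x2 y :: complex
  assumes PR: "P * R = 1"
  shows "(R * x2 - y) * (P * P * (R * y) - x2) - (P + R) * ((x2 - R * y) * (P * P * (R * y) - x2))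
    + (R * x2 - y) * (R * y - P * P * x2) = 0"
proof -
  have PR': "P * (R * x) = x" for x using PR by (simp flip: mult.assoc)
  show ?thesis by (simp add: algebra_simps PR PR')
qed

text \<open>The general identity at y = R x1, divided by x1 - R y: the case of a column that moves
  along i and then along j.\<close>

lemma serre_identity_right:
  fixes P R x1 x2 y :: complex
  assumes PR: "P * R = 1"
  shows "(x2 - R * (R * x1)) * (P * P * x1 - x2) - (P + R) * ((R * x2 - R * x1) * (x1 - P * P * x2))
    + (x2 - R * (R * x1)) * (x1 - P * P * x2) = 0"
proof -
  have PR': "P * (R * x) = x" for x using PR by (simp flip: mult.assoc)
  show ?thesis by (simp add: algebra_simps PR PR')
qed

context column_tensor
begin

text \<open>Both exchange factors are written as multiples of linear forms by one unknown \<kappa>.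
  In a Serre sum the \<kappa> factor out, and only a polynomial identity remains.\<close>

lemma th_pair:
  fixes \<epsilon> i j
  assumes b: "b \<in> tbasis" and p: "p < k" "p' < k" "p \<noteq> p'" and C: "cartan_matrix i j \<noteq> 0"
  defines "Q \<equiv> \<lambda>i j. exp t powi (sg \<epsilon> * cartan_matrix i j)"
  obtains \<kappa> where "th \<epsilon> i p \<epsilon> j p' b = \<kappa> * (Q i j * spec i p b - spec j p' b)"
    "th \<epsilon> j p' \<epsilon> i p b = \<kappa> * (spec i p b - Q i j * spec j p' b)"
proof -
  have ne: "spec i p b - Q i j * spec j p' b \<noteq> 0"
    using spec_neq_cartan'[OF b b p C, of \<epsilon>] by (simp add: Q_def)
  show ?thesis
  proof
    let ?\<kappa> = "th \<epsilon> j p' \<epsilon> i p b / (spec i p b - Q i j * spec j p' b)"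
    show "th \<epsilon> j p' \<epsilon> i p b = ?\<kappa> * (spec i p b - Q i j * spec j p' b)" using ne by simp
    show "th \<epsilon> i p \<epsilon> j p' b = ?\<kappa> * (Q i j * spec i p b - spec j p' b)"
      using th_exchange[OF b p, of \<epsilon> i j] ne unfolding Q_def by (simp add: divide_simps)
  qed
qed

lemma Xp_word3:
  assumes b: "b \<in> tbasis" and p: "p1 < k" "p2 < k" "p3 < k" "p1 \<noteq> p2" "p1 \<noteq> p3" "p2 \<noteq> p3"
  shows "Xp \<epsilon> i1 p1 s1 (Xp \<epsilon> i2 p2 s2 (Xp \<epsilon> i3 p3 s3 (Poly_Mapping.single b c))) =
    Poly_Mapping.single (mvp \<epsilon> i1 p1 (mvp \<epsilon> i2 p2 (mvp \<epsilon> i3 p3 b)))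
      (cf \<epsilon> i1 p1 b * cf \<epsilon> i2 p2 b * cf \<epsilon> i3 p3 b * (th \<epsilon> i1 p1 \<epsilon> i2 p2 b * th \<epsilon> i1 p1 \<epsilon> i3 p3 b * th \<epsilon> i2 p2 \<epsilon> i3 p3 b)
        * spec i1 p1 b powi s1 * spec i2 p2 b powi s2 * spec i3 p3 b powi s3 * c)"
proof (cases "active \<epsilon> i3 p3 b")
  case True
  then have "mvp \<epsilon> i3 p3 b \<in> tbasis" using mvp_tbasis b p by simp
  then show ?thesis using True b p
    by (simp add: Xp_single[of \<epsilon> i3] Xp_word2 cf_mvp spec_mvp mult_ac)
next
  case False
  then show ?thesis by (simp add: Xp_inactive cf_inactive)
qed

text \<open>The column p moves along j and then along i, the column p' once along l. The three
  interleavings reach the same tuple \<open>T\<close> with a common scalar \<open>M\<close> and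
  differ only by exchange factors, where those between i and l are taken at b', after the move along
  j.\<close>

lemma Xp_word3_same:
  fixes \<epsilon> i j l s1 s2 s3
  assumes b: "b \<in> tbasis" and p: "p < k" "p' < k" "p \<noteq> p'" and Y: "active \<epsilon> j p b"
  defines "b' \<equiv> mvp \<epsilon> j p b"
  defines "T \<equiv> mvp \<epsilon> i p (mvp \<epsilon> l p' b')"
    and "M \<equiv> cf \<epsilon> j p b * cf \<epsilon> i p b' * cf \<epsilon> l p' b * spec i p b' powi s1 * spec j p b powi s2 * spec l p' b powi s3"
  shows "Xp \<epsilon> i p s1 (Xp \<epsilon> j p s2 (Xp \<epsilon> l p' s3 (Poly_Mapping.single b 1))) =
      Poly_Mapping.single T (M * (th \<epsilon> j p \<epsilon> l p' b * th \<epsilon> i p \<epsilon> l p' b'))"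
    "Xp \<epsilon> i p s1 (Xp \<epsilon> l p' s3 (Xp \<epsilon> j p s2 (Poly_Mapping.single b 1))) =
      Poly_Mapping.single T (M * (th \<epsilon> l p' \<epsilon> j p b * th \<epsilon> i p \<epsilon> l p' b'))"
    "Xp \<epsilon> l p' s3 (Xp \<epsilon> i p s1 (Xp \<epsilon> j p s2 (Poly_Mapping.single b 1))) =
      Poly_Mapping.single T (M * (th \<epsilon> l p' \<epsilon> j p b * th \<epsilon> l p' \<epsilon> i p b'))"
proof -
  have b': "b' \<in> tbasis" using mvp_tbasis b p Y unfolding b'_def by simp
  have cfl: "cf \<epsilon> l p' b' = cf \<epsilon> l p' b * th \<epsilon> l p' \<epsilon> j p b" "spec l p' b' = spec l p' b"
    using cf_mvp[OF b p(2,1) p(3)[symmetric] Y] spec_mvp[OF p(3)[symmetric]] by (simp_all add: b'_def)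
  show "Xp \<epsilon> i p s1 (Xp \<epsilon> l p' s3 (Xp \<epsilon> j p s2 (Poly_Mapping.single b 1))) =
      Poly_Mapping.single T (M * (th \<epsilon> l p' \<epsilon> j p b * th \<epsilon> i p \<epsilon> l p' b'))"
    using b' p unfolding Xp_single[of \<epsilon> j] b'_def[symmetric] T_def M_def
    by (simp add: Xp_word2 cfl mult_ac)
  show "Xp \<epsilon> l p' s3 (Xp \<epsilon> i p s1 (Xp \<epsilon> j p s2 (Poly_Mapping.single b 1))) =
      Poly_Mapping.single T (M * (th \<epsilon> l p' \<epsilon> j p b * th \<epsilon> l p' \<epsilon> i p b'))"
    using b' p mvp_swap[OF p(3), of \<epsilon> i \<epsilon> l b'] unfolding Xp_single[of \<epsilon> j] b'_def[symmetric] T_def M_def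
    by (simp add: Xp_word2 cfl mult_ac)
  show "Xp \<epsilon> i p s1 (Xp \<epsilon> j p s2 (Xp \<epsilon> l p' s3 (Poly_Mapping.single b 1))) =
      Poly_Mapping.single T (M * (th \<epsilon> j p \<epsilon> l p' b * th \<epsilon> i p \<epsilon> l p' b'))"
  proof (cases "active \<epsilon> l p' b")
    case True
    have T: "T = mvp \<epsilon> i p (mvp \<epsilon> j p (mvp \<epsilon> l p' b))" "mvp \<epsilon> j p (mvp \<epsilon> l p' b) = mvp \<epsilon> l p' b'"
      using mvp_swap[OF p(3), of \<epsilon> j \<epsilon> l b] by (simp_all add: T_def b'_def)
    have "active \<epsilon> l p' b'" using True active_mvp[OF p(3)[symmetric]] by (simp add: b'_def)
    then have "cf \<epsilon> i p (mvp \<epsilon> l p' b') = cf \<epsilon> i p b' * th \<epsilon> i p \<epsilon> l p' b'"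
      using cf_mvp[OF b' p] by simp
    then show ?thesis using b p unfolding T(1)
      by (simp add: Xp_word2) (simp add: Xp_single T(2) spec_mvp M_def mult_ac)
  next
    case False
    then show ?thesis by (simp add: Xp_inactive cf_inactive M_def)
  qed
qed

text \<open>After moving along i the weight of the column at i is \<open>sg \<epsilon>\<close>; one
  move along a neighbouring node can bring it to 0 but not to \<open>- sg \<epsilon>\<close>, which
  a second move along i would require.\<close>

lemma Xp_sandwich:
  assumes b: "b \<in> tbasis" and p: "p < k" "p' < k" and C: "cartan_matrix i j = -1"
  shows "Xp \<epsilon> i p s (Xp \<epsilon> j p' s' (Xp \<epsilon> i p s'' (Poly_Mapping.single b c))) = 0"
proof (cases "active \<epsilon> i p b \<and> active \<epsilon> j p' (mvp \<epsilon> i p b)")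
  case True
  let ?b = "mvp \<epsilon> i p b"
  have b': "?b \<in> tbasis" using b p True mvp_tbasis by simp
  have u: "u i (?b ! p) = sg \<epsilon>" using True b p by (simp add: active_def mvp_nth u_mv tbasisD)
  have "cartan_matrix j i = -1" using C cartan_matrix_sym by metis
  then have "\<not> active \<epsilon> i p (mvp \<epsilon> j p' ?b)"
    using mv_adjacent_sign[of "?b ! p'" j \<epsilon> i] True b' p u
    by (cases "p = p'") (auto simp: active_def mvp_nth tbasisD)
  then show ?thesis by (simp add: Xp_single cf_inactive)
next
  case False
  then show ?thesis by (auto simp: Xp_single cf_inactive)
qed

lemma Xp_twice': 
  assumes "b \<in> tbasis" "p < k" "p' < k"
  shows "Xp \<epsilon> i p s (Xp \<epsilon> i p s' (Xp \<epsilon>' j p' s'' (Poly_Mapping.single b c))) = 0"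
proof (cases "active \<epsilon>' j p' b")
  case True
  then show ?thesis using Xp_twice[OF mvp_tbasis] assms by (simp add: Xp_single[of \<epsilon>'])
next
  case False
  then show ?thesis by (simp add: Xp_inactive)
qed

lemma Xp_word_zero:
  assumes b: "b \<in> tbasis" and p: "p < k" "p' < k" "p \<noteq> p'"
    and inactive: "\<not> (active \<epsilon> j p b \<and> active \<epsilon> i p (mvp \<epsilon> j p b))"
  shows "Xp \<epsilon> i p s (Xp \<epsilon> j p s' (Poly_Mapping.single b c)) = 0"
    "Xp \<epsilon> i p s (Xp \<epsilon> l p' s'' (Xp \<epsilon> j p s' (Poly_Mapping.single b c))) = 0"
    "Xp \<epsilon> i p s (Xp \<epsilon> j p s' (Xp \<epsilon> l p' s'' (Poly_Mapping.single b c))) = 0"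
proof -
  have *: "Xp \<epsilon> i p s (Xp \<epsilon> j p s' (Poly_Mapping.single b c)) = 0"
    if "\<not> (active \<epsilon> j p b \<and> active \<epsilon> i p (mvp \<epsilon> j p b))" for b c
    using that by (auto simp: Xp_single cf_inactive)
  show "Xp \<epsilon> i p s (Xp \<epsilon> j p s' (Poly_Mapping.single b c)) = 0" by (rule *) (rule inactive)
  have "mvp \<epsilon> j p (mvp \<epsilon> l p' b) = mvp \<epsilon> l p' (mvp \<epsilon> j p b)" using p(3) by (rule mvp_swap)
  then have "\<not> (active \<epsilon> j p (mvp \<epsilon> l p' b) \<and> active \<epsilon> i p (mvp \<epsilon> j p (mvp \<epsilon> l p' b)))"
    using inactive p(3) by (simp add: active_mvp)
  then show "Xp \<epsilon> i p s (Xp \<epsilon> j p s' (Xp \<epsilon> l p' s'' (Poly_Mapping.single b c))) = 0"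
    unfolding Xp_single[of \<epsilon> l] by (rule *)
  show "Xp \<epsilon> i p s (Xp \<epsilon> l p' s'' (Xp \<epsilon> j p s' (Poly_Mapping.single b c))) = 0"
    using inactive p(3) by (auto simp: Xp_single cf_inactive active_mvp)
qed

definition serre_word :: "sign \<Rightarrow> 'b mod_ring \<Rightarrow> nat \<Rightarrow> int \<Rightarrow> nat \<Rightarrow> int \<Rightarrow> 'b mod_ring \<Rightarrow> nat \<Rightarrow> int \<Rightarrow>
    ('a list \<Rightarrow>\<^sub>0 complex) \<Rightarrow> ('a list \<Rightarrow>\<^sub>0 complex)" where
  "serre_word \<epsilon> i p1 s1 p2 s2 j p s v =
     Xp \<epsilon> i p1 s1 (Xp \<epsilon> i p2 s2 (Xp \<epsilon> j p s v))
     - (exp t + inverse (exp t)) *\<^sub>C Xp \<epsilon> i p1 s1 (Xp \<epsilon> j p s (Xp \<epsilon> i p2 s2 v))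
     + Xp \<epsilon> j p s (Xp \<epsilon> i p1 s1 (Xp \<epsilon> i p2 s2 v))"

text \<open>Within one column either i can follow j or j can follow i, never both, because the node
  that moves second has weight 0 at the start. At most three of the six words survive, and the
  specialised identities apply to them.\<close>

lemma serre_same:
  assumes b: "b \<in> tbasis" and p: "p < k" "p' < k" "p \<noteq> p'" and C: "cartan_matrix i j = -1"
  shows "serre_word \<epsilon> i p s1 p' s2 j p s (Poly_Mapping.single b 1) + serre_word \<epsilon> i p' s2 p s1 j p s (Poly_Mapping.single b 1) = 0"
proof -
  define P R where "P = exp t powi (sg \<epsilon>)" and "R = exp t powi (- sg \<epsilon>)"
  have PR: "P * R = 1" by (simp add: P_def R_def power_int_minus)
  have PP: "exp t powi (sg \<epsilon> * 2) = P * P" by (simp add: P_def power_int_mult power2_eq_square)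
  have c: "exp t + inverse (exp t) = P + R" by (cases \<epsilon>) (simp_all add: P_def R_def power_int_minus)
  have Cii: "cartan_matrix i i = 2" by (simp add: cartan_matrix_def)
  have Cji: "cartan_matrix j i = -1" using C cartan_matrix_sym by metis
  consider (J) "active \<epsilon> j p b" "active \<epsilon> i p (mvp \<epsilon> j p b)"
    | (A) "active \<epsilon> i p b" "active \<epsilon> j p (mvp \<epsilon> i p b)"
    | (N) "\<not> (active \<epsilon> j p b \<and> active \<epsilon> i p (mvp \<epsilon> j p b))" "\<not> (active \<epsilon> i p b \<and> active \<epsilon> j p (mvp \<epsilon> i p b))"
    by blast
  then show ?thesis
  proof cases
    case J
    define b' where "b' = mvp \<epsilon> j p b"
    have b': "b' \<in> tbasis" using J b p mvp_tbasis by (simp add: b'_def)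
    have A0: "\<not> active \<epsilon> i p b" and x1: "spec i p b' = R * spec j p b"
      using adjacent_active[OF b p(1) C J] by (simp_all add: active_def b'_def R_def)
    have x2: "spec i p' b' = spec i p' b" using spec_mvp[OF p(3)[symmetric]] by (simp add: b'_def)
    obtain \<kappa> where 1: "th \<epsilon> i p' \<epsilon> j p b = \<kappa> * (R * spec i p' b - spec j p b)"
        "th \<epsilon> j p \<epsilon> i p' b = \<kappa> * (spec i p' b - R * spec j p b)"
      using th_pair[OF b p(2,1) p(3)[symmetric], of i j \<epsilon>] unfolding C R_def by auto
    obtain \<kappa>' where 2: "th \<epsilon> i p \<epsilon> i p' b' = \<kappa>' * (P * P * (R * spec j p b) - spec i p' b)"
        "th \<epsilon> i p' \<epsilon> i p b' = \<kappa>' * (R * spec j p b - P * P * spec i p' b)"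
      using th_pair[OF b' p, of i i \<epsilon>] unfolding Cii PP x1 x2 by auto
    have zero: "Xp \<epsilon> i p s1 (Poly_Mapping.single b 1) = 0" "Xp \<epsilon> i p s1 (Xp \<epsilon> i p' s2 (Poly_Mapping.single b 1)) = 0"
      using A0 b p by (simp_all add: Xp_word2 cf_inactive Xp_inactive)
    define M where "M = cf \<epsilon> j p b * cf \<epsilon> i p b' * cf \<epsilon> i p' b * spec i p b' powi s1 * spec j p b powi s * spec i p' b powi s2"
    define z where "z = (R * spec i p' b - spec j p b) * (P * P * (R * spec j p b) - spec i p' b)
      - (P + R) * ((spec i p' b - R * spec j p b) * (P * P * (R * spec j p b) - spec i p' b))
      + (R * spec i p' b - spec j p b) * (R * spec j p b - P * P * spec i p' b)"
    have "serre_word \<epsilon> i p s1 p' s2 j p s (Poly_Mapping.single b 1) + serre_word \<epsilon> i p' s2 p s1 j p s (Poly_Mapping.single b 1)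
      = Poly_Mapping.single (mvp \<epsilon> i p (mvp \<epsilon> i p' b')) (M * (\<kappa> * \<kappa>') * z)"
      unfolding serre_word_def zero c Xp_word3_same[OF b p J(1)] b'_def[symmetric] M_def[symmetric] 1 2 cscale_single Xp_0
        cscale_simps diff_zero add_0_right single_add[symmetric] single_diff[symmetric]
      by (rule arg_cong[of _ _ "Poly_Mapping.single _"]) (simp add: z_def algebra_simps)
    then show ?thesis using serre_identity_left[OF PR] by (simp add: z_def)
  next
    case A
    define b' where "b' = mvp \<epsilon> i p b"
    have b': "b' \<in> tbasis" using A b p mvp_tbasis by (simp add: b'_def)
    have J0: "\<not> active \<epsilon> j p b" and y: "spec j p b' = R * spec i p b"
      using adjacent_active[OF b p(1) Cji A] by (simp_all add: active_def b'_def R_def)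
    have x2: "spec i p' b' = spec i p' b" using spec_mvp[OF p(3)[symmetric]] by (simp add: b'_def)
    obtain \<kappa> where 1: "th \<epsilon> i p \<epsilon> i p' b = \<kappa> * (P * P * spec i p b - spec i p' b)"
        "th \<epsilon> i p' \<epsilon> i p b = \<kappa> * (spec i p b - P * P * spec i p' b)"
      using th_pair[OF b p, of i i \<epsilon>] unfolding Cii PP by auto
    obtain \<kappa>' where 2: "th \<epsilon> i p' \<epsilon> j p b' = \<kappa>' * (R * spec i p' b - R * spec i p b)"
        "th \<epsilon> j p \<epsilon> i p' b' = \<kappa>' * (spec i p' b - R * (R * spec i p b))"
      using th_pair[OF b' p(2,1) p(3)[symmetric], of i j \<epsilon>] unfolding C R_def[symmetric] x2 y by (auto simp: R_def)
    have zero: "Xp \<epsilon> j p s (Poly_Mapping.single b 1) = 0" "Xp \<epsilon> j p s (Xp \<epsilon> i p' s2 (Poly_Mapping.single b 1)) = 0"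
      using J0 b p by (simp_all add: Xp_word2 cf_inactive Xp_inactive)
    define M where "M = cf \<epsilon> i p b * cf \<epsilon> j p b' * cf \<epsilon> i p' b * spec j p b' powi s * spec i p b powi s1 * spec i p' b powi s2"
    define z where "z = (spec i p' b - R * (R * spec i p b)) * (P * P * spec i p b - spec i p' b)
      - (P + R) * ((R * spec i p' b - R * spec i p b) * (spec i p b - P * P * spec i p' b))
      + (spec i p' b - R * (R * spec i p b)) * (spec i p b - P * P * spec i p' b)"
    have "serre_word \<epsilon> i p s1 p' s2 j p s (Poly_Mapping.single b 1) + serre_word \<epsilon> i p' s2 p s1 j p s (Poly_Mapping.single b 1)
      = Poly_Mapping.single (mvp \<epsilon> j p (mvp \<epsilon> i p' b')) (M * (\<kappa> * \<kappa>') * z)"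
      unfolding serre_word_def zero c Xp_word3_same[OF b p A(1)] b'_def[symmetric] M_def[symmetric] 1 2 cscale_single Xp_0
        cscale_simps diff_zero add_0_left single_add[symmetric] single_diff[symmetric] diff_0_right
      by (simp only: diff_zero add_0_left single_uminus[symmetric] single_add[symmetric] single_diff[symmetric] diff_0)
        (rule arg_cong[of _ _ "Poly_Mapping.single _"], simp add: z_def algebra_simps)
    then show ?thesis using serre_identity_right[OF PR] by (simp add: z_def)
  next
    case N
    show ?thesis unfolding serre_word_def using Xp_word_zero[OF b p N(1)] Xp_word_zero[OF b p N(2)] by simp
  qed
qed

text \<open>If both moves along i fall on one column, every word vanishes. If the move along j
  shares its column with one of them, \<open>serre_same\<close> applies. Otherwise all six words end
  in the same tuple, and \<open>serre_identity\<close> remains.\<close>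

lemma serre_single:
  assumes b: "b \<in> tbasis" and p: "p1 < k" "p2 < k" "p < k" and C: "cartan_matrix i j = -1"
  shows "serre_word \<epsilon> i p1 s1 p2 s2 j p s (Poly_Mapping.single b 1) + serre_word \<epsilon> i p2 s2 p1 s1 j p s (Poly_Mapping.single b 1) = 0"
proof -
  have Cji: "cartan_matrix j i = -1" using C cartan_matrix_sym by metis
  consider "p1 = p2" | "p1 \<noteq> p2" "p = p1" | "p1 \<noteq> p2" "p = p2" | "p1 \<noteq> p2" "p \<noteq> p1" "p \<noteq> p2" by blast
  then show ?thesis
  proof cases
    case 1
    then show ?thesis using b p C by (simp add: serre_word_def Xp_twice' Xp_twice Xp_sandwich)
  next
    case 2
    then show ?thesis using serre_same[OF b p(1,2) 2(1) C] by simp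
  next
    case 3
    then show ?thesis using serre_same[OF b p(2,1) 3(1)[symmetric] C] by (simp add: add.commute)
  next
    case 4
    define P R where "P = exp t powi (sg \<epsilon>)" and "R = exp t powi (- sg \<epsilon>)"
    have PR: "P * R = 1" by (simp add: P_def R_def power_int_minus)
    have PP: "exp t powi (sg \<epsilon> * 2) = P * P" by (simp add: P_def power_int_mult power2_eq_square)
    have c: "exp t + inverse (exp t) = P + R" by (cases \<epsilon>) (simp_all add: P_def R_def power_int_minus)
    have Cii: "cartan_matrix i i = 2" by (simp add: cartan_matrix_def)
    define x1 x2 y where "x1 = spec i p1 b" and "x2 = spec i p2 b" and "y = spec j p b"
    obtain \<kappa>1 where 1: "th \<epsilon> i p1 \<epsilon> i p2 b = \<kappa>1 * (P * P * x1 - x2)" "th \<epsilon> i p2 \<epsilon> i p1 b = \<kappa>1 * (x1 - P * P * x2)"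
      using th_pair[OF b p(1,2) 4(1), of i i \<epsilon>] unfolding Cii PP x1_def x2_def by auto
    obtain \<kappa>2 where 2: "th \<epsilon> i p1 \<epsilon> j p b = \<kappa>2 * (R * x1 - y)" "th \<epsilon> j p \<epsilon> i p1 b = \<kappa>2 * (x1 - R * y)"
      using th_pair[OF b p(1,3) 4(2)[symmetric], of i j \<epsilon>] unfolding C x1_def y_def R_def by auto
    obtain \<kappa>3 where 3: "th \<epsilon> i p2 \<epsilon> j p b = \<kappa>3 * (R * x2 - y)" "th \<epsilon> j p \<epsilon> i p2 b = \<kappa>3 * (x2 - R * y)"
      using th_pair[OF b p(2,3) 4(3)[symmetric], of i j \<epsilon>] unfolding C x2_def y_def R_def by auto
    note th = 1[folded x1_def x2_def] 2[folded x1_def y_def] 3[folded x2_def y_def]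
    define T where "T = mvp \<epsilon> i p1 (mvp \<epsilon> i p2 (mvp \<epsilon> j p b))"
    have T: "mvp \<epsilon> i p1 (mvp \<epsilon> j p (mvp \<epsilon> i p2 b)) = T" "mvp \<epsilon> j p (mvp \<epsilon> i p1 (mvp \<epsilon> i p2 b)) = T"
      "mvp \<epsilon> i p2 (mvp \<epsilon> i p1 (mvp \<epsilon> j p b)) = T" "mvp \<epsilon> i p2 (mvp \<epsilon> j p (mvp \<epsilon> i p1 b)) = T"
      "mvp \<epsilon> j p (mvp \<epsilon> i p2 (mvp \<epsilon> i p1 b)) = T"
      using mvp_swap[OF 4(1)] mvp_swap[OF 4(2)] mvp_swap[OF 4(3)] unfolding T_def by metis+
    define M where "M = cf \<epsilon> i p1 b * cf \<epsilon> i p2 b * cf \<epsilon> j p b * x1 powi s1 * x2 powi s2 * y powi s * (\<kappa>1 * \<kappa>2 * \<kappa>3)"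
    have "serre_word \<epsilon> i p1 s1 p2 s2 j p s (Poly_Mapping.single b 1) =
      Poly_Mapping.single T (M * ((P * P * x1 - x2) * ((R * x1 - y) * (R * x2 - y) - (P + R) * ((R * x1 - y) * (x2 - R * y)) + (x1 - R * y) * (x2 - R * y))))"
      using b p 4 unfolding serre_word_def c
      by (simp add: Xp_word3 T T_def[symmetric] th x1_def[symmetric] x2_def[symmetric] y_def[symmetric] flip: single_add single_diff)
        (simp add: M_def algebra_simps)
    moreover have "serre_word \<epsilon> i p2 s2 p1 s1 j p s (Poly_Mapping.single b 1) =
      Poly_Mapping.single T (M * ((x1 - P * P * x2) * ((R * x1 - y) * (R * x2 - y) - (P + R) * ((R * x2 - y) * (x1 - R * y)) + (x1 - R * y) * (x2 - R * y))))"
      using b p 4 unfolding serre_word_def c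
      by (simp add: Xp_word3 T T_def[symmetric] th x1_def[symmetric] x2_def[symmetric] y_def[symmetric] flip: single_add single_diff)
        (simp add: M_def algebra_simps)
    ultimately show ?thesis
      using serre_identity[OF PR, of x1 x2 y] by (simp flip: single_add distrib_left)
  qed
qed

end

section \<open>The action on the tensor product\<close>

lemma phi_series_prod_nth_0:
  assumes "\<And>p. p \<in> A \<Longrightarrow> g p \<noteq> 0"
  shows "fps_nth (\<Prod>p\<in>A. phi_series t \<epsilon> (u p) (g p)) 0 = exp t powi (sg \<epsilon> * (\<Sum>p\<in>A. u p))"
  using assms
  by (induction A rule: infinite_finite_induct)
    (simp_all add: phi_series_nth_0 power_int_add distrib_left)

lemma q_weight_hvec:
  assumes "\<nu> (Some i) = of_int m"
  shows "q_weight t \<nu> (\<lambda>x. of_int s * hvec i x) = exp t powi (s * m)"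
proof -
  have "pairing \<nu> (\<lambda>x. of_int s * hvec i x) = (\<Sum>x\<in>{Some i}. \<nu> x * (of_int s * hvec i x))"
    unfolding pairing_def by (rule sum.mono_neutral_right) (auto simp: hvec_def)
  also have "\<dots> = of_int (s * m)" using assms by (simp add: hvec_def)
  finally show ?thesis
    by (simp add: q_weight_def exp_power_int of_rat_mult mult.commute)
qed

context column_tensor
begin

definition twt :: "'a list \<Rightarrow> 'b mod_ring weight" where
  "twt b y = (\<Sum>p<k. cw (b ! p) y)"

definition ser :: "sign \<Rightarrow> 'b mod_ring \<Rightarrow> 'a list \<Rightarrow> complex fps" where
  "ser \<epsilon> i b = (\<Prod>p<k. phi_series t \<epsilon> (u i (b ! p)) (spec i p b))"

text \<open>The exponential formula for \<phi> read backwards: the eigenvalue series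
  \<open>ser\<close> is known, and the coefficients of its logarithm serve as the eigenvalues of the
  h_{i,m}.\<close>

definition hlog :: "sign \<Rightarrow> 'b mod_ring \<Rightarrow> 'a list \<Rightarrow> complex fps" where
  "hlog \<epsilon> i b = (SOME A. fps_nth A 0 = 0 \<and>
     ser \<epsilon> i b = fps_const (fps_nth (ser \<epsilon> i b) 0) * (fps_exp (of_int (sg \<epsilon>) * (exp t - inverse (exp t))) oo A))"

definition heig :: "'b mod_ring \<Rightarrow> int \<Rightarrow> 'a list \<Rightarrow> complex" where
  "heig i m b = (if m > 0 then fps_nth (hlog Plus i b) (nat m) else fps_nth (hlog Minus i b) (nat (- m)))"

definition taction :: "('b mod_ring, 'a list) action" where
  "taction g v = (case g of
      X \<epsilon> i s \<Rightarrow> \<Sum>p<k. Xp \<epsilon> i p s v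
    | K h \<Rightarrow> lin (\<lambda>b. Poly_Mapping.single b (q_weight t (twt b) h)) v
    | H i m \<Rightarrow> lin (\<lambda>b. Poly_Mapping.single b (heig i m b)) v)"

lemma taction_simps:
  "taction (X \<epsilon> i s) v = (\<Sum>p<k. Xp \<epsilon> i p s v)"
  "taction (K h) v = lin (\<lambda>b. Poly_Mapping.single b (q_weight t (twt b) h)) v"
  "taction (H i m) v = lin (\<lambda>b. Poly_Mapping.single b (heig i m b)) v"
  by (simp_all add: taction_def)

lemma q_minus_nonzero: "exp t - inverse (exp t) \<noteq> 0"
  using exp_powi_eq_iff[of 1 "-1"] by (simp add: power_int_minus)

lemma ser_nth_0: "fps_nth (ser \<epsilon> i b) 0 = exp t powi (sg \<epsilon> * (\<Sum>p<k. u i (b ! p)))"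
  unfolding ser_def by (rule phi_series_prod_nth_0) (simp add: spec_nonzero)

lemma hlog: "fps_nth (hlog \<epsilon> i b) 0 = 0"
  "ser \<epsilon> i b = fps_const (fps_nth (ser \<epsilon> i b) 0) * (fps_exp (of_int (sg \<epsilon>) * (exp t - inverse (exp t))) oo hlog \<epsilon> i b)"
proof -
  have "fps_nth (ser \<epsilon> i b) 0 \<noteq> 0" by (simp add: ser_nth_0)
  moreover have "of_int (sg \<epsilon>) * (exp t - inverse (exp t)) \<noteq> 0" using q_minus_nonzero by simp
  ultimately have ex: "\<exists>A. fps_nth A 0 = 0 \<and>
     ser \<epsilon> i b = fps_const (fps_nth (ser \<epsilon> i b) 0) * (fps_exp (of_int (sg \<epsilon>) * (exp t - inverse (exp t))) oo A)"
    by (rule fps_log_exists)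
  show "fps_nth (hlog \<epsilon> i b) 0 = 0"
    unfolding hlog_def by (rule conjunct1[OF someI_ex[OF ex]])
  show "ser \<epsilon> i b = fps_const (fps_nth (ser \<epsilon> i b) 0) * (fps_exp (of_int (sg \<epsilon>) * (exp t - inverse (exp t))) oo hlog \<epsilon> i b)"
    unfolding hlog_def by (rule conjunct2[OF someI_ex[OF ex]])
qed

lemma hlog_heig: "hlog \<epsilon> i b = Abs_fps (\<lambda>m. if m = 0 then 0 else heig i (sg \<epsilon> * int m) b)"
  by (rule fps_ext, cases \<epsilon>) (auto simp: heig_def hlog(1))

lemma twt_Some: "b \<in> tbasis \<Longrightarrow> twt b (Some i) = of_int (\<Sum>p<k. u i (b ! p))"
  by (simp add: twt_def cw_Some tbasisD)

lemma phi_taction_raw: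
  "phi_op t taction \<epsilon> i p v = lin (\<lambda>b. Poly_Mapping.single b (series_coeff \<epsilon>
      (fps_const (q_weight t (twt b) (\<lambda>x. of_int (sg \<epsilon>) * hvec i x)) *
       (fps_exp (of_int (sg \<epsilon>) * (exp t - inverse (exp t))) oo hlog \<epsilon> i b)) p)) v"
  unfolding hlog_heig by (rule phi_op_diag) (simp_all add: taction_simps)

text \<open>The constant term of \<open>ser\<close> is q^(+-u) with u the total weight at i, which
  is also the eigenvalue of k_i^(+-1); so the weights and the \<phi> eigenvalues are
  compatible.\<close>

lemma ser_eq:
  assumes "b \<in> tbasis"
  shows "fps_const (q_weight t (twt b) (\<lambda>x. of_int (sg \<epsilon>) * hvec i x)) *
       (fps_exp (of_int (sg \<epsilon>) * (exp t - inverse (exp t))) oo hlog \<epsilon> i b) = ser \<epsilon> i b"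
proof -
  have *: "q_weight t (twt b) (\<lambda>x. of_int (sg \<epsilon>) * hvec i x) = fps_nth (ser \<epsilon> i b) 0"
    unfolding ser_nth_0 by (rule q_weight_hvec) (rule twt_Some[OF assms])
  show ?thesis unfolding * by (rule hlog(2)[symmetric])
qed

lemma phi_taction:
  assumes "v \<in> tspace"
  shows "phi_op t taction \<epsilon> i p v = lin (\<lambda>b. Poly_Mapping.single b (series_coeff \<epsilon> (ser \<epsilon> i b) p)) v"
  unfolding phi_taction_raw using ser_eq by (intro lin_cong_tspace[OF assms]) simp

lemma tspace_subspace: "csubspace tspace"
  unfolding tspace_def by (rule csubspace_keys)

lemma single_tspace [simp]: "Poly_Mapping.single b c \<in> tspace \<longleftrightarrow> c = 0 \<or> b \<in> tbasis"
  by (simp add: tspace_def)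

lemma lin_tspace:
  assumes "v \<in> tspace" "\<And>b. b \<in> tbasis \<Longrightarrow> f b \<in> tspace"
  shows "lin f v \<in> tspace"
  using assms by (intro lin_in_subspace tspace_subspace) (auto simp: tspace_def)

lemma Xp_tspace: "v \<in> tspace \<Longrightarrow> p < k \<Longrightarrow> Xp \<epsilon> i p s v \<in> tspace"
  unfolding Xp_def by (rule lin_tspace) (auto simp: cf_def mvp_tbasis)

lemma taction_tspace: "v \<in> tspace \<Longrightarrow> taction g v \<in> tspace"
  by (cases g) (auto simp: taction_simps intro!: lin_tspace cv.subspace_sum[OF tspace_subspace] Xp_tspace)

lemma Xp_add: "Xp \<epsilon> i p s (v + w) = Xp \<epsilon> i p s v + Xp \<epsilon> i p s w"
  and Xp_scale: "Xp \<epsilon> i p s (c *\<^sub>C v) = c *\<^sub>C Xp \<epsilon> i p s v"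
  and Xp_sum: "Xp \<epsilon> i p s (\<Sum>x\<in>A. f x) = (\<Sum>x\<in>A. Xp \<epsilon> i p s (f x))"
  by (simp_all add: Xp_def lin_add lin_scale lin_sum)

lemma taction_add: "taction g (v + w) = taction g v + taction g w"
  and taction_scale: "taction g (c *\<^sub>C v) = c *\<^sub>C taction g v"
  by (cases g; simp add: taction_simps lin_add lin_scale Xp_add Xp_scale sum.distrib cv.scale_sum_right)+

lemma taction_linear_on: "linear_on tspace (taction g)"
  by (simp add: linear_on_def taction_tspace taction_add taction_scale)

section \<open>Verification of the defining relations\<close>

lemma ser_mvp:
  assumes b: "b \<in> tbasis" and p: "p < k" and act: "active \<epsilon> j p b"
  shows "(hom_1 \<epsilon>' - fps_const (exp t powi (sg \<epsilon> * cartan_matrix i j) * spec j p b) * hom_z \<epsilon>') * ser \<epsilon>' i (mvp \<epsilon> j p b)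
    = (fps_const (exp t powi (sg \<epsilon> * cartan_matrix i j)) * hom_1 \<epsilon>' - fps_const (spec j p b) * hom_z \<epsilon>') * ser \<epsilon>' i b"
proof -
  let ?f = "\<lambda>b p. phi_series t \<epsilon>' (u i (b ! p)) (spec i p b)"
  let ?b = "mvp \<epsilon> j p b"
  have "move_step t (sg \<epsilon>) (cartan_matrix j i) (spec j p b) (u i (b ! p)) (spec i p b) (u i (?b ! p)) (spec i p ?b)"
    using mv_step[of "b ! p" j \<epsilon> t i "a p"] b p act by (simp add: spec_def mvp_nth tbasisD active_def)
  from move_step_series[OF this, of \<epsilon>']
  have 1: "(hom_1 \<epsilon>' - fps_const (exp t powi (sg \<epsilon> * cartan_matrix i j) * spec j p b) * hom_z \<epsilon>') * ?f ?b p
    = (fps_const (exp t powi (sg \<epsilon> * cartan_matrix i j)) * hom_1 \<epsilon>' - fps_const (spec j p b) * hom_z \<epsilon>') * ?f b p"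
    using spec_nonzero p cartan_matrix_sym[of i j] by simp
  have 2: "(\<Prod>p'\<in>{..<k} - {p}. ?f ?b p') = (\<Prod>p'\<in>{..<k} - {p}. ?f b p')"
    using b p by (intro prod.cong refl) (simp add: mvp_nth spec_mvp)
  have "ser \<epsilon>' i ?b = ?f ?b p * (\<Prod>p'\<in>{..<k} - {p}. ?f ?b p')" "ser \<epsilon>' i b = ?f b p * (\<Prod>p'\<in>{..<k} - {p}. ?f b p')"
    unfolding ser_def using p by (simp_all only: prod.remove finite_lessThan lessThan_iff)
  then show ?thesis unfolding 2 using 1 by (simp only: mult.assoc[symmetric])
qed

lemma phi_Xp:
  assumes b: "b \<in> tbasis" and p: "p < k"
  shows "series_coeff \<epsilon>' (ser \<epsilon>' i (mvp \<epsilon> j p b)) m * (cf \<epsilon> j p b * spec j p b powi (s - 1))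
     - exp t powi (sg \<epsilon> * cartan_matrix i j) * (series_coeff \<epsilon>' (ser \<epsilon>' i (mvp \<epsilon> j p b)) (m - 1) * (cf \<epsilon> j p b * spec j p b powi s))
   = exp t powi (sg \<epsilon> * cartan_matrix i j) * (cf \<epsilon> j p b * spec j p b powi (s - 1) * series_coeff \<epsilon>' (ser \<epsilon>' i b) m)
     - cf \<epsilon> j p b * spec j p b powi s * series_coeff \<epsilon>' (ser \<epsilon>' i b) (m - 1)"
proof (cases "active \<epsilon> j p b")
  case True
  from series_coeff_shift[OF ser_mvp[OF b p True, of \<epsilon>' i], of m]
  have "series_coeff \<epsilon>' (ser \<epsilon>' i (mvp \<epsilon> j p b)) m
      = exp t powi (sg \<epsilon> * cartan_matrix i j) * spec j p b * series_coeff \<epsilon>' (ser \<epsilon>' i (mvp \<epsilon> j p b)) (m - 1)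
      + exp t powi (sg \<epsilon> * cartan_matrix i j) * series_coeff \<epsilon>' (ser \<epsilon>' i b) m - spec j p b * series_coeff \<epsilon>' (ser \<epsilon>' i b) (m - 1)"
    by (simp add: algebra_simps)
  from arg_cong[OF this, of "\<lambda>z. cf \<epsilon> j p b * spec j p b powi (s - 1) * z"] show ?thesis
    unfolding powi_pred[OF spec_nonzero[OF p], of j b s] by (simp add: algebra_simps)
qed (simp add: cf_inactive)

lemma relation_phi_x:
  assumes "v \<in> tspace"
  defines "Q \<equiv> \<lambda>\<epsilon> i j. exp t powi (sg \<epsilon> * cartan_matrix i j)"
  shows "phi_op t taction \<epsilon>' i m (taction (X \<epsilon> j (s - 1)) v) - Q \<epsilon> i j *\<^sub>C phi_op t taction \<epsilon>' i (m - 1) (taction (X \<epsilon> j s) v)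
    = Q \<epsilon> i j *\<^sub>C taction (X \<epsilon> j (s - 1)) (phi_op t taction \<epsilon>' i m v) - taction (X \<epsilon> j s) (phi_op t taction \<epsilon>' i (m - 1) v)"
proof -
  let ?D = "\<lambda>m. lin (\<lambda>b. Poly_Mapping.single b (series_coeff \<epsilon>' (ser \<epsilon>' i b) m))"
  have *: "?D m (Xp \<epsilon> j p (s - 1) v) - Q \<epsilon> i j *\<^sub>C ?D (m - 1) (Xp \<epsilon> j p s v)
    = Q \<epsilon> i j *\<^sub>C Xp \<epsilon> j p (s - 1) (?D m v) - Xp \<epsilon> j p s (?D (m - 1) v)" if "p < k" for p
    unfolding Xp_def lin_lin lin_scale_fun lin_minus_fun
    by (rule lin_cong_tspace[OF assms(1)])
      (use phi_Xp[OF _ that, of _ \<epsilon>' i \<epsilon> j m s] in \<open>simp add: Q_def mult_ac flip: single_diff\<close>)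
  have "phi_op t taction \<epsilon>' i m' (taction (X \<epsilon> j s') v) = (\<Sum>p<k. ?D m' (Xp \<epsilon> j p s' v))"
    "taction (X \<epsilon> j s') (phi_op t taction \<epsilon>' i m' v) = (\<Sum>p<k. Xp \<epsilon> j p s' (?D m' v))" for m' s'
    using assms(1) taction_tspace[of v "X \<epsilon> j s'"] by (simp_all add: phi_taction taction_simps(1) lin_sum)
  then show ?thesis using * by (simp add: cv.scale_sum_right flip: sum_subtractf)
qed

text \<open>A move and its inverse collect \<phi> factors from both sides of p. The sets
  \<open>before Plus p\<close> and \<open>before Minus p\<close> are complementary, so the result is
  symmetric in the other factors. At most one of the two words survives, and its sign is the weight
  u.\<close>

lemma Xp_mixed_diag:
  assumes b: "b \<in> tbasis" and p: "p < k"
  shows "Xp Plus i p s (Xp Minus i p s' (Poly_Mapping.single b 1)) - Xp Minus i p s' (Xp Plus i p s (Poly_Mapping.single b 1))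
    = Poly_Mapping.single b (of_int (u i (b ! p)) * (\<Prod>p'\<in>{..<k} - {p}. phi_value t (u i (b ! p')) (spec i p' b / spec i p b))
        * spec i p b powi (s + s'))"
proof -
  have col: "b ! p \<in> Col" using b p tbasisD by simp
  let ?f = "\<lambda>p'. phi_value t (u i (b ! p')) (spec i p' b / spec i p b)"
  have split: "(\<Prod>p'\<in>{..<k} - {p}. ?f p') = (\<Prod>p'\<in>before Plus p. ?f p') * (\<Prod>p'\<in>before Minus p. ?f p')"
  proof -
    have "{..<k} - {p} = before Plus p \<union> before Minus p" "before Plus p \<inter> before Minus p = {}"
      using p by (auto simp: before_def)
    then show ?thesis by (simp add: prod.union_disjoint)
  qed
  have *: "Xp (opp \<epsilon>) i p s1 (Xp \<epsilon> i p s2 (Poly_Mapping.single b 1))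
      = Poly_Mapping.single b ((\<Prod>p'\<in>{..<k} - {p}. ?f p') * spec i p b powi (s1 + s2))"
    if "active \<epsilon> i p b" for \<epsilon> s1 s2
  proof -
    let ?b = "mvp \<epsilon> i p b"
    have b': "?b \<in> tbasis" using mvp_tbasis b p that by simp
    have sp: "spec i p ?b = spec i p b" using that b p e_mv[OF col, of i \<epsilon>] by (simp add: spec_def mvp_nth active_def)
    have act: "active (opp \<epsilon>) i p ?b" using that b p u_mv[OF col, of i \<epsilon>] by (simp add: active_def mvp_nth)
    have bk: "mvp (opp \<epsilon>) i p ?b = b"
      using that b p mv_mv[OF col, of i \<epsilon>] by (simp add: mvp_def active_def tbasisD)
    have ne: "p' \<noteq> p" if "p' \<in> before \<epsilon>1 p" for p' \<epsilon>1 using that before_subset p by auto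
    have "cf (opp \<epsilon>) i p ?b = (\<Prod>p'\<in>before (opp \<epsilon>) p. ?f p')"
      unfolding cf_def using act ne b p sp by (simp add: mvp_nth spec_mvp cong: prod.cong_simp)
    moreover have "cf \<epsilon> i p b = (\<Prod>p'\<in>before \<epsilon> p. ?f p')" using that by (simp add: cf_def)
    ultimately have "cf (opp \<epsilon>) i p ?b * cf \<epsilon> i p b = (\<Prod>p'\<in>{..<k} - {p}. ?f p')"
      unfolding split by (cases \<epsilon>) (simp_all add: mult.commute)
    then show ?thesis using spec_nonzero[OF p] by (simp add: Xp_single bk sp power_int_add mult_ac)
  qed
  consider "u i (b ! p) = 1" | "u i (b ! p) = -1" | "u i (b ! p) = 0" using u_range[OF col] by auto
  then show ?thesis
  proof cases
    case 1
    then have "active Minus i p b" "\<not> active Plus i p b" by (auto simp: active_def)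
    then show ?thesis using *[of Minus s s'] 1 by (simp add: Xp_inactive)
  next
    case 2
    then have "active Plus i p b" "\<not> active Minus i p b" by (auto simp: active_def)
    then show ?thesis using *[of Plus s' s] 2 by (simp add: Xp_inactive add.commute flip: single_uminus)
  next
    case 3
    then have "\<not> active Plus i p b" "\<not> active Minus i p b" by (auto simp: active_def)
    then show ?thesis using 3 by (simp add: Xp_inactive)
  qed
qed

lemma u_q_difference:
  assumes "c \<in> Col"
  shows "exp t powi u i c - exp t powi (- u i c) = of_int (u i c) * (exp t - inverse (exp t))"
  using u_range[OF assms, of i] by (auto simp: power_int_minus)

text \<open>Terms with different positions or different nodes cancel. The diagonal terms are the
  coefficients at the poles in \<open>phi_series_prod_diff\<close>: the poles are distinct by
  genericity, and q^u - q^(-u) = u (q - q^(-1)) for u in {-1, 0, 1}.\<close>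

lemma relation_commutator:
  assumes v: "v \<in> tspace"
  shows "taction (X Plus i p) (taction (X Minus j s) v) - taction (X Minus j s) (taction (X Plus i p) v)
    = (if i = j then (1 / (exp t - inverse (exp t))) *\<^sub>C (phi_op t taction Plus i (p + s) v - phi_op t taction Minus i (p + s) v) else 0)"
proof -
  let ?c = "\<lambda>P P' v. Xp Plus i P p (Xp Minus j P' s v) - Xp Minus j P' s (Xp Plus i P p v)"
  have lin: "?c P P' v = lin (\<lambda>b. ?c P P' (Poly_Mapping.single b 1)) v" for P P'
    unfolding Xp_Xp_eq_lin[of _ _ _ _ _ _ _ _ v] lin_minus_fun ..
  have zero: "?c P P' v = 0" if "P < k" "P' < k" "P \<noteq> P' \<or> i \<noteq> j" for P P'
  proof -
    have "?c P P' (Poly_Mapping.single b 1) = 0" if b: "b \<in> tbasis" for b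
      using Xp_mixed_neq[OF b, of P P' i p j s 1] Xp_mixed_self[OF b, of P i j p s 1] \<open>P < k\<close> \<open>P' < k\<close> \<open>P \<noteq> P' \<or> i \<noteq> j\<close>
      by (cases "P = P'") auto
    then have "lin (\<lambda>b. ?c P P' (Poly_Mapping.single b 1)) v = lin (\<lambda>b. 0) v" by (rule lin_cong_tspace[OF v])
    then show ?thesis using lin by simp
  qed
  have "taction (X Plus i p) (taction (X Minus j s) v) - taction (X Minus j s) (taction (X Plus i p) v)
    = (\<Sum>P<k. \<Sum>P'<k. ?c P P' v)"
    unfolding taction_simps Xp_sum sum_subtractf
    by (subst (2) sum.swap) simp
  also have "\<dots> = (\<Sum>P<k. if i = j then ?c P P v else 0)"
  proof (intro sum.cong refl)
    fix P assume "P \<in> {..<k}"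
    then have P: "P < k" by simp
    have "(\<Sum>P'<k. ?c P P' v) = (\<Sum>P'<k. if P' = P then (if i = j then ?c P P v else 0) else 0)"
      by (intro sum.cong refl) (use zero[OF P] in auto)
    then show "(\<Sum>P'<k. ?c P P' v) = (if i = j then ?c P P v else 0)" using P by simp
  qed
  also have "\<dots> = (if i = j then (1 / (exp t - inverse (exp t))) *\<^sub>C (phi_op t taction Plus i (p + s) v - phi_op t taction Minus i (p + s) v) else 0)"
  proof (cases "i = j")
    case True
    have "(\<Sum>P<k. ?c P P v) = lin (\<lambda>b. \<Sum>P<k. ?c P P (Poly_Mapping.single b 1)) v"
      unfolding lin lin_sum_fun ..
    also have "\<dots> = (1 / (exp t - inverse (exp t))) *\<^sub>C (phi_op t taction Plus i (p + s) v - phi_op t taction Minus i (p + s) v)"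
      unfolding phi_taction[OF v] lin_minus_fun lin_scale_fun
    proof (rule lin_cong_tspace[OF v])
      fix b assume b: "b \<in> tbasis"
      let ?F = "\<lambda>P. (\<Prod>p'\<in>{..<k} - {P}. phi_value t (u i (b ! p')) (spec i p' b / spec i P b)) * spec i P b powi (p + s)"
      have "(\<Sum>P<k. ?c P P (Poly_Mapping.single b 1)) = Poly_Mapping.single b (\<Sum>P<k. of_int (u i (b ! P)) * ?F P)"
        using Xp_mixed_diag[OF b] True by (simp add: mult.assoc poly_mapping_eq_iff lookup_sum fun_eq_iff lookup_single when_def)
      moreover have "series_coeff Plus (ser Plus i b) (p + s) - series_coeff Minus (ser Minus i b) (p + s)
         = (\<Sum>P<k. (exp t - inverse (exp t)) * (of_int (u i (b ! P)) * ?F P))"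
        unfolding ser_def using b spec_neq[OF b b]
        by (subst phi_series_prod_diff) (auto simp: spec_nonzero u_q_difference tbasisD mult_ac intro!: sum.cong)
      ultimately show "(\<Sum>P<k. ?c P P (Poly_Mapping.single b 1)) =
         (1 / (exp t - inverse (exp t))) *\<^sub>C (Poly_Mapping.single b (series_coeff Plus (ser Plus i b) (p + s)) -
           Poly_Mapping.single b (series_coeff Minus (ser Minus i b) (p + s)))"
        using q_minus_nonzero by (simp flip: single_diff sum_distrib_left)
    qed
    finally show ?thesis using True by simp
  qed simp
  finally show ?thesis .
qed

lemma relation_x_x:
  assumes v: "v \<in> tspace"
  defines "Q \<equiv> \<lambda>\<epsilon> i j. exp t powi (sg \<epsilon> * cartan_matrix i j)"
  shows "taction (X \<epsilon> i p) (taction (X \<epsilon> j (s - 1)) v) - Q \<epsilon> i j *\<^sub>C taction (X \<epsilon> i (p - 1)) (taction (X \<epsilon> j s) v)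
    = Q \<epsilon> i j *\<^sub>C taction (X \<epsilon> j (s - 1)) (taction (X \<epsilon> i p) v) - taction (X \<epsilon> j s) (taction (X \<epsilon> i (p - 1)) v)"
proof -
  have "taction (X \<epsilon> i p) (taction (X \<epsilon> j (s - 1)) v) - Q \<epsilon> i j *\<^sub>C taction (X \<epsilon> i (p - 1)) (taction (X \<epsilon> j s) v)
    = (\<Sum>P<k. \<Sum>P'<k. Xp \<epsilon> i P p (Xp \<epsilon> j P' (s - 1) v) - Q \<epsilon> i j *\<^sub>C Xp \<epsilon> i P (p - 1) (Xp \<epsilon> j P' s v))"
    by (simp add: taction_simps Xp_sum sum_subtractf cv.scale_sum_right)
  also have "\<dots> = (\<Sum>P<k. \<Sum>P'<k. Q \<epsilon> i j *\<^sub>C Xp \<epsilon> j P' (s - 1) (Xp \<epsilon> i P p v) - Xp \<epsilon> j P' s (Xp \<epsilon> i P (p - 1) v))"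
    unfolding Q_def using Xp_same_sign[OF v] by (intro sum.cong refl) auto
  also have "\<dots> = (\<Sum>P'<k. \<Sum>P<k. Q \<epsilon> i j *\<^sub>C Xp \<epsilon> j P' (s - 1) (Xp \<epsilon> i P p v) - Xp \<epsilon> j P' s (Xp \<epsilon> i P (p - 1) v))"
    by (rule sum.swap)
  also have "\<dots> = Q \<epsilon> i j *\<^sub>C taction (X \<epsilon> j (s - 1)) (taction (X \<epsilon> i p) v) - taction (X \<epsilon> j s) (taction (X \<epsilon> i (p - 1)) v)"
    by (simp add: taction_simps Xp_sum sum_subtractf cv.scale_sum_right)
  finally show ?thesis .
qed

lemma relation_far:
  assumes v: "v \<in> tspace" and C: "cartan_matrix i j = 0"
  shows "taction (X \<epsilon> i p) (taction (X \<epsilon> j s) v) = taction (X \<epsilon> j s) (taction (X \<epsilon> i p) v)"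
proof -
  have "(\<Sum>P<k. \<Sum>P'<k. Xp \<epsilon> i P p (Xp \<epsilon> j P' s v)) = (\<Sum>P<k. \<Sum>P'<k. Xp \<epsilon> j P' s (Xp \<epsilon> i P p v))"
    using Xp_far[OF v _ _ C refl] by (intro sum.cong refl) auto
  also have "\<dots> = (\<Sum>P'<k. \<Sum>P<k. Xp \<epsilon> j P' s (Xp \<epsilon> i P p v))"
    by (rule sum.swap)
  finally show ?thesis by (simp add: taction_simps Xp_sum)
qed

lemma relation_serre:
  assumes v: "v \<in> tspace" and C: "cartan_matrix i j = -1"
  defines "x \<equiv> \<lambda>\<epsilon> i s. taction (X \<epsilon> i s)" and "q2 \<equiv> exp t + inverse (exp t)"
  shows "(x \<epsilon> i p (x \<epsilon> i p' (x \<epsilon> j s v)) - q2 *\<^sub>C x \<epsilon> i p (x \<epsilon> j s (x \<epsilon> i p' v)) + x \<epsilon> j s (x \<epsilon> i p (x \<epsilon> i p' v)))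
    + (x \<epsilon> i p' (x \<epsilon> i p (x \<epsilon> j s v)) - q2 *\<^sub>C x \<epsilon> i p' (x \<epsilon> j s (x \<epsilon> i p v)) + x \<epsilon> j s (x \<epsilon> i p' (x \<epsilon> i p v))) = 0"
proof -
  have word: "serre_word \<epsilon> i p1 s1 p2 s2 j p3 s3 v
    = lin (\<lambda>b. serre_word \<epsilon> i p1 s1 p2 s2 j p3 s3 (Poly_Mapping.single b 1)) v" for p1 p2 p3 s1 s2 s3
    unfolding serre_word_def Xp_Xp_Xp_eq_lin[of _ _ _ _ _ _ _ _ _ _ _ _ v] lin_scale_fun lin_minus_fun lin_plus_fun ..
  have zero: "serre_word \<epsilon> i p1 s1 p2 s2 j p3 s3 v + serre_word \<epsilon> i p2 s2 p1 s1 j p3 s3 v = 0"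
    if "p1 < k" "p2 < k" "p3 < k" for p1 p2 p3 s1 s2 s3
  proof -
    have "lin (\<lambda>b. serre_word \<epsilon> i p1 s1 p2 s2 j p3 s3 (Poly_Mapping.single b 1)
        + serre_word \<epsilon> i p2 s2 p1 s1 j p3 s3 (Poly_Mapping.single b 1)) v = lin (\<lambda>b. 0) v"
      using serre_single[OF _ that C] by (intro lin_cong_tspace[OF v])
    then show ?thesis unfolding word[of p1] word[of p2] lin_plus_fun by simp
  qed
  have sum: "x \<epsilon> i p (x \<epsilon> i p' (x \<epsilon> j s v)) - q2 *\<^sub>C x \<epsilon> i p (x \<epsilon> j s (x \<epsilon> i p' v)) + x \<epsilon> j s (x \<epsilon> i p (x \<epsilon> i p' v))
    = (\<Sum>p3<k. \<Sum>p1<k. \<Sum>p2<k. serre_word \<epsilon> i p1 p p2 p' j p3 s v)" for p p'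
  proof -
    have "x \<epsilon> i p (x \<epsilon> i p' (x \<epsilon> j s v)) = (\<Sum>p3<k. \<Sum>p1<k. \<Sum>p2<k. Xp \<epsilon> i p1 p (Xp \<epsilon> i p2 p' (Xp \<epsilon> j p3 s v)))"
      unfolding x_def taction_simps Xp_sum
      by (subst sum.swap[of _ "{..<k}" "{..<k}"], rule sum.cong, rule refl, rule sum.swap)
    moreover have "x \<epsilon> i p (x \<epsilon> j s (x \<epsilon> i p' v)) = (\<Sum>p3<k. \<Sum>p1<k. \<Sum>p2<k. Xp \<epsilon> i p1 p (Xp \<epsilon> j p3 s (Xp \<epsilon> i p2 p' v)))"
      unfolding x_def taction_simps Xp_sum by (rule sum.swap)
    moreover have "x \<epsilon> j s (x \<epsilon> i p (x \<epsilon> i p' v)) = (\<Sum>p3<k. \<Sum>p1<k. \<Sum>p2<k. Xp \<epsilon> j p3 s (Xp \<epsilon> i p1 p (Xp \<epsilon> i p2 p' v)))"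
      unfolding x_def taction_simps Xp_sum ..
    ultimately show ?thesis
      by (simp add: serre_word_def sum.distrib sum_subtractf cv.scale_sum_right q2_def)
  qed
  \<comment> \<open>A word cancels against the one in which both the positions p1, p2 and the modes
    p, p' are exchanged; hence the positions are renamed in the second sum.\<close>
  have "(\<Sum>p3<k. \<Sum>p1<k. \<Sum>p2<k. serre_word \<epsilon> i p1 p p2 p' j p3 s v)
     + (\<Sum>p3<k. \<Sum>p1<k. \<Sum>p2<k. serre_word \<epsilon> i p1 p' p2 p j p3 s v)
    = (\<Sum>p3<k. \<Sum>p1<k. \<Sum>p2<k. serre_word \<epsilon> i p1 p p2 p' j p3 s v + serre_word \<epsilon> i p2 p' p1 p j p3 s v)"
    unfolding sum.distrib
    by (rule arg_cong2[of _ _ _ _ "(+)"], rule refl, rule sum.cong, rule refl, rule sum.swap)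
  also have "\<dots> = 0" using zero by simp
  finally show ?thesis unfolding sum .
qed

lemma taction_K_K: "taction (K h) (taction (K h') v) = taction (K (\<lambda>y. h y + h' y)) v"
  unfolding taction_simps lin_diag_diag
  by (simp add: q_weight_def pairing_def distrib_left sum.distrib of_rat_add exp_add)

lemma taction_K_0: "taction (K (\<lambda>_. 0)) v = v"
  by (simp add: taction_simps q_weight_def pairing_def)

lemma lin_diag_tspace: "v \<in> tspace \<Longrightarrow> lin (\<lambda>b. Poly_Mapping.single b (w b)) v \<in> tspace"
  by (rule lin_tspace) auto

lemma relation_phi_phi:
  assumes "v \<in> tspace"
  shows "phi_op t taction \<epsilon> i p (phi_op t taction \<epsilon>' j s v) = phi_op t taction \<epsilon>' j s (phi_op t taction \<epsilon> i p v)"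
  using assms by (simp add: phi_taction lin_diag_tspace lin_diag_diag mult.commute)

theorem taction_toroidal_module: "toroidal_module t tspace taction"
  unfolding toroidal_module_def toroidal_relations_def Let_def
proof (intro conjI ballI allI impI)
  show "csubspace tspace" by (rule tspace_subspace)
  show "linear_on tspace (taction g)" for g by (rule taction_linear_on)
  fix v assume v: "v \<in> tspace"
  show "taction (K h) (taction (K h') v) = taction (K (\<lambda>y. h y + h' y)) v" for h h' by (rule taction_K_K)
  show "taction (K (\<lambda>_. 0)) v = v" by (rule taction_K_0)
  show "phi_op t taction \<epsilon> i p (phi_op t taction \<epsilon>' j s v) = phi_op t taction \<epsilon>' j s (phi_op t taction \<epsilon> i p v)"
    for \<epsilon> \<epsilon>' i j p s by (rule relation_phi_phi[OF v])
  show "phi_op t taction \<epsilon>' i p (taction (X \<epsilon> j (s - 1)) v) - exp t powi (sg \<epsilon> * cartan_matrix i j) *\<^sub>C phi_op t taction \<epsilon>' i (p - 1) (taction (X \<epsilon> j s) v)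
    = exp t powi (sg \<epsilon> * cartan_matrix i j) *\<^sub>C taction (X \<epsilon> j (s - 1)) (phi_op t taction \<epsilon>' i p v) - taction (X \<epsilon> j s) (phi_op t taction \<epsilon>' i (p - 1) v)"
    for \<epsilon>' \<epsilon> i j p s by (rule relation_phi_x[OF v])
  show "taction (X Plus i p) (taction (X Minus j s) v) - taction (X Minus j s) (taction (X Plus i p) v)
    = (if i = j then (1 / (exp t - inverse (exp t))) *\<^sub>C (phi_op t taction Plus i (p + s) v - phi_op t taction Minus i (p + s) v) else 0)"
    for i j p s by (rule relation_commutator[OF v])
  show "taction (X \<epsilon> i p) (taction (X \<epsilon> j (s - 1)) v) - exp t powi (sg \<epsilon> * cartan_matrix i j) *\<^sub>C taction (X \<epsilon> i (p - 1)) (taction (X \<epsilon> j s) v)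
    = exp t powi (sg \<epsilon> * cartan_matrix i j) *\<^sub>C taction (X \<epsilon> j (s - 1)) (taction (X \<epsilon> i p) v) - taction (X \<epsilon> j s) (taction (X \<epsilon> i (p - 1)) v)"
    for \<epsilon> i j p s by (rule relation_x_x[OF v])
next
  fix v \<epsilon> i j p p' s
  assume v: "v \<in> tspace" and j: "j = i + 1 \<or> j = (i :: 'b mod_ring) - 1"
  have "cartan_matrix i j = -1" using j adjacent_neq[of i] mod_ring_shift[of i j] by (auto simp: cartan_matrix_def)
  then show "taction (X \<epsilon> i p) (taction (X \<epsilon> i p') (taction (X \<epsilon> j s) v)) - (exp t + inverse (exp t)) *\<^sub>C taction (X \<epsilon> i p) (taction (X \<epsilon> j s) (taction (X \<epsilon> i p') v))
       + taction (X \<epsilon> j s) (taction (X \<epsilon> i p) (taction (X \<epsilon> i p') v))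
     + (taction (X \<epsilon> i p') (taction (X \<epsilon> i p) (taction (X \<epsilon> j s) v)) - (exp t + inverse (exp t)) *\<^sub>C taction (X \<epsilon> i p') (taction (X \<epsilon> j s) (taction (X \<epsilon> i p) v))
       + taction (X \<epsilon> j s) (taction (X \<epsilon> i p') (taction (X \<epsilon> i p) v))) = 0"
    by (rule relation_serre[OF v])
next
  fix v \<epsilon> i j p s
  assume v: "v \<in> tspace" and "i \<noteq> j \<and> i \<noteq> j + 1 \<and> (i :: 'b mod_ring) \<noteq> j - 1"
  then have "cartan_matrix i j = 0" by (simp add: cartan_matrix_def)
  then show "taction (X \<epsilon> i p) (taction (X \<epsilon> j s) v) = taction (X \<epsilon> j s) (taction (X \<epsilon> i p) v)"
    by (rule relation_far[OF v])
qed

section \<open>Separation of basis vectors and irreducibility\<close>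

text \<open>Cross-multiplied, the equality of eigenvalues is one of polynomials and can be evaluated
  at the poles as well.\<close>

lemma ser_eq_imp_values:
  assumes "ser Plus i b = ser Plus i b'"
  shows "(\<Prod>p<k. exp t powi u i (b ! p) - exp t powi (- u i (b ! p)) * (spec i p b * x)) * (\<Prod>p<k. 1 - spec i p b' * x)
    = (\<Prod>p<k. exp t powi u i (b' ! p) - exp t powi (- u i (b' ! p)) * (spec i p b' * x)) * (\<Prod>p<k. 1 - spec i p b * x)"
proof -
  let ?N = "\<lambda>b. \<Prod>p<k. [:exp t powi u i (b ! p), - (exp t powi (- u i (b ! p)) * spec i p b):]"
  let ?D = "\<lambda>b. \<Prod>p<k. [:1, - spec i p b:]"
  have *: "ser Plus i b * fps_of_poly (?D b) = fps_of_poly (?N b)" for b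
    unfolding ser_def by (rule phi_series_prod_times_poly) (simp add: spec_nonzero)
  have "fps_of_poly (?N b * ?D b') = fps_of_poly (?N b' * ?D b)"
    unfolding fps_of_poly_mult *[symmetric] assms by (simp only: mult_ac)
  then have "?N b * ?D b' = ?N b' * ?D b" by simp
  then have "poly (?N b * ?D b') x = poly (?N b' * ?D b) x" by simp
  then show ?thesis by (simp add: poly_prod mult_ac)
qed

text \<open>The zero of an eigenvalue factor is the pole shifted by an even power of q. The exponent
  is written as twice an integer to match the form of the genericity assumption.\<close>

lemma q_zero_iff: "exp t powi m - exp t powi (- m) * y = 0 \<longleftrightarrow> y * exp t powi (2 * (- m)) = 1"
proof -
  have "exp t powi (2 * (- m)) = exp t powi (- m + - m)" by simp
  also have "\<dots> = inverse (exp t powi m) * inverse (exp t powi m)"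
    by (subst power_int_add) (simp_all add: power_int_minus)
  finally have *: "exp t powi (2 * (- m)) = inverse (exp t powi m) * inverse (exp t powi m)" .
  show ?thesis unfolding * power_int_minus by (auto simp: field_simps)
qed

text \<open>
  The poles and the zeros of the eigenvalue of \<open>\<phi>\<^sub>i\<close> determine the columns: by genericity, the position
  of the column can be read off the coset of the pole.
\<close>

lemma ser_eq_imp_parameters:
  assumes b: "b \<in> tbasis" "b' \<in> tbasis" and p: "p < k" and u0: "u i (b ! p) \<noteq> 0"
    and ser: "ser Plus i b = ser Plus i b'"
  shows "spec i p b' = spec i p b \<and> u i (b' ! p) = u i (b ! p)"
proof -
  have sp: "spec i p b \<noteq> 0" using p by (rule spec_nonzero)
  have generic: "spec i p' b1 * exp t powi (2 * d) \<noteq> spec i p b"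
    if "p' < k" "p' \<noteq> p" "b1 \<in> tbasis" for p' b1 d
    using e_same[of "b1 ! p'" "b ! p" i] that b p tbasisD
    by (intro spec_generic) auto
  have pole: "spec i p b' = spec i p b"
  proof -
    \<comment> \<open>The pole contributed by position p. It annihilates the denominator of b, so
      one of the other linear factors has to vanish there.\<close>
    let ?x = "1 / spec i p b"
    have "(\<Prod>p<k. 1 - spec i p b * ?x) = 0" using p sp by (intro prod_zero) auto
    then have "(\<Prod>p<k. exp t powi u i (b ! p) - exp t powi (- u i (b ! p)) * (spec i p b * ?x)) * (\<Prod>p<k. 1 - spec i p b' * ?x) = 0"
      using ser_eq_imp_values[OF ser, of ?x] by (simp only: mult_zero_right)
    then obtain p' where p': "p' < k" and
      "exp t powi u i (b ! p') - exp t powi (- u i (b ! p')) * (spec i p' b * ?x) = 0 \<or> 1 - spec i p' b' * ?x = 0"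
      by (auto simp only: mult_eq_0_iff prod_zero_iff finite_lessThan lessThan_iff)
    then consider "spec i p' b * exp t powi (2 * (- u i (b ! p'))) = spec i p b" | "spec i p' b' = spec i p b"
      unfolding q_zero_iff using sp by (auto simp: field_simps)
    then show ?thesis
    proof cases
      case 1
      then have "p' = p" using generic[OF p' _ b(1)] by blast
      then have "exp t powi (2 * (- u i (b ! p))) = 1" using 1 sp by simp
      then show ?thesis using u0 exp_powi_eq_1_iff by fastforce
    next
      case 2
      then show ?thesis using generic[OF p' _ b(2), of 0] by auto
    qed
  qed
  moreover have "u i (b' ! p) = u i (b ! p)"
  proof -
    \<comment> \<open>The zero contributed by position p: it lies at q^(2u) times the pole and
      thereby determines u once the poles are matched.\<close>
    let ?x = "exp t powi (2 * u i (b ! p)) / spec i p b"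
    have "exp t powi u i (b ! p) - exp t powi (- u i (b ! p)) * (spec i p b * ?x) = 0"
      unfolding q_zero_iff using sp by (simp flip: power_int_add)
    then have "(\<Prod>p<k. exp t powi u i (b ! p) - exp t powi (- u i (b ! p)) * (spec i p b * ?x)) = 0"
      using p by (intro prod_zero bexI[of _ p]) (simp_all only: finite_lessThan lessThan_iff)
    then have "(\<Prod>p<k. exp t powi u i (b' ! p) - exp t powi (- u i (b' ! p)) * (spec i p b' * ?x)) * (\<Prod>p<k. 1 - spec i p b * ?x) = 0"
      using ser_eq_imp_values[OF ser, of ?x] by (simp only: mult_zero_left)
    then obtain p' where p': "p' < k" and
      "exp t powi u i (b' ! p') - exp t powi (- u i (b' ! p')) * (spec i p' b' * ?x) = 0 \<or> 1 - spec i p' b * ?x = 0"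
      by (auto simp only: mult_eq_0_iff prod_zero_iff finite_lessThan lessThan_iff)
    then consider "spec i p' b' * (exp t powi (2 * u i (b ! p)) * exp t powi (2 * (- u i (b' ! p')))) = spec i p b"
      | "spec i p' b * exp t powi (2 * u i (b ! p)) = spec i p b"
      unfolding q_zero_iff using sp by (auto simp: field_simps)
    then show ?thesis
    proof cases
      case 1
      then have *: "spec i p' b' * exp t powi (2 * (u i (b ! p) - u i (b' ! p'))) = spec i p b"
        by (simp add: algebra_simps flip: power_int_add)
      then have "p' = p" using generic[OF p' _ b(2)] by blast
      then have "exp t powi (2 * (u i (b ! p) - u i (b' ! p))) = 1" using * sp pole by simp
      then show ?thesis using exp_powi_eq_1_iff by fastforce
    next
      case 2
      then have "p' = p" using generic[OF p' _ b(1)] by blast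
      then have "exp t powi (2 * u i (b ! p)) = 1" using 2 sp by simp
      then show ?thesis using u0 exp_powi_eq_1_iff by fastforce
    qed
  qed
  ultimately show ?thesis by simp
qed

text \<open>The h_{i,m} determine the logarithm and the k_h the constant term, hence together the
  eigenvalue of \<phi>_i. Its parameters at each position then fix the column there.\<close>

lemma eigenvalue_separation:
  assumes b: "b \<in> tbasis" "b' \<in> tbasis"
    and K: "\<And>h. q_weight t (twt b) h = q_weight t (twt b') h"
    and H: "\<And>i m. m \<noteq> 0 \<Longrightarrow> heig i m b = heig i m b'"
  shows "b = b'"
proof (rule nth_equalityI)
  show "length b = length b'" using b tbasisD(1) by simp
  fix p assume "p < length b"
  then have p: "p < k" using b tbasisD(1) by simp
  have "hlog Plus i b = hlog Plus i b'" for i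
    unfolding hlog_heig by (rule fps_ext) (simp add: H)
  then have ser: "ser Plus i b = ser Plus i b'" for i
    using ser_eq[OF b(1), of Plus i] ser_eq[OF b(2), of Plus i] K by simp
  have par: "spec i p b' = spec i p b \<and> u i (b' ! p) = u i (b ! p)" if "u i (b ! p) \<noteq> 0 \<or> u i (b' ! p) \<noteq> 0" for i
    using ser_eq_imp_parameters[OF b p _ ser] ser_eq_imp_parameters[OF b(2,1) p _ ser[symmetric]] that by metis
  show "b ! p = b' ! p"
  proof (rule column_separation)
    show "u i (b ! p) = u i (b' ! p)" for i using par[of i] by metis
    show "e i (b ! p) = e i (b' ! p)" if "u i (b ! p) \<noteq> 0" for i
      using par[of i] that a_nonzero[OF p] by (simp add: spec_def exp_powi_eq_iff)
  qed (use b p tbasisD in auto)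
qed

lemma tspace_keys: "v \<in> tspace \<Longrightarrow> b \<in> Poly_Mapping.keys v \<Longrightarrow> b \<in> tbasis"
  by (auto simp: tspace_def)

lemma tspace_eq_cspan: "cspan ((\<lambda>b. Poly_Mapping.single b 1) ` tbasis) = tspace"
proof
  show "cspan ((\<lambda>b. Poly_Mapping.single b 1) ` tbasis) \<subseteq> tspace"
    by (rule cv.span_minimal) (auto intro: tspace_subspace)
  show "tspace \<subseteq> cspan ((\<lambda>b. Poly_Mapping.single b 1) ` tbasis)"
    using in_cspan_singles by (auto simp: tspace_def)
qed

theorem taction_thin: "thin_module tspace taction"
  unfolding thin_module_def
proof (intro conjI allI ballI impI)
  show "cspan (\<Union>\<chi>. joint_eigenspace tspace taction \<chi>) = tspace"
  proof
    show "cspan (\<Union>\<chi>. joint_eigenspace tspace taction \<chi>) \<subseteq> tspace"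
      by (rule cv.span_minimal) (auto intro: tspace_subspace simp: joint_eigenspace_def)
    have "Poly_Mapping.single b 1 \<in> (\<Union>\<chi>. joint_eigenspace tspace taction \<chi>)" if b: "b \<in> tbasis" for b
    proof -
      let ?\<chi> = "\<lambda>g. case g of K h \<Rightarrow> q_weight t (twt b) h | H i m \<Rightarrow> heig i m b | X \<epsilon> i s \<Rightarrow> 0"
      have "Poly_Mapping.single b 1 \<in> joint_eigenspace tspace taction ?\<chi>"
        using b by (simp add: joint_eigenspace_def taction_simps)
      then show ?thesis by blast
    qed
    then show "tspace \<subseteq> cspan (\<Union>\<chi>. joint_eigenspace tspace taction \<chi>)"
      unfolding tspace_eq_cspan[symmetric] by (intro cv.span_mono) auto
  qed
  fix \<chi> v w
  assume v: "v \<in> joint_eigenspace tspace taction \<chi>" and w: "w \<in> joint_eigenspace tspace taction \<chi>" and v0: "v \<noteq> 0"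
  have eig: "q_weight t (twt b) h = \<chi> (K h)" "m \<noteq> 0 \<Longrightarrow> heig i m b = \<chi> (H i m)" "b \<in> tbasis"
    if "v' \<in> joint_eigenspace tspace taction \<chi>" "b \<in> Poly_Mapping.keys v'" for v' b h i m
  proof -
    have lk: "Poly_Mapping.lookup v' b \<noteq> 0" using that(2) by (simp add: in_keys_iff)
    have "Poly_Mapping.lookup (taction (K h) v') b = Poly_Mapping.lookup (\<chi> (K h) *\<^sub>C v') b"
      "m \<noteq> 0 \<Longrightarrow> Poly_Mapping.lookup (taction (H i m) v') b = Poly_Mapping.lookup (\<chi> (H i m) *\<^sub>C v') b"
      using that(1) by (simp_all add: joint_eigenspace_def)
    then show "q_weight t (twt b) h = \<chi> (K h)" "m \<noteq> 0 \<Longrightarrow> heig i m b = \<chi> (H i m)"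
      using lk by (simp_all add: taction_simps)
    show "b \<in> tbasis" using that tspace_keys by (auto simp: joint_eigenspace_def)
  qed
  have "Poly_Mapping.keys v \<noteq> {}" using v0 by simp
  then obtain b where b: "b \<in> Poly_Mapping.keys v" by blast
  \<comment> \<open>All basis vectors occurring in joint eigenvectors for one character have the
    same eigenvalues, so they coincide and the eigenspace is a line.\<close>
  have only: "b' = b" if "b' \<in> Poly_Mapping.keys v'" "v' \<in> joint_eigenspace tspace taction \<chi>" for b' v'
    using eig[OF that(2,1)] eig[OF v b] by (intro eigenvalue_separation) auto
  have *: "Poly_Mapping.lookup w b' = Poly_Mapping.lookup w b / Poly_Mapping.lookup v b * Poly_Mapping.lookup v b'" for b'
  proof (cases "b' = b")
    case True
    then show ?thesis using b by (simp add: in_keys_iff)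
  next
    case False
    then have "b' \<notin> Poly_Mapping.keys v" "b' \<notin> Poly_Mapping.keys w" using only v w by blast+
    then show ?thesis unfolding in_keys_iff by simp
  qed
  have "w = (Poly_Mapping.lookup w b / Poly_Mapping.lookup v b) *\<^sub>C v"
    by (rule poly_mapping_eqI, unfold lookup_cscale) (rule *)
  then show "\<exists>c. w = c *\<^sub>C v" by (rule exI)
qed

text \<open>A factor of \<open>cf\<close> vanishes only where two parameters differ by the even
  power q^(2u), which genericity excludes just as it excludes the poles.\<close>

lemma cf_nonzero:
  assumes b: "b \<in> tbasis" and p: "p < k" and act: "active \<epsilon> i p b"
  shows "cf \<epsilon> i p b \<noteq> 0"
proof -
  have "phi_value t (u i (b ! p')) (spec i p' b / spec i p b) \<noteq> 0" if "p' \<in> before \<epsilon> p" for p'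
  proof -
    have p': "p' < k" "p' \<noteq> p" using before_subset[OF p] that by auto
    let ?m = "u i (b ! p')"
    have ne: "spec i p' b * exp t powi (2 * (- ?m)) \<noteq> spec i p b"
      using e_same[of "b ! p'" "b ! p" i] b p p' tbasisD by (intro spec_generic) auto
    then have "exp t powi ?m - exp t powi (- ?m) * (spec i p' b / spec i p b) \<noteq> 0"
      unfolding q_zero_iff using spec_nonzero[OF p, of i b] by simp
    moreover have "spec i p' b / spec i p b \<noteq> 1"
      using spec_neq[OF b b p p'(1), of i] p'(2) spec_nonzero[OF p, of i b] by simp
    ultimately show ?thesis by (simp add: phi_value_def)
  qed
  then show ?thesis using act by (simp add: cf_def)
qed

lemma mvp_inj:
  assumes "b \<in> tbasis" "p < k" "p' < k" "active \<epsilon> i p b" "mvp \<epsilon> i p b = mvp \<epsilon> i p' b"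
  shows "p' = p"
proof (rule ccontr)
  assume "p' \<noteq> p"
  then have "mv \<epsilon> i (b ! p) = b ! p" using assms mvp_nth[of b p \<epsilon> i p] mvp_nth[of b p' \<epsilon> i p] by simp
  then show False using u_mv[of "b ! p" i \<epsilon>] assms tbasisD by (auto simp: active_def)
qed

lemma lookup_X:
  assumes b: "b \<in> tbasis" and p: "p < k" and act: "active \<epsilon> i p b"
  shows "Poly_Mapping.lookup (taction (X \<epsilon> i s) (Poly_Mapping.single b 1)) (mvp \<epsilon> i p b) = cf \<epsilon> i p b * spec i p b powi s"
proof -
  have "Poly_Mapping.lookup (taction (X \<epsilon> i s) (Poly_Mapping.single b 1)) (mvp \<epsilon> i p b)
    = (\<Sum>p'<k. if p' = p then cf \<epsilon> i p b * spec i p b powi s else 0)"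
    unfolding taction_simps lookup_sum Xp_single lookup_single
    using mvp_inj[OF b p _ act] by (intro sum.cong refl) (auto simp: when_def)
  then show ?thesis using p by simp
qed

text \<open>Induction on the size of the support: if b' also occurs, some generator k_h or h_{i,m}
  separates b from b'. Applying it and subtracting its eigenvalue at b' removes b' and keeps
  b.\<close>

lemma stable_subspace_singles:
  assumes U: "csubspace U" "U \<subseteq> tspace" "\<And>g v. g \<in> generators \<Longrightarrow> v \<in> U \<Longrightarrow> taction g v \<in> U"
    and v: "v \<in> U" "b \<in> Poly_Mapping.keys v"
  shows "Poly_Mapping.single b 1 \<in> U"
  using v
proof (induction "card (Poly_Mapping.keys v)" arbitrary: v rule: less_induct)
  case less
  have scale: "c *\<^sub>C w \<in> U" if "w \<in> U" for c w using U(1) that by (rule cv.subspace_scale)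
  show ?case
  proof (cases "Poly_Mapping.keys v = {b}")
    case True
    have "Poly_Mapping.lookup v b \<noteq> 0" using less.prems by (simp add: in_keys_iff)
    moreover have "Poly_Mapping.lookup v x = 0" if "x \<noteq> b" for x
      using True that unfolding not_in_keys_iff_lookup_eq_zero[symmetric] by blast
    ultimately have "(1 / Poly_Mapping.lookup v b) *\<^sub>C v = Poly_Mapping.single b 1"
      by (intro poly_mapping_eqI) (auto simp: lookup_single when_def)
    then show ?thesis using scale[OF less.prems(1), of "1 / Poly_Mapping.lookup v b"] by simp
  next
    case False
    then obtain b' where b': "b' \<in> Poly_Mapping.keys v" "b' \<noteq> b" using less.prems(2) by auto
    have tb: "b \<in> tbasis" "b' \<in> tbasis" using less.prems b' U(2) tspace_keys by blast+
    obtain w where w: "w b \<noteq> w b'" "lin (\<lambda>b. Poly_Mapping.single b (w b)) v \<in> U"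
    proof -
      consider h where "q_weight t (twt b) h \<noteq> q_weight t (twt b') h" | i m where "m \<noteq> 0" "heig i m b \<noteq> heig i m b'"
        using eigenvalue_separation[OF tb] b'(2) by blast
      then show thesis
      proof cases
        case 1
        have "taction (K h) v \<in> U" using less.prems(1) by (intro U(3)) (auto simp: generators_def)
        then show thesis using 1 that[of "\<lambda>b. q_weight t (twt b) h"] by (simp add: taction_simps)
      next
        case 2
        have "taction (H i m) v \<in> U" using less.prems(1) 2(1) by (intro U(3)) (auto simp: generators_def)
        then show thesis using 2 that[of "\<lambda>b. heig i m b"] by (simp add: taction_simps)
      qed
    qed
    define v' where "v' = lin (\<lambda>b. Poly_Mapping.single b (w b)) v - w b' *\<^sub>C v"
    have v'U: "v' \<in> U" unfolding v'_def using U(1) w(2) scale[OF less.prems(1)] by (rule cv.subspace_diff)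
    have lk: "Poly_Mapping.lookup v' x = (w x - w b') * Poly_Mapping.lookup v x" for x
      by (simp add: v'_def lookup_minus left_diff_distrib)
    have "Poly_Mapping.keys v' \<subseteq> Poly_Mapping.keys v - {b'}" by (auto simp: in_keys_iff lk)
    then have "card (Poly_Mapping.keys v') < card (Poly_Mapping.keys v)"
      using b'(1) by (intro psubset_card_mono) auto
    moreover have "b \<in> Poly_Mapping.keys v'" using less.prems(2) w(1) by (simp add: in_keys_iff lk)
    ultimately show ?thesis using less.hyps v'U by blast
  qed
qed

text \<open>Moves act on one position at a time, so connectedness of the set of columns allows the
  replacement of a single entry by any column; replacing the entries of b by those of b' from left
  to right reaches every tuple.\<close>

lemma basis_connected:
  assumes S: "S \<subseteq> tbasis" "S \<noteq> {}" and closed: "\<And>b \<epsilon> i p. b \<in> S \<Longrightarrow> p < k \<Longrightarrow> active \<epsilon> i p b \<Longrightarrow> mvp \<epsilon> i p b \<in> S"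
  shows "S = tbasis"
proof -
  have step: "b[p := c] \<in> S" if b: "b \<in> S" and p: "p < k" and c: "c \<in> Col" for b p c
  proof -
    have len: "length b = k" using b S tbasisD by blast
    have "{c \<in> Col. b[p := c] \<in> S} = Col"
    proof (rule column_connected)
      have "b ! p \<in> {c \<in> Col. b[p := c] \<in> S}" using b p S tbasisD by auto
      then show "{c \<in> Col. b[p := c] \<in> S} \<noteq> {}" by blast
      fix \<epsilon> i c assume c: "c \<in> {c \<in> Col. b[p := c] \<in> S}" "u i c = - sg \<epsilon>"
      then have "mvp \<epsilon> i p (b[p := c]) \<in> S" using closed p len by (simp add: active_def)
      then show "mv \<epsilon> i c \<in> {c \<in> Col. b[p := c] \<in> S}" using c len p mv_Col by (simp add: mvp_def)
    qed auto
    then show ?thesis using c by blast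
  qed
  obtain b where b: "b \<in> S" using S by blast
  have "b' \<in> S" if b': "b' \<in> tbasis" for b'
  proof -
    have len: "length b = k" "length b' = k" using b b' S tbasisD by blast+
    have "take n b' @ drop n b \<in> S" if "n \<le> k" for n
      using that
    proof (induction n)
      case 0
      then show ?case using b by simp
    next
      case (Suc n)
      have "take (Suc n) b' @ drop (Suc n) b = (take n b' @ drop n b)[n := b' ! n]"
        using len Suc.prems by (intro nth_equalityI) (auto simp: nth_append nth_list_update min_def)
      then show ?case using step[of "take n b' @ drop n b" n "b' ! n"] Suc b' tbasisD by simp
    qed
    from this[of k] show ?thesis using len by simp
  qed
  then show ?thesis using S by blast
qed

theorem taction_irreducible:
  assumes "tbasis \<noteq> {}"
  shows "irreducible_module tspace taction"
  unfolding irreducible_module_def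
proof (intro conjI allI impI)
  obtain b0 where "b0 \<in> tbasis" using assms by blast
  then have "Poly_Mapping.single b0 1 \<in> tspace" by simp
  moreover have "Poly_Mapping.single b0 (1 :: complex) \<noteq> 0"
    by (metis lookup_single_eq lookup_zero zero_neq_one)
  ultimately show "tspace \<noteq> {0}" by blast
  fix U assume "csubspace U \<and> U \<subseteq> tspace \<and> (\<forall>g\<in>generators. \<forall>v\<in>U. taction g v \<in> U)"
  then have U: "csubspace U" "U \<subseteq> tspace" "\<And>g v. g \<in> generators \<Longrightarrow> v \<in> U \<Longrightarrow> taction g v \<in> U" by auto
  show "U = {0} \<or> U = tspace"
  proof (cases "U = {0}")
    case False
    moreover have "0 \<in> U" using U(1) by (rule cv.subspace_0)
    ultimately obtain v where v: "v \<in> U" "v \<noteq> 0" by blast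
    then have "Poly_Mapping.keys v \<noteq> {}" by simp
    then obtain b where b: "b \<in> Poly_Mapping.keys v" by blast
    define S where "S = {b \<in> tbasis. Poly_Mapping.single b 1 \<in> U}"
    have "S = tbasis"
    proof (rule basis_connected)
      show "S \<noteq> {}" using stable_subspace_singles[OF U v(1) b] v(1) b U(2) tspace_keys by (auto simp: S_def)
      fix b \<epsilon> i p assume b: "b \<in> S" and p: "p < k" "active \<epsilon> i p b"
      then have tb: "b \<in> tbasis" "taction (X \<epsilon> i 0) (Poly_Mapping.single b 1) \<in> U"
        by (auto simp: S_def generators_def intro!: U(3))
      have "mvp \<epsilon> i p b \<in> Poly_Mapping.keys (taction (X \<epsilon> i 0) (Poly_Mapping.single b 1))"
        using lookup_X[OF tb(1) p, of 0] cf_nonzero[OF tb(1) p] by (simp add: in_keys_iff)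
      then show "mvp \<epsilon> i p b \<in> S"
        using stable_subspace_singles[OF U tb(2)] mvp_tbasis[OF tb(1) p] by (simp add: S_def)
    qed (auto simp: S_def)
    then have "lin (\<lambda>b. Poly_Mapping.single b 1) w \<in> U" if "w \<in> tspace" for w
      using that U(1) by (intro lin_in_subspace) (auto simp: S_def dest: tspace_keys)
    then show ?thesis using U(2) by auto
  qed simp
qed


section \<open>Integrability and extremal vectors\<close>

lemma exp_t_neq_1: "exp t \<noteq> 1"
  using not_root_of_unity[of 1] by simp

lemma q_weight_inj:
  fixes \<nu> \<nu>' :: "'i::finite weight"
  assumes "\<And>h. q_weight t \<nu> h = q_weight t \<nu>' h"
  shows "\<nu> = \<nu>'"
proof (rule ext, rule ccontr)
  fix x assume ne: "\<nu> x \<noteq> \<nu>' x"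
  \<comment> \<open>Supported on the coordinate x and scaled so that the two pairings differ by
    exactly 1; equal q-weights would then give q = 1.\<close>
  define h where "h = (\<lambda>y. if y = x then 1 / (\<nu> x - \<nu>' x) else 0)"
  have p: "pairing \<mu> h = \<mu> x / (\<nu> x - \<nu>' x)" for \<mu> :: "'i weight"
    unfolding pairing_def h_def by (simp add: if_distrib cong: if_cong)
  have "pairing \<nu> h = pairing \<nu>' h + 1"
    unfolding p using ne by (simp add: field_simps)
  then have "q_weight t \<nu> h = q_weight t \<nu>' h * exp t"
    by (simp add: q_weight_def of_rat_add distrib_left exp_add)
  then have "exp t = 1" using assms[of h] by (simp add: q_weight_def)
  then show False using exp_t_neq_1 by contradiction
qed

lemma weight_space_keys:
  assumes "v \<in> weight_space t tspace taction \<nu>" "b \<in> Poly_Mapping.keys v"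
  shows "twt b = \<nu>"
proof (rule q_weight_inj)
  fix h
  have "taction (K h) v = q_weight t \<nu> h *\<^sub>C v" using assms(1) by (simp add: weight_space_def)
  then have "Poly_Mapping.lookup (taction (K h) v) b = Poly_Mapping.lookup (q_weight t \<nu> h *\<^sub>C v) b" by simp
  then show "q_weight t (twt b) h = q_weight t \<nu> h"
    using assms(2) by (simp add: taction_simps in_keys_iff)
qed

lemma single_weight_space: "b \<in> tbasis \<Longrightarrow> Poly_Mapping.single b c \<in> weight_space t tspace taction (twt b)"
  by (simp add: weight_space_def taction_simps mult.commute)

lemma twt_lattice: "b \<in> tbasis \<Longrightarrow> twt b \<in> weight_lattice"
  by (simp add: weight_lattice_def twt_Some del: of_int_sum)

lemma keys_X:
  assumes v: "v \<in> tspace" and x: "x \<in> Poly_Mapping.keys (taction (X \<epsilon> i s) v)"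
  obtains b p where "b \<in> Poly_Mapping.keys v" "p < k" "active \<epsilon> i p b" "x = mvp \<epsilon> i p b"
proof -
  let ?B = "{mvp \<epsilon> i p b |b p. b \<in> Poly_Mapping.keys v \<and> p < k \<and> active \<epsilon> i p b}"
  let ?W = "{v. Poly_Mapping.keys v \<subseteq> ?B}"
  have W: "csubspace ?W" by (rule csubspace_keys)
  have "Xp \<epsilon> i p s v \<in> ?W" if "p < k" for p
    unfolding Xp_def
  proof (rule lin_in_subspace[OF W])
    fix b assume "b \<in> Poly_Mapping.keys v"
    then show "Poly_Mapping.single (mvp \<epsilon> i p b) (cf \<epsilon> i p b * spec i p b powi s) \<in> ?W"
      using that by (cases "active \<epsilon> i p b") (auto simp: cf_inactive)
  qed
  then have "taction (X \<epsilon> i s) v \<in> ?W"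
    unfolding taction_simps by (intro cv.subspace_sum[OF W]) simp
  then show thesis using x that by blast
qed

text \<open>The measure behind local nilpotency: a move along i makes its column inactive and leaves
  the other columns alone.\<close>

definition activity :: "sign \<Rightarrow> 'b mod_ring \<Rightarrow> 'a list \<Rightarrow> nat" where
  "activity \<epsilon> i b = card {p. p < k \<and> active \<epsilon> i p b}"

lemma activity_mvp:
  assumes b: "b \<in> tbasis" and p: "p < k" "active \<epsilon> i p b"
  shows "activity \<epsilon> i (mvp \<epsilon> i p b) < activity \<epsilon> i b"
  unfolding activity_def
proof (rule psubset_card_mono)
  have "\<not> active \<epsilon> i p (mvp \<epsilon> i p b)" using b p by (simp add: active_def mvp_nth u_mv tbasisD)
  moreover have "active \<epsilon> i p' (mvp \<epsilon> i p b) \<longleftrightarrow> active \<epsilon> i p' b" if "p' \<noteq> p" for p'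
    using that by (rule active_mvp)
  ultimately have "active \<epsilon> i p' (mvp \<epsilon> i p b) \<longleftrightarrow> active \<epsilon> i p' b \<and> p' \<noteq> p" for p'
    by (cases "p' = p") simp_all
  then show "{p'. p' < k \<and> active \<epsilon> i p' (mvp \<epsilon> i p b)} \<subset> {p'. p' < k \<and> active \<epsilon> i p' b}"
    using p by blast
qed simp

lemma X_nilpotent:
  assumes "v \<in> tspace" "\<And>b. b \<in> Poly_Mapping.keys v \<Longrightarrow> activity \<epsilon> i b < m"
  shows "(taction (X \<epsilon> i 0) ^^ m) v = 0"
  using assms
proof (induction m arbitrary: v)
  case 0
  then have "Poly_Mapping.keys v = {}" by blast
  then show ?case by simp
next
  case (Suc m)
  have "(taction (X \<epsilon> i 0) ^^ m) (taction (X \<epsilon> i 0) v) = 0"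
  proof (rule Suc.IH)
    show "taction (X \<epsilon> i 0) v \<in> tspace" using Suc.prems(1) by (rule taction_tspace)
    fix x assume "x \<in> Poly_Mapping.keys (taction (X \<epsilon> i 0) v)"
    then obtain b p where b: "b \<in> Poly_Mapping.keys v" "p < k" "active \<epsilon> i p b" "x = mvp \<epsilon> i p b"
      by (rule keys_X[OF Suc.prems(1)])
    then have "activity \<epsilon> i x < activity \<epsilon> i b"
      using activity_mvp tspace_keys[OF Suc.prems(1)] by simp
    then show "activity \<epsilon> i x < m" using Suc.prems(2)[OF b(1)] by simp
  qed
  then show ?case by (simp only: funpow_Suc_right o_apply)
qed

theorem taction_integrable: "integrable_module t tspace taction"
  unfolding integrable_module_def
proof (intro conjI allI ballI impI)
  show "cspan (\<Union>\<nu>\<in>weight_lattice. weight_space t tspace taction \<nu>) = tspace"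
  proof
    show "cspan (\<Union>\<nu>\<in>weight_lattice. weight_space t tspace taction \<nu>) \<subseteq> tspace"
      by (rule cv.span_minimal) (auto intro: tspace_subspace simp: weight_space_def)
    show "tspace \<subseteq> cspan (\<Union>\<nu>\<in>weight_lattice. weight_space t tspace taction \<nu>)"
      unfolding tspace_eq_cspan[symmetric]
    proof (rule cv.span_mono, rule subsetI)
      fix v :: "'a list \<Rightarrow>\<^sub>0 complex"
      assume "v \<in> (\<lambda>b. Poly_Mapping.single b 1) ` tbasis"
      then obtain b where "b \<in> tbasis" "v = Poly_Mapping.single b 1" by blast
      then show "v \<in> (\<Union>\<nu>\<in>weight_lattice. weight_space t (cspan ((\<lambda>b. Poly_Mapping.single b 1) ` tbasis)) taction \<nu>)"
        unfolding tspace_eq_cspan using single_weight_space twt_lattice by blast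
    qed
  qed
next
  fix S f \<nu>
  assume *: "finite S \<and> S \<subseteq> weight_lattice \<and> (\<forall>\<nu>\<in>S. f \<nu> \<in> weight_space t tspace taction \<nu>) \<and> sum f S = 0"
    and \<nu>: "\<nu> \<in> S"
  show "f \<nu> = 0"
  proof (rule poly_mapping_eqI)
    fix b
    show "Poly_Mapping.lookup (f \<nu>) b = Poly_Mapping.lookup 0 b"
    proof (cases "b \<in> Poly_Mapping.keys (f \<nu>)")
      case True
      have "\<nu>' = twt b" if "\<nu>' \<in> S" "b \<in> Poly_Mapping.keys (f \<nu>')" for \<nu>'
        using weight_space_keys[of "f \<nu>'" \<nu>' b] that * by auto
      then have "Poly_Mapping.lookup (f \<nu>') b = 0" if "\<nu>' \<in> S" "\<nu>' \<noteq> \<nu>" for \<nu>'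
        using that \<nu> True unfolding not_in_keys_iff_lookup_eq_zero[symmetric] by metis
      then have "(\<Sum>\<nu>'\<in>S - {\<nu>}. Poly_Mapping.lookup (f \<nu>') b) = 0"
        by (intro sum.neutral) blast
      moreover have "Poly_Mapping.lookup (sum f S) b = Poly_Mapping.lookup (f \<nu>) b + (\<Sum>\<nu>'\<in>S - {\<nu>}. Poly_Mapping.lookup (f \<nu>') b)"
        unfolding lookup_sum using * \<nu> by (intro sum.remove) auto
      ultimately show ?thesis using * by simp
    next
      case False
      then show ?thesis by (simp add: in_keys_iff)
    qed
  qed
next
  fix \<epsilon> i v assume v: "v \<in> tspace"
  \<comment> \<open>At most k columns are active, and the measure must lie strictly below the
    exponent; hence k + 1 applications.\<close>
  have "(taction (X \<epsilon> i 0) ^^ Suc k) v = 0"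
  proof (rule X_nilpotent[OF v])
    fix b
    have "card {p. p < k \<and> active \<epsilon> i p b} \<le> card {..<k}" by (rule card_mono) auto
    then show "activity \<epsilon> i b < Suc k" by (simp add: activity_def)
  qed
  then show "\<exists>N. (taction (X \<epsilon> i 0) ^^ N) v = 0" by (rule exI)
qed

text \<open>The orbit is a submodule containing v, which is not zero, so irreducibility makes it
  everything.\<close>

lemma taction_generates:
  assumes v: "v \<in> tspace" "v \<noteq> 0"
  shows "subalgebra_orbit taction generators v = tspace"
proof -
  let ?U = "subalgebra_orbit taction generators v"
  have vU: "v \<in> ?U" unfolding subalgebra_orbit_def
    by (rule cv.span_base) (auto intro!: exI[of _ "[]"])
  have "foldr taction gs v \<in> tspace" for gs
    by (induction gs) (simp_all add: v(1) taction_tspace)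
  then have sub: "?U \<subseteq> tspace"
    unfolding subalgebra_orbit_def by (intro cv.span_minimal tspace_subspace) auto
  have stable: "taction g w \<in> ?U" if g: "g \<in> generators" and w: "w \<in> ?U" for g w
    using w unfolding subalgebra_orbit_def
  proof (induction rule: cv.span_induct)
    case base
    show "csubspace {x. taction g x \<in> cspan {foldr taction gs v |gs. set gs \<subseteq> generators}}"
      unfolding csubspace_iff
      using taction_scale[of g 0 0] by (auto simp: taction_add taction_scale intro: cv.span_add cv.span_scale cv.span_zero)
  next
    case (step x)
    then obtain gs where "x = foldr taction gs v" "set gs \<subseteq> generators" by blast
    then have "taction g x = foldr taction (g # gs) v" "set (g # gs) \<subseteq> generators" using g by auto
    then show ?case by (intro cv.span_base) blast
  qed
  have "v \<noteq> 0 \<Longrightarrow> Poly_Mapping.keys v \<noteq> {}" by simp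
  then have "tbasis \<noteq> {}" using v tspace_keys by blast
  from taction_irreducible[OF this] have "csubspace ?U \<and> ?U \<subseteq> tspace \<and> (\<forall>g\<in>generators. \<forall>w\<in>?U. taction g w \<in> ?U) \<longrightarrow> ?U = {0} \<or> ?U = tspace"
    unfolding irreducible_module_def by (elim conjE) (rule spec)
  moreover have "csubspace ?U" unfolding subalgebra_orbit_def by (rule cv.subspace_span)
  ultimately have "?U = {0} \<or> ?U = tspace" using sub stable by simp
  then show ?thesis using vU v(2) by blast
qed

lemma replicate_tbasis: "c \<in> Col \<Longrightarrow> replicate k c \<in> tbasis"
  by (simp add: tbasis_def)

lemma active_replicate: "p < k \<Longrightarrow> active \<epsilon> i p (replicate k c) \<longleftrightarrow> u i c = - sg \<epsilon>"
  by (simp add: active_def)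

text \<open>After m applications only tuples with exactly m moved columns occur, and for m = k there
  is one such tuple. Controlling the support suffices: the conditions on an extremal vector are
  homogeneous, so any scalar z' will do.\<close>

lemma X_power_replicate:
  assumes c: "c \<in> Col" and uc: "u i c = - sg \<epsilon>"
  shows "\<exists>z'. (taction (X \<epsilon> i 0) ^^ k) (Poly_Mapping.single (replicate k c) z) = Poly_Mapping.single (replicate k (mv \<epsilon> i c)) z'"
proof -
  define tup where "tup = (\<lambda>A. map (\<lambda>p. if p \<in> A then mv \<epsilon> i c else c) [0..<k])"
  define L where "L = (\<lambda>m. {tup A |A. A \<subseteq> {..<k} \<and> card A = m})"
  have tup: "tup A \<in> tbasis" for A using c uc mv_Col by (auto simp: tup_def tbasis_def)
  have "Poly_Mapping.keys ((taction (X \<epsilon> i 0) ^^ m) (Poly_Mapping.single (replicate k c) z)) \<subseteq> L m" for m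
  proof (induction m)
    case 0
    have "tup {} = replicate k c" by (simp add: tup_def map_replicate_const)
    then show ?case by (auto simp: L_def intro!: exI[of _ "{}"])
  next
    case (Suc m)
    define v where "v = (taction (X \<epsilon> i 0) ^^ m) (Poly_Mapping.single (replicate k c) z)"
    have v: "Poly_Mapping.keys v \<subseteq> L m" using Suc by (simp add: v_def)
    have vt: "v \<in> tspace" using v tup by (auto simp: tspace_def L_def)
    have "x \<in> L (Suc m)" if x: "x \<in> Poly_Mapping.keys (taction (X \<epsilon> i 0) v)" for x
    proof -
      obtain b p where b: "b \<in> Poly_Mapping.keys v" "p < k" "active \<epsilon> i p b" "x = mvp \<epsilon> i p b"
        using x by (rule keys_X[OF vt])
      then obtain A where A: "b = tup A" "A \<subseteq> {..<k}" "card A = m" using v by (auto simp: L_def)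
      have p: "p \<notin> A"
        using b(2,3) A(1) u_mv[OF c uc] by (auto simp: active_def tup_def)
      have "x = tup (insert p A)"
        unfolding b(4) A(1) mvp_def using p b(2) by (intro nth_equalityI) (auto simp: tup_def nth_list_update)
      moreover have "card (insert p A) = Suc m" using p A finite_subset[OF A(2)] by simp
      ultimately show ?thesis using A(2) b(2) unfolding L_def by blast
    qed
    then show ?case by (auto simp: v_def)
  qed
  from this[of k] have "Poly_Mapping.keys ((taction (X \<epsilon> i 0) ^^ k) (Poly_Mapping.single (replicate k c) z)) \<subseteq> {replicate k (mv \<epsilon> i c)}"
  proof -
    have "tup A = replicate k (mv \<epsilon> i c)" if "A \<subseteq> {..<k}" "card A = k" for A
    proof -
      have "A = {..<k}" using that by (intro card_subset_eq) auto
      then show ?thesis unfolding tup_def by (intro nth_equalityI) auto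
    qed
    then have "L k \<subseteq> {replicate k (mv \<epsilon> i c)}" by (auto simp: L_def)
    then show ?thesis using \<open>\<And>m. _ m \<subseteq> L m\<close>[of k] by blast
  qed
  then obtain w where w: "w = (taction (X \<epsilon> i 0) ^^ k) (Poly_Mapping.single (replicate k c) z)" "Poly_Mapping.keys w \<subseteq> {replicate k (mv \<epsilon> i c)}"
    by blast
  have "Poly_Mapping.lookup w x = Poly_Mapping.lookup (Poly_Mapping.single (replicate k (mv \<epsilon> i c)) (Poly_Mapping.lookup w (replicate k (mv \<epsilon> i c)))) x" for x
    using w(2) by (cases "x = replicate k (mv \<epsilon> i c)")
      (auto simp: lookup_single when_def simp flip: not_in_keys_iff_lookup_eq_zero)
  then have "w = Poly_Mapping.single (replicate k (mv \<epsilon> i c)) (Poly_Mapping.lookup w (replicate k (mv \<epsilon> i c)))"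
    by (rule poly_mapping_eqI)
  then show ?thesis unfolding w(1) by (rule exI)
qed

lemma twt_replicate: "twt (replicate k c) x = of_nat k * cw c x"
  by (simp add: twt_def)

lemma reflection_replicate:
  assumes c: "c \<in> Col" and uc: "u i c = - sg \<epsilon>"
  shows "twt (replicate k (mv \<epsilon> i c)) = reflection i (twt (replicate k c))"
proof
  fix x
  have "cw (mv \<epsilon> i c) x = cw c x + of_int (sg \<epsilon>) * simple_root i x"
  proof (cases \<epsilon>)
    case Minus
    then show ?thesis using cw_mv[OF c, of i] uc by simp
  next
    case Plus
    then have "cw c x = cw (mv Plus i c) x - simple_root i x"
      using cw_mv[of "mv Plus i c" i x] mv_inverse_Minus[OF c, of i] uc by simp
    then show ?thesis using Plus by simp
  qed
  then show "twt (replicate k (mv \<epsilon> i c)) x = reflection i (twt (replicate k c)) x"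
    using uc by (simp add: reflection_def twt_replicate cw_Some[OF c] algebra_simps)
qed

text \<open>On k equal columns the weight at i is k, 0 or -k. Accordingly S_i applies the k-th power
  and moves all columns, or it is the identity.\<close>

lemma S_iter_replicate:
  assumes "c \<in> Col" and k: "k \<ge> 1"
  shows "\<exists>c'\<in>Col. \<exists>z. S_iter t taction is (twt (replicate k c)) (Poly_Mapping.single (replicate k c) 1)
    = (twt (replicate k c'), Poly_Mapping.single (replicate k c') z)"
proof (induction "is")
  case Nil
  then show ?case using assms by auto
next
  case (Cons i "is")
  then obtain c' z where c': "c' \<in> Col" and
    S: "S_iter t taction is (twt (replicate k c)) (Poly_Mapping.single (replicate k c) 1)
      = (twt (replicate k c'), Poly_Mapping.single (replicate k c') z)" by blast
  have w: "twt (replicate k c') (Some i) = of_nat k * of_int (u i c')" by (simp add: twt_replicate cw_Some[OF c'])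
  have move: "\<exists>c''\<in>Col. \<exists>z'. S_iter t taction (i # is) (twt (replicate k c)) (Poly_Mapping.single (replicate k c) 1)
    = (twt (replicate k c''), Poly_Mapping.single (replicate k c'') z')" if uc: "u i c' = - sg \<epsilon>" for \<epsilon>
  proof -
    have w': "twt (replicate k c') (Some i) = of_int (int k * (- sg \<epsilon>))" by (simp add: w uc)
    have "nat \<bar>\<lfloor>twt (replicate k c') (Some i)\<rfloor>\<bar> = k"
      unfolding w' floor_of_int by (cases \<epsilon>) simp_all
    moreover have "(if 0 \<le> twt (replicate k c') (Some i) then Minus else Plus) = \<epsilon>"
      unfolding w' of_int_0_le_iff using k by (cases \<epsilon>) simp_all
    moreover obtain z' where "(taction (X \<epsilon> i 0) ^^ k) (Poly_Mapping.single (replicate k c') z) = Poly_Mapping.single (replicate k (mv \<epsilon> i c')) z'"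
      using X_power_replicate[OF c' uc] by blast
    ultimately have "S_iter t taction (i # is) (twt (replicate k c)) (Poly_Mapping.single (replicate k c) 1)
      = (twt (replicate k (mv \<epsilon> i c')), Poly_Mapping.single (replicate k (mv \<epsilon> i c')) (1 / q_fact t k * z'))"
      by (simp add: S S_op_def reflection_replicate[OF c' uc])
    then show ?thesis using mv_Col[OF c' uc] by blast
  qed
  consider "u i c' = - sg Minus" | "u i c' = - sg Plus" | "u i c' = 0" using u_range[OF c', of i] by auto
  then show ?case
  proof cases
    case 3
    then have "reflection i (twt (replicate k c')) = twt (replicate k c')" "S_op t taction i (twt (replicate k c')) v = v" for v
      by (simp_all add: reflection_def w S_op_def q_fact_def fun_eq_iff)
    then show ?thesis using c' by (auto simp: S)
  qed (rule move, assumption)+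
qed

lemma extremal_replicate:
  assumes c: "c \<in> Col" and k: "k \<ge> 1"
  shows "extremal_vector t tspace taction (twt (replicate k c)) (Poly_Mapping.single (replicate k c) 1)"
  unfolding extremal_vector_def
proof (intro allI)
  fix "is" i
  obtain c' z where c': "c' \<in> Col" and
    S: "S_iter t taction is (twt (replicate k c)) (Poly_Mapping.single (replicate k c) 1)
      = (twt (replicate k c'), Poly_Mapping.single (replicate k c') z)"
    using S_iter_replicate[OF c k] by blast
  have w: "twt (replicate k c') (Some i) = of_nat k * of_int (u i c')" by (simp add: twt_replicate cw_Some[OF c'])
  have zero: "taction (X \<epsilon> i 0) (Poly_Mapping.single (replicate k c') z) = 0" if "u i c' \<noteq> - sg \<epsilon>" for \<epsilon>
    unfolding taction_simps using that by (intro sum.neutral) (simp add: Xp_inactive active_replicate)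
  have "u i c' \<noteq> -1" if "0 \<le> twt (replicate k c') (Some i)"
    using that k unfolding w by (auto simp: zero_le_mult_iff)
  moreover have "u i c' \<noteq> 1" if "twt (replicate k c') (Some i) \<le> 0"
    using that k unfolding w by (auto simp: mult_le_0_iff)
  ultimately have "i_extremal t tspace taction i (twt (replicate k c')) (Poly_Mapping.single (replicate k c') z)"
    unfolding i_extremal_def using zero[of Plus] zero[of Minus] single_weight_space[OF replicate_tbasis[OF c']] by auto
  then show "case S_iter t taction is (twt (replicate k c)) (Poly_Mapping.single (replicate k c) 1) of
     (\<mu>, x) \<Rightarrow> i_extremal t tspace taction i \<mu> x"
    by (simp add: S)
qed

text \<open>Each position stays in the finite set that \<open>column_vertical\<close> provides for
  its initial column; the tuples built from these sets span a finite-dimensional space stable under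
  the subalgebra.\<close>

lemma vertical_finite:
  assumes w: "w \<in> tspace"
  shows "\<exists>B. finite B \<and> subalgebra_orbit taction (vertical_generators j) w \<subseteq> cspan B"
proof -
  let ?P = "\<lambda>c S. finite S \<and> c \<in> S \<and> S \<subseteq> Col \<and>
        (\<forall>\<epsilon> i. \<forall>c'\<in>S. i \<noteq> j \<longrightarrow> u i c' = - sg \<epsilon> \<longrightarrow> mv \<epsilon> i c' \<in> S)"
  have "\<forall>c\<in>Col. \<exists>S. ?P c S" using column_vertical by blast
  from bchoice[OF this] obtain S where P: "\<forall>c\<in>Col. ?P c (S c)" by (elim exE)
  have S: "finite (S c)" "c \<in> S c" "S c \<subseteq> Col" if "c \<in> Col" for c
    using bspec[OF P that] by blast+
  have S4: "mv \<epsilon> i c' \<in> S c" if "c \<in> Col" "c' \<in> S c" "i \<noteq> j" "u i c' = - sg \<epsilon>" for c \<epsilon> i c'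
    using bspec[OF P that(1)] that(2-4) by blast
  define T where "T = (\<Union>b\<in>Poly_Mapping.keys w. {b'. length b' = k \<and> (\<forall>p<k. b' ! p \<in> S (b ! p))})"
  have wb: "b \<in> tbasis" if "b \<in> Poly_Mapping.keys w" for b using w that by (rule tspace_keys)
  have "finite {b'. length b' = k \<and> (\<forall>p<k. b' ! p \<in> S (b ! p))}" if "b \<in> Poly_Mapping.keys w" for b
  proof (rule finite_subset)
    show "{b'. length b' = k \<and> (\<forall>p<k. b' ! p \<in> S (b ! p))} \<subseteq> {b'. set b' \<subseteq> (\<Union>p<k. S (b ! p)) \<and> length b' = k}"
      by (fastforce simp: in_set_conv_nth)
    show "finite {b'. set b' \<subseteq> (\<Union>p<k. S (b ! p)) \<and> length b' = k}"
      using S(1) wb[OF that] tbasisD by (intro finite_lists_length_eq) auto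
  qed
  then have fin: "finite T" by (simp add: T_def)
  have T: "T \<subseteq> tbasis"
  proof
    fix b' assume "b' \<in> T"
    then obtain b where "b \<in> tbasis" "length b' = k" "\<And>p. p < k \<Longrightarrow> b' ! p \<in> S (b ! p)"
      using wb by (auto simp: T_def)
    then show "b' \<in> tbasis" using S(3) tbasisD(2) unfolding tbasis_def by blast
  qed
  let ?W = "{v. Poly_Mapping.keys v \<subseteq> T}"
  have W: "csubspace ?W" by (rule csubspace_keys)
  have "b \<in> T" if "b \<in> Poly_Mapping.keys w" for b
  proof -
    have "\<forall>p<k. b ! p \<in> S (b ! p)" using S(2) tbasisD(2)[OF wb[OF that]] by blast
    then show ?thesis using that tbasisD(1)[OF wb[OF that]] unfolding T_def by blast
  qed
  then have wW: "w \<in> ?W" by blast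
  have stable: "taction g v \<in> ?W" if g: "g \<in> vertical_generators j" and v: "v \<in> ?W" for g v
  proof -
    have vt: "v \<in> tspace" using v T by (auto simp: tspace_def)
    have diag: "lin (\<lambda>b. Poly_Mapping.single b (f b)) v \<in> ?W" for f
      using v by (intro lin_in_subspace[OF W]) auto
    consider (X) \<epsilon> i s where "g = X \<epsilon> i s" "i \<noteq> j" | (H) i m where "g = H i m" | (K) h where "g = K h"
      using g by (auto simp: vertical_generators_def)
    then show ?thesis
    proof cases
      case X
      have "x \<in> T" if x: "x \<in> Poly_Mapping.keys (taction (X \<epsilon> i s) v)" for x
      proof -
        obtain b p where b: "b \<in> Poly_Mapping.keys v" "p < k" "active \<epsilon> i p b" "x = mvp \<epsilon> i p b"
          using x by (rule keys_X[OF vt])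
        then obtain b0 where b0: "b0 \<in> Poly_Mapping.keys w" "length b = k" "\<And>p. p < k \<Longrightarrow> b ! p \<in> S (b0 ! p)"
          using v by (auto simp: T_def)
        have "mv \<epsilon> i (b ! p) \<in> S (b0 ! p)"
          using b b0 X(2) S4[of "b0 ! p" "b ! p" i \<epsilon>] wb[OF b0(1)] tbasisD by (simp add: active_def)
        then have "length x = k \<and> (\<forall>p<k. x ! p \<in> S (b0 ! p))"
          using b0 b(2) unfolding b(4) mvp_def by (auto simp: nth_list_update)
        then show ?thesis using b0(1) by (auto simp: T_def)
      qed
      then show ?thesis unfolding X by blast
    qed (simp_all only: taction_simps diag)
  qed
  have "foldr taction gs w \<in> ?W" if "set gs \<subseteq> vertical_generators j" for gs
    using that by (induction gs) (use wW stable in auto)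
  then have "subalgebra_orbit taction (vertical_generators j) w \<subseteq> ?W"
    unfolding subalgebra_orbit_def by (intro cv.span_minimal W) blast
  also have "?W \<subseteq> cspan ((\<lambda>b. Poly_Mapping.single b 1) ` T)" using in_cspan_singles by blast
  finally show ?thesis using fin by blast
qed

definition teig :: "'b mod_ring \<Rightarrow> 'a list \<Rightarrow> complex poly fract" where
  "teig i b = (\<Prod>p<k. phi_factor t (u i (b ! p)) (spec i p b))"

lemma rf_coeff_teig: "rf_coeff \<epsilon> (teig i b) m = series_coeff \<epsilon> (ser \<epsilon> i b) m"
  unfolding rf_coeff_eq teig_def ser_def by (subst rf_expand_prod_phi_factor) (simp_all add: spec_nonzero)

theorem taction_extremal_loop_weight:
  assumes c: "c \<in> Col" and k: "k \<ge> 1" and m: "is_monomial m" "mono_weight m = twt (replicate k c)"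
    and eig: "\<And>i. mono_eigenvalue t m i = teig i (replicate k c)"
  shows "extremal_loop_weight_module t tspace taction m"
  unfolding extremal_loop_weight_module_def
proof (intro conjI taction_toroidal_module taction_integrable m(1) bexI)
  let ?v = "Poly_Mapping.single (replicate k c) (1 :: complex)"
  have b: "replicate k c \<in> tbasis" using c by (rule replicate_tbasis)
  then have v: "?v \<in> tspace" by simp
  have "?v \<noteq> 0" by (metis lookup_single_eq lookup_zero zero_neq_one)
  with v show "subalgebra_orbit taction generators ?v = tspace" by (rule taction_generates)
  show "extremal_vector t tspace taction (mono_weight m) ?v"
    unfolding m(2) by (rule extremal_replicate[OF c k])
  show "\<forall>j. \<forall>w\<in>tspace. \<exists>B. finite B \<and> subalgebra_orbit taction (vertical_generators j) w \<subseteq> cspan B"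
    using vertical_finite by blast
  have "phi_op t taction \<epsilon> i p ?v - rf_coeff \<epsilon> (mono_eigenvalue t m i) p *\<^sub>C ?v = 0" for \<epsilon> i p
    by (simp add: phi_taction[OF v] eig rf_coeff_teig)
  then have "((\<lambda>x. phi_op t taction \<epsilon> i p x - rf_coeff \<epsilon> (mono_eigenvalue t m i) p *\<^sub>C x) ^^ 1) ?v = 0" for \<epsilon> i p
    by simp
  then show "?v \<in> lweight_space t tspace taction m"
    unfolding lweight_space_def mem_Collect_eq m(2)
    by (intro conjI allI exI[of _ 1] single_weight_space[OF b])
qed

text \<open>The interface to the concrete modules. Only values on \<open>Col\<close> are compared,
  since the fields of a loop datum are total functions whose values off the basis carry no
  meaning.\<close>

definition column_data :: "nat \<Rightarrow> ('b mod_ring, 'a) loop_data \<Rightarrow> bool" where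
  "column_data p M \<longleftrightarrow> basis M = Col \<and> (\<forall>c\<in>Col. wt M c = cw c) \<and>
     (\<forall>c\<in>Col. \<forall>i. phi_eig M i c = phi_factor t (u i c) (a p * exp t powi e i c)) \<and>
     (\<forall>c\<in>Col. \<forall>c'\<in>Col. \<forall>\<epsilon> i \<gamma>. x_coeff M \<epsilon> i c c' \<gamma> =
        (if u i c = - sg \<epsilon> \<and> c' = mv \<epsilon> i c \<and> \<gamma> = a p * exp t powi e i c then 1 else 0))"

lemma column_dataD:
  assumes "column_data p M"
  shows "basis M = Col" "c \<in> Col \<Longrightarrow> wt M c = cw c"
    "c \<in> Col \<Longrightarrow> phi_eig M i c = phi_factor t (u i c) (a p * exp t powi e i c)"
    "c \<in> Col \<Longrightarrow> c' \<in> Col \<Longrightarrow> x_coeff M \<epsilon> i c c' \<gamma> =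
        (if u i c = - sg \<epsilon> \<and> c' = mv \<epsilon> i c \<and> \<gamma> = a p * exp t powi e i c then 1 else 0)"
  using assms unfolding column_data_def by blast+

section \<open>Identification of the action with the Drinfeld coproduct of loop data\<close>

context
  fixes Ms :: "('b mod_ring, 'a) loop_data list"
  assumes len: "length Ms = k" and Ms: "\<And>p. p < k \<Longrightarrow> column_data p (Ms ! p)"
begin

lemma basis_tensor: "basis (tensor Ms) = tbasis"
  using column_dataD(1)[OF Ms] by (simp add: tensor_def len tbasis_def)

lemma underlying_space_tensor: "underlying_space (tensor Ms) = tspace"
  by (simp add: underlying_space_def basis_tensor tspace_def)

lemma coproduct_factor_eq:
  assumes "b \<in> tbasis" "p < k"
  shows "coproduct_factor Ms \<epsilon> i b p = (\<Prod>p'\<in>before \<epsilon> p. phi_factor t (u i (b ! p')) (spec i p' b))"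
proof -
  have "(case \<epsilon> of Plus \<Rightarrow> {..<p} | Minus \<Rightarrow> {p<..<length Ms}) = before \<epsilon> p"
    by (cases \<epsilon>) (simp_all add: before_def len)
  then show ?thesis
    unfolding coproduct_factor_def using before_subset[OF assms(2), of \<epsilon>] assms(1)
    by (auto intro!: prod.cong simp: column_dataD(3)[OF Ms] tbasisD spec_def)
qed

text \<open>The factor at p' has its pole at 1/\<open>spec i p' b\<close>, which genericity
  separates from the point of evaluation 1/\<open>spec i p b\<close>; no infinite sum remains in the
  coproduct.\<close>

lemma coproduct_factor_value:
  assumes b: "b \<in> tbasis" and p: "p < k"
  shows "rf_regular (coproduct_factor Ms \<epsilon> i b p) (inverse (spec i p b))"
    "rf_eval (coproduct_factor Ms \<epsilon> i b p) (inverse (spec i p b))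
      = (\<Prod>p'\<in>before \<epsilon> p. phi_value t (u i (b ! p')) (spec i p' b / spec i p b))"
proof -
  have ne: "spec i p' b * inverse (spec i p b) \<noteq> 1" if "p' \<in> before \<epsilon> p" for p'
    using that before_subset[OF p, of \<epsilon>] spec_neq[OF b b p, of p' i] spec_nonzero[OF p, of i b]
    by (auto simp: field_simps)
  then show "rf_regular (coproduct_factor Ms \<epsilon> i b p) (inverse (spec i p b))"
    unfolding coproduct_factor_eq[OF assms] by (intro rf_regular_prod rf_regular_phi_factor)
  show "rf_eval (coproduct_factor Ms \<epsilon> i b p) (inverse (spec i p b))
      = (\<Prod>p'\<in>before \<epsilon> p. phi_value t (u i (b ! p')) (spec i p' b / spec i p b))"
    unfolding coproduct_factor_eq[OF assms] using ne
    by (subst rf_regular_prod) (auto intro!: prod.cong rf_regular_phi_factor simp: rf_eval_phi_factor divide_inverse)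
qed

theorem tensor_coproduct_well_defined: "coproduct_well_defined Ms"
  unfolding coproduct_well_defined_def basis_tensor len
proof (intro ballI allI impI)
  fix b p \<epsilon> i \<gamma> c'
  assume b: "b \<in> tbasis" and p: "p < k" and c': "c' \<in> basis (Ms ! p)" and x: "x_coeff (Ms ! p) \<epsilon> i (b ! p) c' \<gamma> \<noteq> 0"
  then have "\<gamma> = spec i p b"
    using column_dataD(1,4)[OF Ms[OF p]] tbasisD(2)[OF b p] by (simp add: spec_def split: if_splits)
  then show "rf_regular (coproduct_factor Ms \<epsilon> i b p) (inverse \<gamma>)"
    using coproduct_factor_value(1)[OF b p] by simp
qed

lemma x_coeff_tensor:
  assumes b: "b \<in> tbasis" and b': "b' \<in> tbasis"
  shows "x_coeff (tensor Ms) \<epsilon> i b b' \<gamma> = (\<Sum>p<k. if b' = mvp \<epsilon> i p b \<and> \<gamma> = spec i p b then cf \<epsilon> i p b else 0)"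
proof -
  have "(if b' = b[p := b' ! p] then rf_eval (coproduct_factor Ms \<epsilon> i b p) (inverse \<gamma>) * x_coeff (Ms ! p) \<epsilon> i (b ! p) (b' ! p) \<gamma> else 0)
    = (if b' = mvp \<epsilon> i p b \<and> \<gamma> = spec i p b then cf \<epsilon> i p b else 0)" if p: "p < k" for p
  proof -
    have x: "x_coeff (Ms ! p) \<epsilon> i (b ! p) (b' ! p) \<gamma>
      = (if active \<epsilon> i p b \<and> b' ! p = mv \<epsilon> i (b ! p) \<and> \<gamma> = spec i p b then 1 else 0)"
      using column_dataD(4)[OF Ms[OF p]] tbasisD(2)[OF b p] tbasisD(2)[OF b' p] by (simp add: active_def spec_def)
    have "b' = b[p := b' ! p] \<and> b' ! p = mv \<epsilon> i (b ! p) \<longleftrightarrow> b' = mvp \<epsilon> i p b"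
      using tbasisD(1)[OF b] p by (auto simp: mvp_def)
    then show ?thesis using coproduct_factor_value(2)[OF b p, of \<epsilon> i] unfolding x cf_def by auto
  qed
  then show ?thesis by (simp add: tensor_def len)
qed

theorem tensor_has_action: "has_action t (tensor Ms) taction"
  unfolding has_action_def underlying_space_tensor basis_tensor
proof (intro conjI ballI allI taction_linear_on)
  fix b assume b: "b \<in> tbasis"
  have "wt (tensor Ms) b = twt b"
    using column_dataD(2)[OF Ms] tbasisD(2)[OF b] by (auto simp: tensor_def len twt_def fun_eq_iff)
  then show "taction (K h) (Poly_Mapping.single b 1) = Poly_Mapping.single b (q_weight t (wt (tensor Ms) b) h)" for h
    by (simp add: taction_simps)
  have "phi_eig (tensor Ms) i b = teig i b" for i
    using column_dataD(3)[OF Ms] tbasisD(2)[OF b] by (auto simp: tensor_def len teig_def spec_def intro!: prod.cong)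
  then show "phi_op t taction \<epsilon> i p (Poly_Mapping.single b 1) = Poly_Mapping.single b (rf_coeff \<epsilon> (phi_eig (tensor Ms) i b) p)" for \<epsilon> i p
    using b by (simp add: phi_taction rf_coeff_teig)
  fix \<epsilon> i s b' assume b': "b' \<in> tbasis"
  have X: "Poly_Mapping.lookup (taction (X \<epsilon> i s) (Poly_Mapping.single b 1)) b'
     = (\<Sum>p<k. if b' = mvp \<epsilon> i p b then cf \<epsilon> i p b * spec i p b powi s else 0)"
    unfolding taction_simps lookup_sum Xp_single lookup_single by (intro sum.cong refl) (auto simp: when_def)
  show "Poly_Mapping.lookup (taction (X \<epsilon> i s) (Poly_Mapping.single b 1)) b' =
      (\<Sum>\<gamma> | x_coeff (tensor Ms) \<epsilon> i b b' \<gamma> \<noteq> 0. x_coeff (tensor Ms) \<epsilon> i b b' \<gamma> * \<gamma> powi s)"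
  proof (cases "\<exists>p<k. active \<epsilon> i p b \<and> b' = mvp \<epsilon> i p b")
    case True
    then obtain p where p: "p < k" "active \<epsilon> i p b" "b' = mvp \<epsilon> i p b" by blast
    \<comment> \<open>Moves at different positions give different tuples, so a given matrix entry
      receives at most one summand and a single delta function.\<close>
    have only: "b' = mvp \<epsilon> i p' b \<longleftrightarrow> p' = p" if "p' < k" for p'
      using mvp_inj[OF b p(1) that p(2)] p(3) by auto
    have "x_coeff (tensor Ms) \<epsilon> i b b' \<gamma> = (\<Sum>p'<k. if p' = p then (if \<gamma> = spec i p b then cf \<epsilon> i p b else 0) else 0)" for \<gamma>
      unfolding x_coeff_tensor[OF b b'] using only by (intro sum.cong refl) auto
    then have x: "x_coeff (tensor Ms) \<epsilon> i b b' \<gamma> = (if \<gamma> = spec i p b then cf \<epsilon> i p b else 0)" for \<gamma>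
      using p(1) by simp
    have "{\<gamma>. x_coeff (tensor Ms) \<epsilon> i b b' \<gamma> \<noteq> 0} = {spec i p b}"
      using cf_nonzero[OF b p(1,2)] by (auto simp: x)
    moreover have "Poly_Mapping.lookup (taction (X \<epsilon> i s) (Poly_Mapping.single b 1)) b' = cf \<epsilon> i p b * spec i p b powi s"
      unfolding p(3) by (rule lookup_X[OF b p(1,2)])
    ultimately show ?thesis by (simp add: x)
  next
    case False
    then have "x_coeff (tensor Ms) \<epsilon> i b b' \<gamma> = 0" for \<gamma>
      unfolding x_coeff_tensor[OF b b'] by (intro sum.neutral) (auto simp: cf_def)
    moreover have "Poly_Mapping.lookup (taction (X \<epsilon> i s) (Poly_Mapping.single b 1)) b' = 0"
      unfolding X using False by (intro sum.neutral) (auto simp: cf_def)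
    ultimately show ?thesis by simp
  qed
qed

end

end

section \<open>Columns as periodic sequences\<close>

text \<open>The bound 2r + 1 is n, one less than the period, so the entries of a column lie in
  distinct residue classes.\<close>

definition columns :: "nat \<Rightarrow> int list set" where
  "columns r = {js. length js = r + 1 \<and> sorted_wrt (<) js \<and> last js - hd js \<le> 2 * int r + 1}"

definition occ :: "'n::nontriv mod_ring \<Rightarrow> int list \<Rightarrow> bool" where
  "occ i js \<longleftrightarrow> i \<in> of_int ` set js"

text \<open>The choice is unique for a column whose entries meet the class i.\<close>

definition box :: "'n::nontriv mod_ring \<Rightarrow> int list \<Rightarrow> nat" where
  "box i js = (SOME s. s < length js \<and> of_int (js ! s) = i)"

definition col_u :: "'n::nontriv mod_ring \<Rightarrow> int list \<Rightarrow> int" where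
  "col_u i js = of_bool (occ i js) - of_bool (occ (i + 1) js)"

text \<open>The value \<open>to_int_mod_ring i\<close> in the last case is irrelevant, but has the right parity.\<close>

definition col_e :: "'n::nontriv mod_ring \<Rightarrow> int list \<Rightarrow> int" where
  "col_e i js = (if occ i js then js ! box i js - 2 * int (box i js)
     else if occ (i + 1) js then js ! box (i + 1) js - 1 - 2 * int (box (i + 1) js)
     else to_int_mod_ring i)"

definition col_mv :: "sign \<Rightarrow> 'n::nontriv mod_ring \<Rightarrow> int list \<Rightarrow> int list" where
  "col_mv \<epsilon> i js = (case \<epsilon> of Minus \<Rightarrow> js[box i js := js ! box i js + 1]
     | Plus \<Rightarrow> js[box (i + 1) js := js ! box (i + 1) js - 1])"

definition col_wt :: "int list \<Rightarrow> 'n::nontriv mod_ring weight" where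
  "col_wt js x = (\<Sum>s<length js. box_weight (js ! s) x)"

lemma columns_iff:
  "js \<in> columns r \<longleftrightarrow> length js = r + 1 \<and> (\<forall>s s'. s < s' \<longrightarrow> s' \<le> r \<longrightarrow> js ! s < js ! s') \<and> js ! r - js ! 0 \<le> 2 * int r + 1"
proof (cases "length js = r + 1")
  case True
  then have "js \<noteq> []" by auto
  then have "last js = js ! r" "hd js = js ! 0" using True by (simp_all add: last_conv_nth hd_conv_nth)
  then show ?thesis using True unfolding columns_def sorted_wrt_iff_nth_less by (auto simp: less_Suc_eq_le)
qed (simp add: columns_def)

lemma columns_length: "js \<in> columns r \<Longrightarrow> length js = r + 1"
  by (simp add: columns_def)

lemma columns_less: "js \<in> columns r \<Longrightarrow> s < s' \<Longrightarrow> s' \<le> r \<Longrightarrow> js ! s < js ! s'"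
  by (simp add: columns_iff)

lemma columns_mono: "js \<in> columns r \<Longrightarrow> s \<le> s' \<Longrightarrow> s' \<le> r \<Longrightarrow> js ! s \<le> js ! s'"
  using columns_less[of js r s s'] by (cases "s = s'") auto

lemma columns_span:
  assumes "js \<in> columns r" "s \<le> r" "s' \<le> r"
  shows "js ! s' - js ! s \<le> 2 * int r + 1"
  using assms columns_mono[of js r 0 s] columns_mono[of js r s' r] by (auto simp: columns_iff)

lemma occ_iff: "js \<in> columns r \<Longrightarrow> occ i js \<longleftrightarrow> (\<exists>s\<le>r. of_int (js ! s) = i)"
  by (auto simp: occ_def columns_length in_set_conv_nth image_iff less_Suc_eq_le Bex_def)

lemma occ_of_int: "js \<in> columns r \<Longrightarrow> s \<le> r \<Longrightarrow> occ (of_int (js ! s)) js"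
  using occ_iff by blast

lemma box_weight_Suc:
  "(box_weight (j + 1) x :: rat) = box_weight j x - simple_root (of_int j :: 'n::nontriv mod_ring) x"
proof (cases "j \<ge> 1")
  case True
  then have "{1..<j + 1} = insert j {1..<j}" "{j..<1} = {}" "{j + 1..<1} = {}" by auto
  then show ?thesis by (simp add: box_weight_def)
next
  case False
  then have "{j..<1} = insert j {j + 1..<1}" "{1..<j} = {}" "{1..<j + 1} = {}" by auto
  then show ?thesis by (simp add: box_weight_def)
qed

lemma of_int_to_int_mod_ring [simp]: "of_int (to_int_mod_ring i) = (i :: 'n::nontriv mod_ring)"
  by (simp add: of_int_of_int_mod_ring)

lemma multiple_less_imp_zero: "N dvd x \<Longrightarrow> \<bar>x\<bar> < N \<Longrightarrow> x = (0::int)"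
  using zdvd_not_zless[of "\<bar>x\<bar>" N] by (cases "x = 0") auto

section \<open>Moving a single box inside a column\<close>

locale column_model =
  fixes r :: nat and ty :: "'n::nontriv itself"
  assumes r: "r \<ge> 1" and card_n: "CARD('n) = 2 * r + 2"
begin

lemma of_int_eq_iff_dvd: "(of_int x :: 'n mod_ring) = of_int y \<longleftrightarrow> 2 * int r + 2 dvd x - y"
  unfolding of_int_mod_ring_eq_iff card_n by (simp add: add.commute)

lemma of_int_eq_imp_eq:
  assumes "(of_int x :: 'n mod_ring) = of_int y" "\<bar>x - y\<bar> < 2 * int r + 2"
  shows "x = y"
  using multiple_less_imp_zero[of "2 * int r + 2" "x - y"] assms of_int_eq_iff_dvd by simp

lemma occ_nth: "js \<in> columns r \<Longrightarrow> s \<le> r \<Longrightarrow> occ (of_int (js ! s) :: 'n mod_ring) js"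
  by (rule occ_of_int)

lemma card_ge_4: "CARD('n) \<ge> 4"
  using r card_n by simp

lemma two_steps: "(i :: 'n mod_ring) + 1 \<noteq> i" "i - 1 \<noteq> i" "i + 1 \<noteq> i - 1" "i + 1 + 1 \<noteq> i" "i + 1 + 1 \<noteq> i + 1"
proof -
  show "i + 1 \<noteq> i" "i - 1 \<noteq> i" "i + 1 + 1 \<noteq> i + 1" by auto
  have "(i + 1) - (i - 1) = (of_int 2 :: 'n mod_ring)" "(i + 1 + 1) - i = (of_int 2 :: 'n mod_ring)" by simp_all
  moreover have "(of_int 2 :: 'n mod_ring) \<noteq> 0" using small_mod_ring_neq[of 2, OF card_ge_4] by simp
  ultimately show "i + 1 \<noteq> i - 1" "i + 1 + 1 \<noteq> i" by (metis diff_self)+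
qed

lemma class_inj:
  assumes "js \<in> columns r" "s \<le> r" "s' \<le> r" "(of_int (js ! s) :: 'n mod_ring) = of_int (js ! s')"
  shows "s = s'"
proof (rule ccontr)
  assume "s \<noteq> s'"
  have "js ! s = js ! s'"
    using columns_span[OF assms(1-3)] columns_span[OF assms(1,3,2)] assms(4) by (intro of_int_eq_imp_eq) auto
  then show False using \<open>s \<noteq> s'\<close> columns_less[OF assms(1), of s s'] columns_less[OF assms(1), of s' s] assms(2,3)
    by (cases "s < s'") auto
qed

lemma box_eq:
  assumes "js \<in> columns r" "s \<le> r" "(of_int (js ! s) :: 'n mod_ring) = i"
  shows "box i js = s"
  unfolding box_def
proof (rule some_equality)
  show "s < length js \<and> of_int (js ! s) = i" using assms by (simp add: columns_length[OF assms(1)])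
  show "s' < length js \<and> of_int (js ! s') = i \<Longrightarrow> s' = s" for s'
    using assms class_inj[of js s' s] by (simp add: columns_length[OF assms(1)])
qed

lemma box:
  assumes "js \<in> columns r" "occ (i :: 'n mod_ring) js"
  shows "box i js \<le> r" "of_int (js ! box i js) = i"
proof -
  obtain s where "s \<le> r" "of_int (js ! s) = i" using assms occ_iff by blast
  then show "box i js \<le> r" "of_int (js ! box i js) = i" using box_eq[OF assms(1)] by auto
qed

text \<open>The raised box could collide with the next one or, if it is the last, come a full period
  ahead of the first. In either case the class above it would already be occupied.\<close>

lemma raise_column:
  assumes js: "js \<in> columns r" and s: "s \<le> r" and free: "\<not> occ (of_int (js ! s) + 1 :: 'n mod_ring) js"
  shows "js[s := js ! s + 1] \<in> columns r"
proof -
  have ne: "js ! s' \<noteq> js ! s + 1" if "s' \<le> r" for s'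
    using occ_nth[OF js that] free by auto
  \<comment> \<open>The periodic collision: the raised last box would be congruent to the first
    box.\<close>
  have wrap: "js ! r + 1 - js ! 0 \<noteq> 2 * int r + 2" if "s = r"
  proof
    assume "js ! r + 1 - js ! 0 = 2 * int r + 2"
    then have "js ! 0 - (js ! r + 1) = - (2 * int r + 2)" by simp
    then have "(of_int (js ! 0) :: 'n mod_ring) = of_int (js ! r + 1)" by (simp only: of_int_eq_iff_dvd dvd_minus_iff dvd_refl)
    then show False using occ_nth[OF js, of 0] free that by simp
  qed
  have "js[s := js ! s + 1] ! x < js[s := js ! s + 1] ! y" if "x < y" "y \<le> r" for x y
  proof -
    have "js ! x < js ! y" using columns_less[OF js] that by simp
    moreover have "js ! y \<noteq> js ! s + 1" using ne that by simp
    ultimately show ?thesis using that s by (auto simp: nth_list_update columns_length[OF js])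
  qed
  moreover have "js[s := js ! s + 1] ! r - js[s := js ! s + 1] ! 0 \<le> 2 * int r + 1"
    using js wrap r s by (auto simp: columns_iff nth_list_update)
  ultimately show ?thesis using js by (simp add: columns_iff)
qed

text \<open>As for raising, with the previous box as neighbour; the periodic collision is now that
  of the lowered first box with the last one.\<close>

lemma lower_column:
  assumes js: "js \<in> columns r" and s: "s \<le> r" and free: "\<not> occ (of_int (js ! s) - 1 :: 'n mod_ring) js"
  shows "js[s := js ! s - 1] \<in> columns r"
proof -
  have ne: "js ! s' \<noteq> js ! s - 1" if "s' \<le> r" for s'
    using occ_nth[OF js that] free by auto
  have wrap: "js ! r + 1 - js ! 0 \<noteq> 2 * int r + 2" if "s = 0"
  proof
    assume "js ! r + 1 - js ! 0 = 2 * int r + 2"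
    then have "js ! r - (js ! 0 - 1) = 2 * int r + 2" by simp
    then have "(of_int (js ! r) :: 'n mod_ring) = of_int (js ! 0 - 1)" by (simp only: of_int_eq_iff_dvd dvd_refl)
    then show False using occ_nth[OF js, of r] free that by simp
  qed
  have "js[s := js ! s - 1] ! x < js[s := js ! s - 1] ! y" if "x < y" "y \<le> r" for x y
  proof -
    have "js ! x < js ! y" using columns_less[OF js] that by simp
    moreover have "js ! x \<noteq> js ! s - 1" using ne that by simp
    ultimately show ?thesis using that s by (auto simp: nth_list_update columns_length[OF js])
  qed
  moreover have "js[s := js ! s - 1] ! r - js[s := js ! s - 1] ! 0 \<le> 2 * int r + 1"
    using js wrap r s by (auto simp: columns_iff nth_list_update)
  ultimately show ?thesis using js by (simp add: columns_iff)
qed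

lemma raised_free:
  assumes js: "js \<in> columns r" and s: "s \<le> r" and js': "js[s := js ! s + 1] \<in> columns r"
  shows "\<not> occ (of_int (js ! s) + 1 :: 'n mod_ring) js"
proof
  assume "occ (of_int (js ! s) + 1 :: 'n mod_ring) js"
  then obtain s' where s': "s' \<le> r" "(of_int (js ! s') :: 'n mod_ring) = of_int (js ! s) + 1"
    using occ_iff[OF js] by blast
  then have ne: "s' \<noteq> s" using two_steps(1) by metis
  have "(of_int (js[s := js ! s + 1] ! s') :: 'n mod_ring) = of_int (js[s := js ! s + 1] ! s)"
    using s' s ne js by (simp add: columns_length[OF js])
  then show False using class_inj[OF js' s'(1) s] ne by simp
qed

lemma occ_raise:
  assumes js: "js \<in> columns r" and s: "s \<le> r" and i: "(of_int (js ! s) :: 'n mod_ring) = i"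
    and js': "js[s := js ! s + 1] \<in> columns r"
  shows "occ l (js[s := js ! s + 1]) \<longleftrightarrow> l = i + 1 \<or> (l \<noteq> i \<and> occ l js)"
proof
  assume "occ l (js[s := js ! s + 1])"
  then obtain s' where s': "s' \<le> r" "of_int (js[s := js ! s + 1] ! s') = l" using occ_iff[OF js'] by blast
  show "l = i + 1 \<or> (l \<noteq> i \<and> occ l js)"
  proof (cases "s' = s")
    case True
    then show ?thesis using s' s js i by (auto simp: columns_length[OF js])
  next
    case False
    then have "of_int (js ! s') = l" using s' by simp
    moreover from this have "occ l js" using occ_nth[OF js s'(1)] by metis
    moreover have "(of_int (js ! s') :: 'n mod_ring) \<noteq> of_int (js ! s)"
      using class_inj[OF js s'(1) s] False by blast
    ultimately show ?thesis using i by simp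
  qed
next
  assume *: "l = i + 1 \<or> (l \<noteq> i \<and> occ l js)"
  have o: "occ (of_int (js[s := js ! s + 1] ! s') :: 'n mod_ring) (js[s := js ! s + 1])" if "s' \<le> r" for s'
    using occ_nth[OF js' that] .
  show "occ l (js[s := js ! s + 1])"
  proof (cases "l = i + 1")
    case True
    then show ?thesis using o[OF s] s i by (simp add: columns_length[OF js])
  next
    case False
    then have l: "l \<noteq> i" "occ l js" using * by auto
    then have "box l js \<noteq> s" using box[OF js, of l] i by auto
    then show ?thesis using o[of "box l js"] box[OF js l(2)] by simp
  qed
qed

lemma box_raise:
  assumes js: "js \<in> columns r" and s: "s \<le> r" and i: "(of_int (js ! s) :: 'n mod_ring) = i"
    and js': "js[s := js ! s + 1] \<in> columns r"
  shows "box (i + 1) (js[s := js ! s + 1]) = s"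
    and "l \<noteq> i \<Longrightarrow> occ l js \<Longrightarrow> box l (js[s := js ! s + 1]) = box l js"
    and "l \<noteq> i \<Longrightarrow> occ l js \<Longrightarrow> box l js \<noteq> s"
proof -
  show "box (i + 1) (js[s := js ! s + 1]) = s"
    using s i js by (intro box_eq[OF js']) (simp_all add: columns_length[OF js])
  show ne: "box l js \<noteq> s" if "l \<noteq> i" "occ l js" using box[OF js that(2)] that(1) i by auto
  show "box l (js[s := js ! s + 1]) = box l js" if "l \<noteq> i" "occ l js"
    using box[OF js that(2)] ne[OF that] by (intro box_eq[OF js']) simp_all
qed

text \<open>
  Continued by \<open>js ! (s + r + 1) = js ! s + 2 r + 2\<close>, a column becomes a periodic sequence, for which
  \<open>js ! s - 2 s\<close> is periodic.
\<close>

lemma neighbour: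
  assumes js: "js \<in> columns r" and s: "s \<le> r" "s' \<le> r"
    and d: "0 < d" "d < 2 * int r + 2" "(of_int (js ! s') :: 'n mod_ring) = of_int (js ! s + d)"
    and free: "\<And>d'. 0 < d' \<Longrightarrow> d' < d \<Longrightarrow> \<not> occ (of_int (js ! s + d') :: 'n mod_ring) js"
  shows "js ! s' - 2 * int s' = js ! s - 2 * int s + d - 2"
proof -
  let ?N = "2 * int r + 2"
  have occ: "occ (of_int (js ! x) :: 'n mod_ring) js" if "x \<le> r" for x using occ_of_int[OF js that] .
  have b: "js ! s' - js ! s < ?N" "js ! s - js ! s' < ?N" "js ! s - js ! 0 < ?N" "js ! r - js ! s' < ?N"
    using columns_span[OF js] s by force+
  have dv: "?N dvd js ! s' - (js ! s + d)" using d(3) of_int_eq_iff_dvd by blast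
  show ?thesis
  proof (cases "js ! s' > js ! s")
    case True
    have eq: "js ! s' = js ! s + d" using multiple_less_imp_zero[OF dv] b d True by auto
    have "s < s'" using columns_mono[OF js, of s' s] s True by (cases "s < s'") auto
    moreover have "\<not> s + 1 < s'"
    proof
      assume lt: "s + 1 < s'"
      have "js ! s < js ! (s + 1)" "js ! (s + 1) < js ! s'" using columns_less[OF js] lt s by simp_all
      then have "\<not> occ (of_int (js ! s + (js ! (s + 1) - js ! s)) :: 'n mod_ring) js"
        using eq by (intro free) auto
      then show False using occ[of "s + 1"] lt s by simp
    qed
    ultimately have "s' = s + 1" by simp
    then show ?thesis using eq by simp
  next
    \<comment> \<open>The neighbour is reached across the period: s is the last position and s' = 0.
      The shift of the value by 2r + 2 is compensated by the change of 2s, which is 2r, together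
      with the constant 2 in the claim.\<close>
    case False
    have "\<bar>js ! s' - (js ! s + d) + ?N\<bar> < ?N" using b(2) d False by (simp add: abs_less_iff)
    then have "js ! s' - (js ! s + d) + ?N = 0"
      by (rule multiple_less_imp_zero[OF dvd_add[OF dv dvd_refl]])
    then have eq: "js ! s' + ?N = js ! s + d" by simp
    have "\<not> s < r"
    proof
      assume "s < r"
      then have "\<not> occ (of_int (js ! s + (js ! r - js ! s)) :: 'n mod_ring) js"
        using columns_less[OF js, of s r] eq b by (intro free) auto
      then show False using occ[of r] by simp
    qed
    moreover have "\<not> 0 < s'"
    proof
      assume "0 < s'"
      then have "\<not> occ (of_int (js ! s + (js ! 0 + ?N - js ! s)) :: 'n mod_ring) js"
        using columns_less[OF js, of 0 s'] s eq b by (intro free) auto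
      moreover have "(of_int (js ! s + (js ! 0 + ?N - js ! s)) :: 'n mod_ring) = of_int (js ! 0)"
        by (subst of_int_eq_iff_dvd) simp
      ultimately show False using occ[of 0] by simp
    qed
    ultimately show ?thesis using eq s by simp
  qed
qed

lemma col_u_1: "col_u i js = 1 \<longleftrightarrow> occ i js \<and> \<not> occ (i + 1) js"
  and col_u_m1: "col_u i js = -1 \<longleftrightarrow> \<not> occ i js \<and> occ (i + 1) js"
  by (simp_all add: col_u_def of_bool_def)

lemma col_mv_Minus:
  assumes js: "js \<in> columns r" and u: "col_u (i :: 'n mod_ring) js = 1"
  defines "s \<equiv> box i js"
  shows "s \<le> r" "of_int (js ! s) = i" "col_mv Minus i js = js[s := js ! s + 1]" "js[s := js ! s + 1] \<in> columns r"
    "col_e i js = js ! s - 2 * int s" "\<not> occ (i + 1) js"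
proof -
  have o: "occ i js" "\<not> occ (i + 1) js" using u col_u_1 by auto
  show s: "s \<le> r" "of_int (js ! s) = i" using box[OF js o(1)] by (simp_all add: s_def)
  show "js[s := js ! s + 1] \<in> columns r" using raise_column[OF js s(1)] o s by simp
  show "col_mv Minus i js = js[s := js ! s + 1]" "col_e i js = js ! s - 2 * int s" "\<not> occ (i + 1) js"
    using o by (simp_all add: col_mv_def col_e_def s_def)
qed

lemma Minus_properties:
  assumes js: "js \<in> columns r" and u: "col_u (i :: 'n mod_ring) js = 1"
  shows "col_mv Minus i js \<in> columns r" "col_u i (col_mv Minus i js) = -1"
    "col_e i (col_mv Minus i js) = col_e i js" "col_mv Plus i (col_mv Minus i js) = js"
proof -
  define s where "s = box i js"
  note M = col_mv_Minus[OF js u, folded s_def]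
  note occ = occ_raise[OF js M(1,2,4)] and box' = box_raise[OF js M(1,2,4)]
  show "col_mv Minus i js \<in> columns r" using M by simp
  show "col_u i (col_mv Minus i js) = -1" unfolding M(3) col_u_m1 occ using two_steps by simp
  have "col_e i (js[s := js ! s + 1]) = js[s := js ! s + 1] ! s - 1 - 2 * int s"
    unfolding col_e_def occ box'(1) using two_steps by simp
  then show "col_e i (col_mv Minus i js) = col_e i js"
    using M js by (simp add: columns_length[OF js])
  show "col_mv Plus i (col_mv Minus i js) = js"
    unfolding M(3) using M(1) js by (simp add: col_mv_def box'(1) columns_length[OF js])
qed

lemma Plus_properties:
  assumes js: "js \<in> columns r" and u: "col_u (i :: 'n mod_ring) js = -1"
  shows "col_mv Plus i js \<in> columns r" "col_u i (col_mv Plus i js) = 1" "col_mv Minus i (col_mv Plus i js) = js"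
proof -
  define s where "s = box (i + 1) js"
  have o: "\<not> occ i js" "occ (i + 1) js" using u col_u_m1 by auto
  have s: "s \<le> r" "of_int (js ! s) = i + 1" using box[OF js o(2)] by (simp_all add: s_def)
  define js' where "js' = js[s := js ! s - 1]"
  have js': "js' \<in> columns r" unfolding js'_def using lower_column[OF js s(1)] o s by simp
  have mv: "col_mv Plus i js = js'" by (simp add: col_mv_def js'_def s_def)
  have i: "of_int (js' ! s) = i" using s js by (simp add: js'_def columns_length[OF js])
  have back': "js'[s := js' ! s + 1] = js" using s js by (simp add: js'_def columns_length[OF js])
  have bx: "box i js' = s" by (rule box_eq[OF js' s(1) i])
  have "occ i js'" using occ_of_int[OF js' s(1)] i by metis
  moreover have "\<not> occ (i + 1) js'" using raised_free[OF js' s(1)] i back' js by simp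
  ultimately show "col_u i (col_mv Plus i js) = 1" unfolding mv col_u_1 by simp
  show "col_mv Plus i js \<in> columns r" using mv js' by simp
  show "col_mv Minus i (col_mv Plus i js) = js" unfolding mv using back' by (simp add: col_mv_def bx)
qed

lemma raise_is_move:
  assumes js: "js \<in> columns r" and s: "s \<le> r" and js': "js[s := js ! s + 1] \<in> columns r"
  shows "col_u (of_int (js ! s) :: 'n mod_ring) js = 1"
    "col_mv Minus (of_int (js ! s) :: 'n mod_ring) js = js[s := js ! s + 1]"
proof -
  show "col_u (of_int (js ! s) :: 'n mod_ring) js = 1"
    unfolding col_u_1 using raised_free[OF js s js'] occ_of_int[OF js s] by simp
  show "col_mv Minus (of_int (js ! s) :: 'n mod_ring) js = js[s := js ! s + 1]"
    using box_eq[OF js s refl] by (simp add: col_mv_def)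
qed

text \<open>The move carries a box from the class i to i + 1. For j = i + 1 the alternatives are
  decided by whether the class i + 2 is occupied, for j = i - 1 by whether i - 1 is. Where two boxes
  have to be compared, \<open>neighbour\<close> at distance 2 respectively 1 relates their
  parameters.\<close>

lemma adjacent_column:
  assumes js: "js \<in> columns r" and u: "col_u (i :: 'n mod_ring) js = 1" and j: "j = i + 1 \<or> j = i - 1"
  shows "col_u j js = 0 \<and> col_u j (col_mv Minus i js) = 1 \<and> col_e j (col_mv Minus i js) = col_e i js + 1 \<or>
         col_u j js = -1 \<and> col_u j (col_mv Minus i js) = 0 \<and> col_e j js = col_e i js - 1"
proof -
  define s where "s = box i js"
  note M = col_mv_Minus[OF js u, folded s_def]
  define js' where "js' = js[s := js ! s + 1]"
  note occ = occ_raise[OF js M(1,2,4), folded js'_def] and box' = box_raise[OF js M(1,2,4), folded js'_def]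
  have oi: "occ i js" using u unfolding col_u_1 by simp
  have nth': "js' ! s = js ! s + 1" "x \<noteq> s \<Longrightarrow> js' ! x = js ! x" for x
    using M(1) js by (simp_all add: js'_def columns_length[OF js])
  from j show ?thesis
  proof
    assume j: "j = i + 1"
    show ?thesis
    proof (cases "occ (i + 1 + 1) js")
      case False
      then have "col_u j js = 0" "col_u j js' = 1" "col_e j js' = js' ! s - 2 * int s"
        unfolding j col_u_def col_e_def occ box'(1) using M(6) two_steps[of i] by simp_all
      then show ?thesis using M nth' by (simp add: js'_def)
    next
      case True
      let ?s' = "box (i + 1 + 1) js"
      have "js ! ?s' - 2 * int ?s' = js ! s - 2 * int s + 2 - 2"
      proof (rule neighbour[OF js M(1)])
        show "of_int (js ! box (i + 1 + 1) js) = (of_int (js ! s + 2) :: 'n mod_ring)"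
          using box[OF js True] M(2) by (simp add: add.assoc)
        show "\<not> occ (of_int (js ! s + d') :: 'n mod_ring) js" if "0 < d'" "d' < 2" for d'
        proof -
          have "d' = 1" using that by simp
          then show ?thesis using M(2,6) by simp
        qed
      qed (use box[OF js True] r in auto)
      moreover have "col_u j js = -1" "col_u j js' = 0" "col_e j js = js ! ?s' - 1 - 2 * int ?s'"
        unfolding j col_u_def col_e_def occ using M(6) two_steps[of i] True by simp_all
      ultimately show ?thesis using M by (simp add: js'_def)
    qed
  next
    assume j: "j = i - 1"
    have j1: "j + 1 = i" "j \<noteq> i" "j \<noteq> i + 1" "i \<noteq> i + 1" using j two_steps[of i] by auto
    show ?thesis
    proof (cases "occ j js")
      case False
      then have "col_u j js = -1" "col_u j js' = 0" "col_e j js = js ! s - 1 - 2 * int s"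
        unfolding col_u_def col_e_def j1(1) occ using j1 oi by (simp_all add: s_def)
      then show ?thesis using M by (simp add: js'_def)
    next
      case True
      let ?s' = "box j js"
      have "js ! s - 2 * int s = js ! ?s' - 2 * int ?s' + 1 - 2"
      proof (rule neighbour[OF js])
        show "(of_int (js ! s) :: 'n mod_ring) = of_int (js ! box j js + 1)"
          using box[OF js True] M(2) j1(1) by simp
      qed (use box[OF js True] r M(1) in auto)
      moreover have "col_u j js = 0" "col_u j js' = 1" "col_e j js' = js' ! ?s' - 2 * int ?s'"
        unfolding col_u_def col_e_def j1(1) occ using j1 oi True box'(2)[of j] by simp_all
      moreover have "js' ! ?s' = js ! ?s'" using nth'(2) box'(3)[of j] j1 True by simp
      ultimately show ?thesis using M by (simp add: js'_def)
    qed
  qed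
qed

lemma far_column:
  assumes js: "js \<in> columns r" and u: "col_u (i :: 'n mod_ring) js = 1" and j: "j \<noteq> i" "j \<noteq> i + 1" "j \<noteq> i - 1"
  shows "col_u j (col_mv Minus i js) = col_u j js \<and> col_e j (col_mv Minus i js) = col_e j js"
    "occ j js \<Longrightarrow> box j (col_mv Minus i js) = box j js \<and> col_mv Minus i js ! box j js = js ! box j js"
proof -
  define s where "s = box i js"
  note M = col_mv_Minus[OF js u, folded s_def]
  note occ = occ_raise[OF js M(1,2,4)] and box' = box_raise[OF js M(1,2,4)]
  have j': "j + 1 \<noteq> i" "j + 1 \<noteq> i + 1" using j by auto
  show "occ j js \<Longrightarrow> box j (col_mv Minus i js) = box j js \<and> col_mv Minus i js ! box j js = js ! box j js"
    unfolding M(3) using box'(2,3)[of j] j by simp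
  have "col_u j (js[s := js ! s + 1]) = col_u j js"
    unfolding col_u_def occ using j j' by simp
  moreover have "col_e j (js[s := js ! s + 1]) = col_e j js"
    unfolding col_e_def occ using j j' box'(2,3)[of j] box'(2,3)[of "j + 1"]
    by (cases "occ j js"; cases "occ (j + 1) js") auto
  ultimately show "col_u j (col_mv Minus i js) = col_u j js \<and> col_e j (col_mv Minus i js) = col_e j js"
    unfolding M(3) by simp
qed

lemma commute_column:
  assumes js: "js \<in> columns r" and u: "col_u (i :: 'n mod_ring) js = 1" "col_u j js = 1" and j: "j \<noteq> i" "j \<noteq> i + 1" "j \<noteq> i - 1"
  shows "col_mv Minus i (col_mv Minus j js) = col_mv Minus j (col_mv Minus i js)"
proof -
  have j': "i \<noteq> j" "i \<noteq> j + 1" "i \<noteq> j - 1" using j by auto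
  have o: "occ i js" "occ j js" using u col_u_1 by auto
  have "box i js \<noteq> box j js" using box[OF js o(1)] box[OF js o(2)] j by auto
  moreover have "col_mv Minus i (col_mv Minus j js) = (col_mv Minus j js)[box i js := js ! box i js + 1]"
    unfolding col_mv_def[of Minus i] using far_column(2)[OF js u(2) j' o(1)] by simp
  moreover have "col_mv Minus j (col_mv Minus i js) = (col_mv Minus i js)[box j js := js ! box j js + 1]"
    unfolding col_mv_def[of Minus j] using far_column(2)[OF js u(1) j o(2)] by simp
  ultimately show ?thesis by (simp add: col_mv_def list_update_swap)
qed

text \<open>The period 2r + 2 is even, so parity is well defined on residue classes; here the
  hypothesis that n is odd enters the bookkeeping of exponents.\<close>

lemma even_card_dvd: "(of_int x :: 'n mod_ring) = of_int y \<Longrightarrow> even (x - y)"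
proof -
  assume "(of_int x :: 'n mod_ring) = of_int y"
  then have "2 * (int r + 1) dvd x - y" by (simp add: of_int_eq_iff_dvd)
  then show "even (x - y)" by (rule dvd_mult_left)
qed

lemma col_e_parity:
  assumes js: "js \<in> columns r"
  shows "even (col_e (i :: 'n mod_ring) js - to_int_mod_ring i)"
proof -
  have "even (x - 2 * y - to_int_mod_ring i)" if "of_int x = i" for x y
    using even_card_dvd[of x "to_int_mod_ring i"] that by simp
  from this[of "js ! box i js"] this[of "js ! box (i + 1) js - 1"] show ?thesis
    using box(2)[OF js, of i] box(2)[OF js, of "i + 1"] by (simp add: col_e_def)
qed

lemma to_int_parity: "odd (to_int_mod_ring (i + 1 :: 'n mod_ring) - to_int_mod_ring i)"
  using even_card_dvd[of "to_int_mod_ring (i + 1)" "to_int_mod_ring i + 1"] by simp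


section \<open>Reconstruction of a column from its weights and parameters\<close>

lemma class_offset: "\<exists>m. (l :: 'n mod_ring) = i + of_nat m"
proof -
  have "0 \<le> to_int_mod_ring (l - i)" using range_to_int_mod_ring[where ?'a = 'n] by (metis atLeastLessThan_iff rangeI)
  then have "of_nat (nat (to_int_mod_ring (l - i))) = l - i"
    by (metis of_int_of_nat_eq of_int_to_int_mod_ring nat_0_le)
  then show ?thesis by (metis add_diff_cancel_left' diff_add_cancel add.commute)
qed

text \<open>Otherwise occupancy would propagate from class to class around the whole cycle, but r +
  1 boxes cannot fill 2r + 2 classes.\<close>

lemma exists_top:
  assumes js: "js \<in> columns r"
  obtains i :: "'n mod_ring" where "occ i js" "\<not> occ (i + 1) js"
proof (rule ccontr)
  note witness = that
  assume "\<not> thesis"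
  then have step: "occ (i + 1) js" if "occ i js" for i :: "'n mod_ring" using witness that by blast
  have "occ (of_int (js ! 0) + of_nat m :: 'n mod_ring) js" for m
  proof (induction m)
    case 0
    then show ?case using occ_nth[OF js, of 0] by simp
  next
    case (Suc m)
    then show ?case using step[of "of_int (js ! 0) + of_nat m"] by (simp add: algebra_simps)
  qed
  then have "occ i js" for i :: "'n mod_ring" using class_offset[of i "of_int (js ! 0)"] by metis
  then have "(UNIV :: 'n mod_ring set) \<subseteq> of_int ` set js" by (auto simp: occ_def)
  then have "CARD('n mod_ring) \<le> card (of_int ` set js :: 'n mod_ring set)" by (intro card_mono) auto
  also have "\<dots> \<le> length js" by (meson card_image_le card_length finite_set le_trans)
  finally show False using card_n columns_length[OF js] by simp
qed

text \<open>The part of the periodic continuation strictly between the box s and its translate.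
  Being strictly increasing, this list is determined by its set, hence by the occupied classes and
  the value at s.\<close>

lemma periodic_tail:
  assumes js: "js \<in> columns r" and s: "s \<le> r"
  shows "sorted_wrt (<) (drop (s + 1) js @ map (\<lambda>x. x + (2 * int r + 2)) (take s js))"
    and "set (drop (s + 1) js @ map (\<lambda>x. x + (2 * int r + 2)) (take s js))
      = {x. js ! s < x \<and> x < js ! s + (2 * int r + 2) \<and> occ (of_int x :: 'n mod_ring) js}"
proof -
  let ?N = "2 * int r + 2"
  let ?L = "drop (s + 1) js @ map (\<lambda>x. x + ?N) (take s js)"
  have sorted: "sorted_wrt (<) js" using js by (simp add: columns_def)
  have len: "length js = r + 1" using columns_length[OF js] .
  have "x < y + ?N" if "x \<in> set js" "y \<in> set js" for x y
  proof -
    have *: "\<exists>s\<le>r. z = js ! s" if "z \<in> set js" for z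
      using that len by (auto simp: in_set_conv_nth less_Suc_eq_le)
    then obtain s1 s2 where "s1 \<le> r" "s2 \<le> r" "x = js ! s1" "y = js ! s2"
      using *[OF \<open>x \<in> set js\<close>] *[OF \<open>y \<in> set js\<close>] by blast
    then show ?thesis using columns_span[OF js, of s2 s1] by simp
  qed
  then have "x < y + ?N" if "x \<in> set (drop (s + 1) js)" "y \<in> set (take s js)" for x y
    using that in_set_dropD in_set_takeD by metis
  then show "sorted_wrt (<) ?L"
    using sorted_wrt_drop[OF sorted] sorted_wrt_take[OF sorted]
    by (auto simp: sorted_wrt_append sorted_wrt_map)
  have mem: "x \<in> set ?L \<longleftrightarrow> (\<exists>s'\<le>r. (s < s' \<and> x = js ! s') \<or> (s' < s \<and> x = js ! s' + ?N))" for x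
  proof -
    have "x \<in> set (drop (s + 1) js) \<longleftrightarrow> (\<exists>s'\<le>r. s < s' \<and> x = js ! s')"
    proof
      assume "x \<in> set (drop (s + 1) js)"
      then obtain i where "i < length js - (s + 1)" "x = js ! (s + 1 + i)" using s len by (auto simp: in_set_conv_nth)
      then show "\<exists>s'\<le>r. s < s' \<and> x = js ! s'" using len by (intro exI[of _ "s + 1 + i"]) auto
    next
      assume "\<exists>s'\<le>r. s < s' \<and> x = js ! s'"
      then obtain s' where "s' \<le> r" "s < s'" "x = js ! s'" by blast
      then show "x \<in> set (drop (s + 1) js)" using len
        by (auto simp: in_set_conv_nth intro!: exI[of _ "s' - (s + 1)"])
    qed
    moreover have "x \<in> set (map (\<lambda>x. x + ?N) (take s js)) \<longleftrightarrow> (\<exists>s'\<le>r. s' < s \<and> x = js ! s' + ?N)"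
      using s len by (auto simp: in_set_conv_nth image_iff Bex_def) (metis nth_take less_imp_le_nat le_trans)+
    ultimately show ?thesis by auto
  qed
  show "set ?L = {x. js ! s < x \<and> x < js ! s + ?N \<and> occ (of_int x :: 'n mod_ring) js}"
  proof (rule Set.set_eqI)
    fix x
    show "x \<in> set ?L \<longleftrightarrow> x \<in> {x. js ! s < x \<and> x < js ! s + ?N \<and> occ (of_int x :: 'n mod_ring) js}"
    proof
      assume "x \<in> set ?L"
      then obtain s' where s': "s' \<le> r" "(s < s' \<and> x = js ! s') \<or> (s' < s \<and> x = js ! s' + ?N)" using mem by blast
      have "(of_int x :: 'n mod_ring) = of_int (js ! s')"
        using s'(2) by (subst of_int_eq_iff_dvd) auto
      then have "occ (of_int x :: 'n mod_ring) js" using occ_nth[OF js s'(1)] by simp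
      then show "x \<in> {x. js ! s < x \<and> x < js ! s + ?N \<and> occ (of_int x :: 'n mod_ring) js}"
        using s' columns_less[OF js, of s s'] columns_less[OF js, of s' s] columns_span[OF js s s'(1)] columns_span[OF js s'(1) s] s
        by auto
    next
      assume "x \<in> {x. js ! s < x \<and> x < js ! s + ?N \<and> occ (of_int x :: 'n mod_ring) js}"
      then have x: "js ! s < x" "x < js ! s + ?N" "occ (of_int x :: 'n mod_ring) js" by auto
      then obtain s' where s': "s' \<le> r" "(of_int (js ! s') :: 'n mod_ring) = of_int x" using occ_iff[OF js] by blast
      have b: "js ! s' - js ! s < ?N" "js ! s - js ! s' < ?N" using columns_span[OF js s s'(1)] columns_span[OF js s'(1) s] by auto
      have dv: "?N dvd js ! s' - x" using s'(2) of_int_eq_iff_dvd by blast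
      have dv': "?N dvd js ! s' - x + ?N" using dvd_add[OF dv dvd_refl] .
      consider "s < s'" | "s' < s" | "s' = s" by linarith
      then have "(s < s' \<and> x = js ! s') \<or> (s' < s \<and> x = js ! s' + ?N)"
      proof cases
        case 1
        then have "js ! s < js ! s'" using columns_less[OF js] s' by simp
        then have "\<bar>js ! s' - x\<bar> < ?N" using x b by (simp add: abs_less_iff)
        then show ?thesis using multiple_less_imp_zero[OF dv] 1 by simp
      next
        case 2
        then have "js ! s' < js ! s" using columns_less[OF js] s by simp
        then have "\<bar>js ! s' - x + ?N\<bar> < ?N" using x b by (simp add: abs_less_iff)
        then show ?thesis using multiple_less_imp_zero[OF dv'] 2 by simp
      next
        case 3
        then have "\<bar>js ! s' - x\<bar> < ?N" using x by (simp add: abs_less_iff)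
        then show ?thesis using multiple_less_imp_zero[OF dv] 3 x by simp
      qed
      then show "x \<in> set ?L" using mem s'(1) by blast
    qed
  qed
qed

text \<open>The weights are differences of occupancies of successive classes, so they determine all
  occupancies from one known class. At a class i with weight 1 the parameter then fixes both the
  value and the position of its box, and \<open>periodic_tail\<close> yields the rest.\<close>

lemma separation_column:
  assumes js: "js \<in> columns r" "js' \<in> columns r"
    and u: "\<And>i :: 'n mod_ring. col_u i js = col_u i js'"
    and e: "\<And>i :: 'n mod_ring. col_u i js \<noteq> 0 \<Longrightarrow> col_e i js = col_e i js'"
  shows "js = js'"
proof -
  let ?N = "2 * int r + 2"
  obtain i :: "'n mod_ring" where i: "occ i js" "\<not> occ (i + 1) js" using exists_top[OF js(1)] .
  have "col_u i js = 1" using i by (simp add: col_u_def)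
  then have i': "occ i js'" using u col_u_1 by metis
  have "occ (i + of_nat m) js = occ (i + of_nat m) js'" for m
  proof (induction m)
    case 0
    then show ?case using i i' by simp
  next
    case (Suc m)
    have "col_u (i + of_nat m) js = col_u (i + of_nat m) js'" by (rule u)
    then have "occ (i + of_nat m + 1) js = occ (i + of_nat m + 1) js'"
      using Suc by (simp add: col_u_def of_bool_def split: if_splits)
    then show ?case by (simp add: algebra_simps)
  qed
  then have occ: "occ l js = occ l js'" for l :: "'n mod_ring" using class_offset[of l i] by metis
  define s s' where "s = box i js" and "s' = box i js'"
  have s: "s \<le> r" "of_int (js ! s) = i" "s' \<le> r" "of_int (js' ! s') = i"
    using box[OF js(1) i(1)] box[OF js(2) i'] by (simp_all add: s_def s'_def)
  have eq: "js ! s - 2 * int s = js' ! s' - 2 * int s'"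
    using e[of i] \<open>col_u i js = 1\<close> i i' by (simp add: col_e_def s_def s'_def)
  have "?N dvd js ! s - js' ! s'" using s of_int_eq_iff_dvd by metis
  \<comment> \<open>By \<open>eq\<close> the difference is twice a difference of positions, hence at
    most 2r in absolute value; being divisible by the period it vanishes.\<close>
  moreover have "\<bar>js ! s - js' ! s'\<bar> < ?N" using eq s(1,3) by (simp add: abs_less_iff)
  ultimately have v: "js ! s = js' ! s'" using multiple_less_imp_zero by fastforce
  then have ss: "s' = s" using eq by simp
  have "drop (s + 1) js @ map (\<lambda>x. x + ?N) (take s js) = drop (s + 1) js' @ map (\<lambda>x. x + ?N) (take s js')"
    using periodic_tail[OF js(1) s(1)] periodic_tail[OF js(2) s(1)] v ss occ
    by (intro strict_sorted_equal) simp_all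
  then have dt: "drop (s + 1) js = drop (s + 1) js'" "map (\<lambda>x. x + ?N) (take s js) = map (\<lambda>x. x + ?N) (take s js')"
    using columns_length[OF js(1)] columns_length[OF js(2)] by (simp_all add: append_eq_append_conv)
  have "inj (\<lambda>x. x + ?N)" by (simp add: inj_def)
  with dt(2) have "take s js = take s js'" using inj_map_eq_map by blast
  then show ?thesis
    using id_take_nth_drop[of s js] id_take_nth_drop[of s js'] dt(1) v ss s(1) columns_length[OF js(1)] columns_length[OF js(2)]
    by simp
qed

section \<open>Connectedness of the set of columns and the blocks cut out by a node\<close>

definition packed :: "int \<Rightarrow> nat \<Rightarrow> int list" where
  "packed m n = map (\<lambda>s. m + int s + (if s < n then 0 else 1)) [0..<r + 1]"

lemma packed_columns: "packed m n \<in> columns r"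
  using r by (auto simp: columns_iff packed_def simp del: upt_Suc)

text \<open>Membership in S is invariant under raising or lowering a box. Lowering boxes closes all
  gaps and reduces a column to the interval that starts at its first entry. The interval starting at
  m is connected to the one starting at m + 1 through the \<open>packed m n\<close>, in which the
  boxes from position n on have already been raised.\<close>

lemma connected_columns:
  assumes S: "S \<subseteq> columns r" "S \<noteq> {}"
    and closed: "\<And>\<epsilon> (i :: 'n mod_ring) js. js \<in> S \<Longrightarrow> col_u i js = - sg \<epsilon> \<Longrightarrow> col_mv \<epsilon> i js \<in> S"
  shows "S = columns r"
proof -
  have raise: "js \<in> S \<longleftrightarrow> js[s := js ! s + 1] \<in> S"
    if js: "js \<in> columns r" "js[s := js ! s + 1] \<in> columns r" "s \<le> r" for js s
  proof -
    let ?i = "of_int (js ! s) :: 'n mod_ring"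
    note mv = raise_is_move[OF js(1,3,2)]
    note M = Minus_properties[OF js(1) mv(1), unfolded mv(2)]
    show ?thesis
    proof
      show "js \<in> S \<Longrightarrow> js[s := js ! s + 1] \<in> S" using closed[of js ?i Minus] mv by simp
      show "js[s := js ! s + 1] \<in> S \<Longrightarrow> js \<in> S"
        using closed[of "js[s := js ! s + 1]" ?i Plus] M by simp
    qed
  qed
  have pack: "js \<in> S \<longleftrightarrow> packed (js ! 0) (r + 1) \<in> S" if "js \<in> columns r" for js
    using that
  proof (induction "nat (\<Sum>s\<le>r. js ! s - js ! 0)" arbitrary: js rule: less_induct)
    case less
    note js = less.prems
    have len: "length js = r + 1" using columns_length[OF js] .
    show ?case
    proof (cases "\<exists>s. s < r \<and> js ! s + 1 \<noteq> js ! (s + 1)")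
      case False
      then have step: "js ! s + 1 = js ! (s + 1)" if "s < r" for s using that by blast
      have *: "js ! s = js ! 0 + int s" if "s \<le> r" for s
        using that
      proof (induction s)
        case (Suc s)
        then show ?case using step[of s] by simp
      qed simp
      have **: "js ! s = packed (js ! 0) (r + 1) ! s" if "s < length js" for s
      proof -
        have "s \<le> r" using that len by simp
        then show ?thesis unfolding *[OF \<open>s \<le> r\<close>] by (simp add: packed_def del: upt_Suc)
      qed
      have "length js = length (packed (js ! 0) (r + 1))" using len by (simp add: packed_def)
      then have "js = packed (js ! 0) (r + 1)" using ** by (rule nth_equalityI)
      then show ?thesis by simp
    next
      case True
      then obtain s where s: "s < r" "js ! s + 1 \<noteq> js ! (s + 1)" by blast
      then have gap: "js ! s + 1 < js ! (s + 1)" using columns_less[OF js, of s "s + 1"] by simp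
      \<comment> \<open>The box just above the gap moves down; the total distance to the first box
        decreases, while the first box stays in place.\<close>
      define js' where "js' = js[s + 1 := js ! (s + 1) - 1]"
      have nth': "js' ! x = (if x = s + 1 then js ! x - 1 else js ! x)" if "x \<le> r" for x
        using len s that by (auto simp: js'_def nth_list_update)
      have "js' ! x < js' ! y" if "x < y" "y \<le> r" for x y
      proof -
        have "js ! x < js ! y" using columns_less[OF js that] .
        moreover have "js ! x \<le> js ! s" if "y = s + 1" using columns_mono[OF js, of x s] \<open>x < y\<close> that s by simp
        ultimately show ?thesis using nth'[of x] nth'[of y] that gap by auto
      qed
      moreover have "js' ! r - js' ! 0 \<le> 2 * int r + 1" using nth'[of r] nth'[of 0] columns_span[OF js, of 0 r] s by auto
      ultimately have js': "js' \<in> columns r" using len by (simp add: columns_iff js'_def)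
      have back': "js'[s + 1 := js' ! (s + 1) + 1] = js" using len s by (simp add: js'_def)
      have "(\<Sum>x\<le>r. js' ! x - js' ! 0) < (\<Sum>x\<le>r. js ! x - js ! 0)"
        using s nth' by (intro sum_strict_mono_ex1) auto
      moreover have "0 \<le> (\<Sum>x\<le>r. js' ! x - js' ! 0)" using columns_mono[OF js', of 0] by (intro sum_nonneg) simp
      ultimately have "js' \<in> S \<longleftrightarrow> packed (js' ! 0) (r + 1) \<in> S" using js' by (intro less.hyps) auto
      moreover have "js' ! 0 = js ! 0" using nth'[of 0] by simp
      moreover have "js' \<in> S \<longleftrightarrow> js \<in> S" using raise[OF js', of "s + 1"] back' js s by simp
      ultimately show ?thesis by simp
    qed
  qed
  have shift: "packed m (r + 1) \<in> S \<longleftrightarrow> packed (m + 1) (r + 1) \<in> S" for m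
  proof -
    have "packed m n \<in> S \<longleftrightarrow> packed m (r + 1) \<in> S" if "n \<le> r + 1" for n
      using that
    proof (induction rule: inc_induct)
      case (step n)
      have "(packed m (Suc n))[n := packed m (Suc n) ! n + 1] = packed m n"
        using step by (intro nth_equalityI) (auto simp: packed_def nth_list_update simp del: upt_Suc)
      then show ?case using raise[of "packed m (Suc n)" n] packed_columns[of m] step by simp
    qed simp
    from this[of 0] have "packed m 0 \<in> S \<longleftrightarrow> packed m (r + 1) \<in> S" by simp
    moreover have "packed m 0 = packed (m + 1) (r + 1)"
      by (intro nth_equalityI) (auto simp: packed_def simp del: upt_Suc)
    ultimately show ?thesis by simp
  qed
  obtain js where "js \<in> S" using S by blast
  then have "packed (js ! 0) (r + 1) \<in> S" using pack S by blast
  then have "packed m (r + 1) \<in> S" for m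
  proof (induction m rule: int_induct[of _ "js ! 0"])
    case (step1 i)
    then show ?case using shift by simp
  next
    case (step2 i)
    then show ?case using shift[of "i - 1"] by simp
  qed simp
  then show ?thesis using pack S by blast
qed

text \<open>The integers of class j cut \<int> into blocks of one period, and a box can pass from
  one block to the next only by a move along j. Keeping each box in its block leaves finitely many
  columns.\<close>

lemma vertical_columns:
  assumes js: "js \<in> columns r"
  shows "\<exists>S. finite S \<and> js \<in> S \<and> S \<subseteq> columns r \<and>
    (\<forall>\<epsilon> i. \<forall>js'\<in>S. i \<noteq> (j :: 'n mod_ring) \<longrightarrow> col_u i js' = - sg \<epsilon> \<longrightarrow> col_mv \<epsilon> i js' \<in> S)"
proof -
  let ?N = "2 * int r + 2"
  define j0 where "j0 = to_int_mod_ring j"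
  have j0: "of_int j0 = j" by (simp add: j0_def)
  \<comment> \<open>The block with number b runs from j0 + 1 + N b to j0 + N (b + 1), where N is the
    period, and ends in an integer of class j; so adding 1 leaves the block exactly from
    there.\<close>
  define blk where "blk x = (x - j0 - 1) div ?N" for x
  have blk: "blk (x + 1) = blk x" if "(of_int x :: 'n mod_ring) \<noteq> j" for x
  proof -
    have "\<not> ?N dvd x - j0" using that of_int_eq_iff_dvd[of x j0] j0 by simp
    then have "(x - j0) mod ?N \<noteq> 0" by (simp add: dvd_eq_mod_eq_0)
    moreover have "0 \<le> (x - j0) mod ?N" "(x - j0) mod ?N < ?N" by simp_all
    ultimately have "0 \<le> (x - j0) mod ?N - 1" "(x - j0) mod ?N - 1 < ?N" by linarith+
    moreover have "x - j0 - 1 = ?N * ((x - j0) div ?N) + ((x - j0) mod ?N - 1)"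
      using mult_div_mod_eq[of ?N "x - j0"] by linarith
    ultimately have "(x - j0 - 1) div ?N = (x - j0) div ?N"
      by (metis int_div_pos_eq)
    then show ?thesis by (simp add: blk_def)
  qed
  define S where "S = {js' \<in> columns r. \<forall>s\<le>r. blk (js' ! s) = blk (js ! s)}"
  have "finite {x. blk x = b}" for b
  proof (rule finite_subset)
    show "{x. blk x = b} \<subseteq> {j0 + 1 + ?N * b..j0 + 1 + ?N * b + ?N}"
    proof
      fix x assume "x \<in> {x. blk x = b}"
      then have "x - j0 - 1 = ?N * b + (x - j0 - 1) mod ?N" using mult_div_mod_eq[of ?N "x - j0 - 1"] by (simp add: blk_def)
      moreover have "0 \<le> (x - j0 - 1) mod ?N" "(x - j0 - 1) mod ?N < ?N" by simp_all
      ultimately show "x \<in> {j0 + 1 + ?N * b..j0 + 1 + ?N * b + ?N}" by (simp only: atLeastAtMost_iff) linarith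
    qed
  qed simp
  then have fin: "finite (\<Union>s\<le>r. {x. blk x = blk (js ! s)})" by simp
  have "S \<subseteq> {js'. set js' \<subseteq> (\<Union>s\<le>r. {x. blk x = blk (js ! s)}) \<and> length js' = r + 1}"
  proof (intro subsetI CollectI conjI)
    fix js' assume js': "js' \<in> S"
    then show len: "length js' = r + 1" using columns_length by (simp add: S_def)
    fix x assume "x \<in> set js'"
    then obtain s where "s \<le> r" "x = js' ! s" using len by (auto simp: in_set_conv_nth less_Suc_eq_le)
    then show "x \<in> (\<Union>s\<le>r. {x. blk x = blk (js ! s)})" using js' by (auto simp: S_def)
  qed
  then have finS: "finite S" using finite_lists_length_eq[OF fin] by (rule finite_subset)
  have S: "js \<in> S" "S \<subseteq> columns r" using js by (auto simp: S_def)
  have "col_mv \<epsilon> i js' \<in> S" if js': "js' \<in> S" and ij: "i \<noteq> j" and u: "col_u i js' = - sg \<epsilon>" for \<epsilon> i js'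
  proof -
    have c: "js' \<in> columns r" and b: "\<And>s. s \<le> r \<Longrightarrow> blk (js' ! s) = blk (js ! s)" using js' by (auto simp: S_def)
    have raised: "blk (js1[s := js1 ! s + 1] ! s') = blk (js1 ! s')"
      if "js1 \<in> columns r" "s \<le> r" "of_int (js1 ! s) = i" for js1 s s'
      using that blk[of "js1 ! s"] ij by (cases "s' = s") (simp_all add: columns_length[OF that(1)])
    show ?thesis
    proof (cases \<epsilon>)
      case Minus
      then have u1: "col_u i js' = 1" using u by simp
      note M = col_mv_Minus[OF c u1]
      show ?thesis using M(4) raised[OF c M(1,2)] b unfolding Minus M(3) by (simp add: S_def)
    next
      case Plus
      then have u1: "col_u i js' = -1" using u by simp
      note P = Plus_properties[OF c u1]
      note M = col_mv_Minus[OF P(1,2)]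
      have "blk (js' ! s') = blk (col_mv Plus i js' ! s')" for s'
        using raised[OF P(1) M(1,2), of s'] P(3) unfolding M(3) by simp
      then show ?thesis using P(1) b unfolding Plus by (simp add: S_def)
    qed
  qed
  then show ?thesis using finS S by (intro exI[of _ S] conjI allI ballI impI)
qed

section \<open>Weights of columns and the axioms of the abstract model\<close>

lemma col_wt_mv:
  assumes js: "js \<in> columns r" and u: "col_u (i :: 'n mod_ring) js = 1"
  shows "col_wt (col_mv Minus i js) x = col_wt js x - simple_root i x"
proof -
  define s where "s = box i js"
  note M = col_mv_Minus[OF js u, folded s_def]
  have len: "s < length js" using M(1) columns_length[OF js] by simp
  have "col_wt (js[s := js ! s + 1]) x = box_weight (js ! s + 1) x + (\<Sum>s'\<in>{..<length js} - {s}. box_weight (js ! s') x)"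
    unfolding col_wt_def using len by (subst sum.remove[of _ s]) (auto intro!: sum.cong)
  moreover have "col_wt js x = box_weight (js ! s) x + (\<Sum>s'\<in>{..<length js} - {s}. box_weight (js ! s') x)"
    unfolding col_wt_def using len by (subst sum.remove[of _ s]) auto
  ultimately show ?thesis unfolding M(3) box_weight_Suc M(2) by simp
qed

text \<open>Both sides lose the value of a simple root when j increases by 1, so the value at j = 1
  propagates in both directions.\<close>

lemma box_weight_Some:
  "box_weight j (Some (i :: 'n mod_ring)) = of_bool (i = of_int j) - of_bool (i = of_int j - 1)"
proof -
  have step: "box_weight (j + 1) (Some i) = of_bool (i = of_int (j + 1)) - of_bool (i = of_int (j + 1) - 1) \<longleftrightarrow>
    box_weight j (Some i) = of_bool (i = of_int j) - of_bool (i = of_int j - 1)" for j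
  proof -
    define l where "l = (of_int j :: 'n mod_ring)"
    have "simple_root l (Some i) = of_bool (i = l) - of_bool (i = l - 1) - (of_bool (i = l + 1) - of_bool (i = l))"
      using two_steps[of l] two_steps[of i] mod_ring_shift[of i l] by (auto simp: simple_root_def cartan_matrix_def)
    then show ?thesis unfolding box_weight_Suc l_def[symmetric] by (auto simp: l_def)
  qed
  show ?thesis
  proof (induction j rule: int_induct[of _ 1])
    case base
    show ?case by (simp add: box_weight_def varpi_def fund_weight_def)
  next
    case (step1 j)
    then show ?case using step by blast
  next
    case (step2 j)
    then show ?case using step[of "j - 1"] by simp
  qed
qed

lemma sum_class:
  assumes js: "js \<in> columns r"
  shows "(\<Sum>s<r + 1. of_bool ((i :: 'n mod_ring) = of_int (js ! s)) :: rat) = of_bool (occ i js)"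
proof (cases "occ i js")
  case True
  note b = box[OF js True]
  have "(i = of_int (js ! s)) = (s = box i js)" if "s \<le> r" for s using b box_eq[OF js that, of i] by auto
  then have "(\<Sum>s<r + 1. of_bool (i = of_int (js ! s)) :: rat) = (\<Sum>s<r + 1. if s = box i js then 1 else 0)"
    by (intro sum.cong) (auto simp: less_Suc_eq_le)
  then show ?thesis using b True by simp
next
  case False
  then have "i \<noteq> of_int (js ! s)" if "s \<le> r" for s using occ_nth[OF js that] by blast
  then have "(\<Sum>s<r + 1. of_bool (i = of_int (js ! s)) :: rat) = 0" by (intro sum.neutral) auto
  then show ?thesis using False by simp
qed

lemma col_wt_Some:
  assumes js: "js \<in> columns r"
  shows "col_wt js (Some (i :: 'n mod_ring)) = of_int (col_u i js)"
proof -
  have eq: "i = l - 1 \<longleftrightarrow> i + 1 = l" for l :: "'n mod_ring" by auto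
  have "col_wt js (Some i) = (\<Sum>s<r + 1. of_bool (i = of_int (js ! s))) - (\<Sum>s<r + 1. of_bool (i + 1 = of_int (js ! s)))"
    unfolding col_wt_def box_weight_Some sum_subtractf[symmetric] columns_length[OF js] eq ..
  then show ?thesis unfolding sum_class[OF js] by (simp add: col_u_def)
qed

sublocale column_system "columns r" "col_u :: 'n mod_ring \<Rightarrow> _" col_e col_mv col_wt
proof
  show "CARD('n) \<ge> 4" by (rule card_ge_4)
  fix js assume js: "js \<in> columns r"
  show "col_u i js \<in> {-1, 0, 1}" for i :: "'n mod_ring" by (simp add: col_u_def of_bool_def)
  show "even (col_e i js - col_e i js')" if "js' \<in> columns r" for js' and i :: "'n mod_ring"
    using col_e_parity[OF js, of i] col_e_parity[OF that, of i] by simp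
  show "odd (col_e (i + 1) js - col_e i js')" if "js' \<in> columns r" for js' and i :: "'n mod_ring"
    using col_e_parity[OF js, of "i + 1"] col_e_parity[OF that, of i] to_int_parity[of i] by simp
  have u: "col_u i js = 1 \<or> col_u i js = -1 \<and> \<epsilon> = Plus" "col_u i js = 1 \<Longrightarrow> \<epsilon> = Minus" if "col_u i js = - sg \<epsilon>" for i :: "'n mod_ring" and \<epsilon>
    using that by (cases \<epsilon>; simp)+
  fix i :: "'n mod_ring"
  show "col_mv \<epsilon> i js \<in> columns r" if "col_u i js = - sg \<epsilon>" for \<epsilon>
    using Minus_properties[OF js, of i] Plus_properties[OF js, of i] that by (cases \<epsilon>) auto
  show "col_u i (col_mv \<epsilon> i js) = sg \<epsilon>" if "col_u i js = - sg \<epsilon>" for \<epsilon>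
    using Minus_properties[OF js, of i] Plus_properties[OF js, of i] that by (cases \<epsilon>) auto
  show "col_e i (col_mv \<epsilon> i js) = col_e i js" if "col_u i js = - sg \<epsilon>" for \<epsilon>
    using Minus_properties[OF js, of i] Minus_properties[of "col_mv Plus i js" i] Plus_properties[OF js, of i] that by (cases \<epsilon>) auto
  show "col_mv (opp \<epsilon>) i (col_mv \<epsilon> i js) = js" if "col_u i js = - sg \<epsilon>" for \<epsilon>
    using Minus_properties[OF js, of i] Plus_properties[OF js, of i] that by (cases \<epsilon>) auto
next
  fix S :: "int list set"
  assume "S \<subseteq> columns r" "S \<noteq> {}" "\<And>\<epsilon> (i :: 'n mod_ring) c. c \<in> S \<Longrightarrow> col_u i c = - sg \<epsilon> \<Longrightarrow> col_mv \<epsilon> i c \<in> S"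
  then show "S = columns r" by (rule connected_columns)
qed (fact adjacent_column far_column(1) commute_column separation_column vertical_columns col_wt_Some col_wt_mv)+

end

section \<open>Identification of the column modules with the combinatorial model\<close>

lemma inj_on_times_const: "inj_on c A \<Longrightarrow> d \<noteq> 0 \<Longrightarrow> inj_on (\<lambda>s. c s * (d :: complex)) A"
  by (intro inj_onI) (auto dest: inj_onD)

lemma psi_nonzero: "psi t c \<noteq> 0"
  by (simp add: psi_def Zero_fract_def eq_fract)

context column_model
begin

lemma columns_basis: "basis (column_module t r a :: ('n mod_ring, int list) loop_data) = columns r"
  by (auto simp: column_module_def Vtilde_def restrict_basis_def tensor_def columns_def vector_rep_def card_n simp del: upt_Suc)

lemma column_wt:
  assumes js: "js \<in> columns r"
  shows "wt (column_module t r a :: ('n mod_ring, int list) loop_data) js = col_wt js"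
  using columns_length[OF js]
  by (auto simp: column_module_def Vtilde_def restrict_basis_def tensor_def vector_rep_def col_wt_def fun_eq_iff simp del: upt_Suc intro!: sum.cong)

lemma prod_class:
  fixes f :: "nat \<Rightarrow> 'x::comm_monoid_mult"
  assumes js: "js \<in> columns r"
  shows "(\<Prod>s<r + 1. if (i :: 'n mod_ring) = of_int (js ! s) then f s else 1) = (if occ i js then f (box i js) else 1)"
proof (cases "occ i js")
  case True
  note b = box[OF js True]
  have "(i = of_int (js ! s)) = (s = box i js)" if "s \<le> r" for s using b box_eq[OF js that, of i] by auto
  then have "(\<Prod>s<r + 1. if i = of_int (js ! s) then f s else 1) = (\<Prod>s<r + 1. if s = box i js then f s else 1)"
    by (intro prod.cong) (auto simp: less_Suc_eq_le)
  then show ?thesis using b True by simp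
next
  case False
  then have "i \<noteq> of_int (js ! s)" if "s \<le> r" for s using occ_nth[OF js that] by blast
  then have "(\<Prod>s<r + 1. if i = of_int (js ! s) then f s else 1) = 1" by (intro prod.neutral) auto
  then show ?thesis using False by simp
qed

text \<open>The product form, valid because i and i + 1 are distinct classes, lets a product over
  all boxes be split into one for the class i and one for the class i + 1.\<close>

lemma vector_rep_phi:
  "phi_eig (vector_rep t b :: ('n mod_ring, int) loop_data) i j
    = (if i = of_int j then psi t (b * exp t powi j) else 1)
      * (if i + 1 = of_int j then inverse (psi t (b * exp t powi (j + 1))) else 1)"
proof -
  have "i = of_int (j - 1) \<longleftrightarrow> i + 1 = of_int j" using mod_ring_shift(1)[of i "of_int j"] by auto
  moreover have "\<not> (i = of_int j \<and> i + 1 = of_int j)" using two_steps(1)[of i] by auto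
  ultimately show ?thesis by (auto simp: vector_rep_def)
qed

text \<open>At most one box lies in the class i and at most one in i + 1, and no other box
  contributes. A single such box gives the parameter and weight of the model; two of them
  cancel.\<close>

lemma column_phi:
  assumes js: "js \<in> columns r"
  shows "phi_eig (column_module t r a) (i :: 'n mod_ring) js = phi_factor t (col_u i js) (a * exp t powi col_e i js)"
proof -
  let ?f = "\<lambda>s. psi t (a * exp t powi (js ! s - 2 * int s))"
  let ?g = "\<lambda>s. inverse (psi t (a * exp t powi (js ! s + 1 - 2 * int s)))"
  have "phi_eig (column_module t r a) i js
    = (\<Prod>s<r + 1. (if i = of_int (js ! s) then ?f s else 1) * (if i + 1 = of_int (js ! s) then ?g s else 1))"
    unfolding column_module_def Vtilde_def restrict_basis_def tensor_def
    by (simp add: vector_rep_phi del: upt_Suc prod.lessThan_Suc)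
      (intro prod.cong refl, simp add: power_int_diff power_int_add power_int_minus divide_inverse mult_ac nth_append del: upt_Suc)
  also have "\<dots> = (if occ i js then ?f (box i js) else 1) * (if occ (i + 1) js then ?g (box (i + 1) js) else 1)"
    unfolding prod.distrib prod_class[OF js] ..
  also have "\<dots> = phi_factor t (col_u i js) (a * exp t powi col_e i js)"
  proof -
    have f: "?f s = phi_factor t 1 (a * exp t powi (js ! s - 2 * int s))" for s by (rule psi_eq_phi_factor)
    have g: "?g s = phi_factor t (-1) (a * exp t powi (js ! s - 1 - 2 * int s))" for s
    proof (rule inverse_psi_eq_phi_factor)
      have "js ! s + 1 - 2 * int s = js ! s - 1 - 2 * int s + 2" by simp
      then have "exp t powi (js ! s + 1 - 2 * int s) = exp t powi (js ! s - 1 - 2 * int s) * exp t powi 2"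
        by (simp only: power_int_add_numeral power_int_add[OF disjI1[OF exp_not_eq_zero]])
      then show "a * exp t powi (js ! s + 1 - 2 * int s) = a * exp t powi (js ! s - 1 - 2 * int s) * exp t ^ 2"
        by (simp add: mult.assoc)
    qed
    consider "occ i js" "occ (i + 1) js" | "occ i js" "\<not> occ (i + 1) js" | "\<not> occ i js" "occ (i + 1) js"
      | "\<not> occ i js" "\<not> occ (i + 1) js" by blast
    then show ?thesis
    proof cases
      case 1
      let ?s = "box i js" and ?s' = "box (i + 1) js"
      \<comment> \<open>At distance 1 the parameters of \<psi> and of its inverse agree exactly,
        also when the two boxes are the last and the first.\<close>
      have "js ! ?s' - 2 * int ?s' = js ! ?s - 2 * int ?s + 1 - 2"
        using box[OF js 1(1)] box[OF js 1(2)] r by (intro neighbour[OF js]) auto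
      then have "js ! ?s' + 1 - 2 * int ?s' = js ! ?s - 2 * int ?s" by simp
      then show ?thesis using 1 by (simp add: col_u_def psi_nonzero)
    next
      case 2
      then show ?thesis using f by (simp add: col_u_def col_e_def)
    next
      case 3
      then show ?thesis using g by (simp add: col_u_def col_e_def)
    next
      case 4
      then show ?thesis by (simp add: col_u_def)
    qed
  qed
  finally show ?thesis .
qed

text \<open>Only boxes in the classes i and i + 1 have a nontrivial \<phi>_i. If s is the only such
  box, the coproduct inside the column produces no scalar.\<close>

lemma column_coproduct_factor:
  assumes s: "s \<le> r" and other: "\<And>p. p \<le> r \<Longrightarrow> p \<noteq> s \<Longrightarrow> (i :: 'n mod_ring) \<noteq> of_int (js ! p) \<and> i + 1 \<noteq> of_int (js ! p)"
  shows "coproduct_factor (map (\<lambda>s. vector_rep t (b s)) [0..<r + 1]) \<epsilon> i js s = 1"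
  unfolding coproduct_factor_def
proof (rule prod.neutral, rule ballI)
  fix p
  assume "p \<in> (case \<epsilon> of Plus \<Rightarrow> {..<s} | Minus \<Rightarrow> {s<..<length (map (\<lambda>s. vector_rep t (b s) :: ('n mod_ring, int) loop_data) [0..<r + 1])})"
  then have p: "p < r + 1" "p \<noteq> s" using s by (cases \<epsilon>; simp)+
  then have "map (\<lambda>s. vector_rep t (b s)) [0..<r + 1] ! p = (vector_rep t (b p) :: ('n mod_ring, int) loop_data)"
    by (simp del: upt_Suc)
  then show "phi_eig (map (\<lambda>s. vector_rep t (b s)) [0..<r + 1] ! p) i (js ! p) = 1"
    using other[of p] p by (simp add: vector_rep_phi del: upt_Suc)
qed

text \<open>The projection enters by requiring js' to be a column: this forces the class into which
  the box moves to be free, so that no other box sees the node i. A single box \<open>s0\<close>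
  then contributes, with coefficient 1.\<close>

lemma column_x_coeff:
  assumes js: "js \<in> columns r" and js': "js' \<in> columns r"
  shows "x_coeff (column_module t r a) \<epsilon> (i :: 'n mod_ring) js js' \<gamma>
    = (if col_u i js = - sg \<epsilon> \<and> js' = col_mv \<epsilon> i js \<and> \<gamma> = a * exp t powi col_e i js then 1 else 0)"
proof -
  define b where "b = (\<lambda>s. a * exp t powi (- 2 * int s))"
  define Ms where "Ms = map (\<lambda>s. vector_rep t (b s) :: ('n mod_ring, int) loop_data) [0..<r + 1]"
  define R where "R \<longleftrightarrow> col_u i js = - sg \<epsilon> \<and> js' = col_mv \<epsilon> i js \<and> \<gamma> = a * exp t powi col_e i js"
  define T where "T = (\<lambda>s. if js' = js[s := js' ! s]
      then rf_eval (coproduct_factor Ms \<epsilon> i js s) (inverse \<gamma>) * x_coeff (Ms ! s) \<epsilon> i (js ! s) (js' ! s) \<gamma> else 0)"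
  define s0 where "s0 = (case \<epsilon> of Minus \<Rightarrow> box i js | Plus \<Rightarrow> box (i + 1) js)"
  have b: "b s * exp t powi m = a * exp t powi (m - 2 * int s)" for s m
    by (simp add: b_def power_int_diff power_int_minus divide_inverse mult_ac)
  have "x_coeff (column_module t r a) \<epsilon> i js js' \<gamma> = (\<Sum>s<r + 1. T s)"
    unfolding column_module_def Vtilde_def restrict_basis_def tensor_def T_def Ms_def b_def by simp
  also have "\<dots> = (\<Sum>s<r + 1. if s = s0 then (if R then 1 else 0) else 0)"
  proof (rule sum.cong[OF refl])
    fix s assume "s \<in> {..<r + 1}"
    then have s: "s \<le> r" by simp
    have nth: "Ms ! s = vector_rep t (b s)" using s by (simp add: Ms_def del: upt_Suc)
    have factor: "rf_eval (coproduct_factor Ms \<epsilon> i js s) (inverse \<gamma>) = 1"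
      if "\<And>p. p \<le> r \<Longrightarrow> p \<noteq> s \<Longrightarrow> i \<noteq> of_int (js ! p) \<and> i + 1 \<noteq> of_int (js ! p)"
      using column_coproduct_factor[OF s that] by (simp add: Ms_def)
    show "T s = (if s = s0 then (if R then 1 else 0) else 0)"
    proof (cases \<epsilon>)
      case Minus
      show ?thesis
      proof (cases "js' = js[s := js ! s + 1] \<and> i = of_int (js ! s)")
        case True
        then have j: "js[s := js ! s + 1] \<in> columns r" and i: "i = of_int (js ! s)" using js' by auto
        note mv = raise_is_move[OF js s j, folded i]
        note M = col_mv_Minus[OF js mv(1)]
        have "s0 = s" using box_eq[OF js s i[symmetric]] Minus by (simp add: s0_def)
        moreover have "col_e i js = js ! s - 2 * int s" using M(5) box_eq[OF js s i[symmetric]] by simp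
        moreover have "i \<noteq> of_int (js ! p) \<and> i + 1 \<noteq> of_int (js ! p)" if "p \<le> r" "p \<noteq> s" for p
          using class_inj[OF js that(1) s] that M(6) occ_nth[OF js that(1)] i by auto
        ultimately show ?thesis
          using True mv factor js s Minus columns_length[OF js]
          by (simp add: T_def R_def nth vector_rep_def b)
      next
        case False
        have "T s = 0"
        proof (rule ccontr)
          assume "T s \<noteq> 0"
          then have "js' = js[s := js' ! s]" "js' ! s = js ! s + 1" "i = of_int (js ! s)"
            using Minus by (auto simp: T_def nth vector_rep_def split: if_splits)
          then show False using False by metis
        qed
        moreover have "\<not> (s = s0 \<and> R)"
        proof
          assume *: "s = s0 \<and> R"
          then have u: "col_u i js = 1" by (simp add: R_def Minus)
          show False using * False col_mv_Minus(2,3)[OF js u] by (simp add: R_def Minus s0_def)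
        qed
        ultimately show ?thesis by auto
      qed
    next
      case Plus
      show ?thesis
      proof (cases "js' = js[s := js ! s - 1] \<and> i = of_int (js ! s - 1)")
        case True
        have len: "length js = r + 1" by (rule columns_length[OF js])
        have v: "js' ! s = js ! s - 1" and up: "js'[s := js' ! s + 1] = js" using True s len by simp_all
        have i: "i = of_int (js' ! s)" "of_int (js ! s) = i + 1" using True v by simp_all
        note mv = raise_is_move[OF js' s, unfolded up, OF js, folded i]
        note M = Minus_properties[OF js' mv(1), unfolded mv(2)]
        have "box i js' = s" by (rule box_eq[OF js' s i(1)[symmetric]])
        then have e: "col_e i js = js ! s - 1 - 2 * int s" using M(3) col_mv_Minus(5)[OF js' mv(1)] v by simp
        have "s0 = s" using box_eq[OF js s i(2)] Plus by (simp add: s0_def)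
        moreover have "i \<noteq> of_int (js ! p) \<and> i + 1 \<noteq> of_int (js ! p)" if "p \<le> r" "p \<noteq> s" for p
          using class_inj[OF js that(1) s] that M(2) occ_nth[OF js that(1)] i unfolding col_u_m1 by auto
        ultimately show ?thesis
          using True M e factor s Plus len v
          by (simp add: T_def R_def nth vector_rep_def b)
      next
        case False
        have "T s = 0"
        proof (rule ccontr)
          assume "T s \<noteq> 0"
          then have "js' = js[s := js' ! s]" "js' ! s = js ! s - 1" "i = of_int (js ! s - 1)"
            using Plus by (auto simp: T_def nth vector_rep_def split: if_splits)
          then show False using False by metis
        qed
        moreover have "\<not> (s = s0 \<and> R)"
        proof
          assume *: "s = s0 \<and> R"
          then have "occ (i + 1) js" using col_u_m1[of i js] by (simp add: R_def Plus)
          then have "of_int (js ! s - 1) = i" using box(2)[OF js] * by (simp add: s0_def Plus)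
          then show False using * False by (auto simp: R_def Plus s0_def col_mv_def)
        qed
        ultimately show ?thesis by auto
      qed
    qed
  qed
  also have "\<dots> = (if R then 1 else 0)"
  proof -
    have "s0 < r + 1" if R
    proof (cases \<epsilon>)
      case Minus
      then have "col_u i js = 1" using that by (simp add: R_def)
      then show ?thesis using col_mv_Minus(1)[OF js] Minus by (simp add: s0_def less_Suc_eq_le)
    next
      case Plus
      then have "occ (i + 1) js" using that col_u_m1[of i js] by (simp add: R_def)
      then show ?thesis using box(1)[OF js] Plus by (simp add: s0_def less_Suc_eq_le)
    qed
    then show ?thesis by (cases R) simp_all
  qed
  finally show ?thesis by (simp add: R_def)
qed

section \<open>The column 1, ..., r + 1 and its monomial\<close>

lemma packed_nth: "s \<le> r \<Longrightarrow> packed 1 (Suc r) ! s = 1 + int s"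
  by (simp add: packed_def del: upt_Suc)

lemma packed_wt: "col_wt (packed 1 (r + 1)) x = (varpi (of_nat (r + 1) :: 'n mod_ring) x :: rat)"
proof -
  have len: "length (packed 1 (r + 1)) = r + 1" by (simp add: packed_def)
  have wt: "col_wt (packed 1 (r + 1)) x = (\<Sum>s<r + 1. box_weight (1 + int s) x)" for x :: "'n mod_ring option"
    unfolding col_wt_def len by (intro sum.cong refl) (simp add: packed_nth)
  show ?thesis
  proof (cases x)
    case (Some i)
    define F where "F s = (of_bool (i = of_nat s) :: rat)" for s
    \<comment> \<open>The box s has weight \<Lambda>_s - \<Lambda>_{s-1} on the coroots, so the sum
      over the boxes telescopes.\<close>
    have "(\<Sum>s<r + 1. box_weight (1 + int s) (Some i)) = (\<Sum>s<r + 1. F (Suc s) - F s)"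
      by (intro sum.cong refl) (simp add: box_weight_Some F_def)
    also have "\<dots> = F (r + 1) - F 0" by (rule sum_lessThan_telescope)
    finally show ?thesis unfolding wt Some by (simp add: F_def varpi_def fund_weight_def)
  next
    case None
    have "box_weight (1 + int s) (None :: 'n mod_ring option) = 0" if "s < r + 1" for s
    proof -
      \<comment> \<open>The boxes 1, ..., r + 1 are reached from the box 1 without subtracting the
        root of node 0, the only simple root that is nonzero on d.\<close>
      have "(of_int l :: 'n mod_ring) \<noteq> 0" if "l \<in> {1..<1 + int s}" for l
        using of_int_eq_imp_eq[of l 0] that \<open>s < r + 1\<close> by auto
      then have "(\<Sum>l\<in>{1..<1 + int s}. simple_root (of_int l :: 'n mod_ring) None) = 0"
        by (intro sum.neutral) (auto simp: simple_root_def)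
      then show ?thesis by (simp add: box_weight_def varpi_def fund_weight_def)
    qed
    then show ?thesis unfolding wt None by (simp add: varpi_def fund_weight_def)
  qed
qed

lemma top_class_nonzero: "(of_nat (r + 1) :: 'n mod_ring) \<noteq> 0"
  using of_int_eq_imp_eq[of "int r + 1" 0] by (auto simp: add.commute)

lemma packed_u: "col_u i (packed 1 (r + 1)) = of_bool (i = (of_nat (r + 1) :: 'n mod_ring)) - of_bool (i = 0)"
proof -
  have "(of_int (col_u i (packed 1 (r + 1))) :: rat) = of_int (of_bool (i = of_nat (r + 1)) - of_bool (i = 0))"
    unfolding col_wt_Some[OF packed_columns, symmetric] packed_wt by (simp add: varpi_def fund_weight_def)
  then show ?thesis by (simp only: of_int_eq_iff)
qed

text \<open>The values come from r + 1 - 2r for the last box and 1 - 1 for the first. They explain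
  the parameter c = a q^(-r) of the monomial: a q^(1-r) = c q at node r + 1, and at node 0 the
  inverse of \<psi> has parameter a q^2 = c q^(r+1) q.\<close>

lemma packed_e: "col_e (of_nat (r + 1) :: 'n mod_ring) (packed 1 (r + 1)) = 1 - int r"
  "col_e (0 :: 'n mod_ring) (packed 1 (r + 1)) = 0"
proof -
  note c = packed_columns[of 1 "r + 1"]
  have "box (of_nat (r + 1) :: 'n mod_ring) (packed 1 (r + 1)) = r"
    by (rule box_eq[OF c]) (simp_all add: packed_nth)
  moreover have "col_u (of_nat (r + 1) :: 'n mod_ring) (packed 1 (r + 1)) = 1"
    unfolding packed_u using top_class_nonzero by simp
  ultimately show "col_e (of_nat (r + 1) :: 'n mod_ring) (packed 1 (r + 1)) = 1 - int r"
    using col_mv_Minus(5)[OF c] by (simp add: packed_nth)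
  have "box (0 + 1 :: 'n mod_ring) (packed 1 (r + 1)) = 0"
    by (rule box_eq[OF c]) (simp_all add: packed_nth)
  moreover have "col_u (0 :: 'n mod_ring) (packed 1 (r + 1)) = -1"
    unfolding packed_u using top_class_nonzero by simp
  ultimately show "col_e (0 :: 'n mod_ring) (packed 1 (r + 1)) = 0"
    unfolding col_u_m1 col_e_def by (simp add: packed_nth)
qed

text \<open>For pairwise distinct parameters no exponents add up, so each exponent is an indicator;
  at most one of the two terms is nonzero because the classes r + 1 and 0 differ.\<close>

lemma top_monomial_exp:
  assumes "inj_on c {1..k}"
  shows "mono_exp (top_monomial t r k c) i b
    = of_bool (i = (of_nat (r + 1) :: 'n mod_ring)) * of_bool (b \<in> c ` {1..k})
      - of_bool (i = 0) * of_bool (b \<in> (\<lambda>s. c s * exp t ^ (r + 1)) ` {1..k})"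
proof -
  have count: "(\<Sum>s\<in>{1..k}. if P \<and> b = d s then 1 else 0) = (of_bool P * of_bool (b \<in> d ` {1..k}) :: int)"
    if "inj_on d {1..k}" for d and P
  proof (cases "P \<and> b \<in> d ` {1..k}")
    case True
    then obtain s0 where s0: "s0 \<in> {1..k}" "b = d s0" by blast
    have "(\<Sum>s\<in>{1..k}. if P \<and> b = d s then 1 else 0) = (\<Sum>s\<in>{1..k}. if s = s0 then 1 else (0 :: int))"
      using True s0 inj_onD[OF that] by (intro sum.cong) auto
    then show ?thesis using True s0 by simp
  next
    case False
    then have "(\<Sum>s\<in>{1..k}. if P \<and> b = d s then 1 else (0 :: int)) = 0" by (intro sum.neutral) auto
    then show ?thesis using False by auto
  qed
  have "inj_on (\<lambda>s. c s * exp t ^ (r + 1)) {1..k}" by (rule inj_on_times_const[OF assms]) simp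
  then show ?thesis
    unfolding top_monomial_def monomial.sel sum_subtractf count[OF assms] by (simp only: count)
qed

lemma top_monomial_is_monomial:
  assumes c: "inj_on c {1..k}" "\<And>s. s \<in> {1..k} \<Longrightarrow> c s \<noteq> 0"
  shows "is_monomial (top_monomial t r k c :: 'n mod_ring monomial)"
proof -
  let ?m = "top_monomial t r k c :: 'n mod_ring monomial"
  let ?d = "\<lambda>s. c s * exp t ^ (r + 1)"
  have d: "inj_on ?d {1..k}" by (rule inj_on_times_const[OF c(1)]) simp
  have w: "mono_weight ?m x = of_nat k * varpi (of_nat (r + 1)) x" for x by (simp add: top_monomial_def)
  have "mono_weight ?m \<in> weight_lattice"
    unfolding weight_lattice_def w by (simp add: varpi_def fund_weight_def)
  moreover have "finite {b. mono_exp ?m i b \<noteq> 0} \<and> mono_exp ?m i 0 = 0 \<and>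
      of_int (\<Sum>b | mono_exp ?m i b \<noteq> 0. mono_exp ?m i b) = mono_weight ?m (Some i)" for i
  proof -
    have 0: "mono_exp ?m i 0 = 0" using c(2) by (auto simp: top_monomial_exp[OF c(1)])
    have sub: "{b. mono_exp ?m i b \<noteq> 0} \<subseteq> c ` {1..k} \<union> ?d ` {1..k}"
      by (auto simp: top_monomial_exp[OF c(1)])
    have "(\<Sum>b | mono_exp ?m i b \<noteq> 0. mono_exp ?m i b) = (\<Sum>b\<in>c ` {1..k} \<union> ?d ` {1..k}. mono_exp ?m i b)"
      using sub by (intro sum.mono_neutral_left) auto
    also have "\<dots> = of_bool (i = of_nat (r + 1)) * (\<Sum>b\<in>c ` {1..k} \<union> ?d ` {1..k}. of_bool (b \<in> c ` {1..k}))
        - of_bool (i = 0) * (\<Sum>b\<in>c ` {1..k} \<union> ?d ` {1..k}. of_bool (b \<in> ?d ` {1..k}))"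
      unfolding top_monomial_exp[OF c(1)] sum_subtractf sum_distrib_left ..
    also have "(\<Sum>b\<in>c ` {1..k} \<union> ?d ` {1..k}. of_bool (b \<in> c ` {1..k})) = (\<Sum>b\<in>c ` {1..k}. 1 :: int)"
      by (intro sum.mono_neutral_cong_right) auto
    also have "(\<Sum>b\<in>c ` {1..k} \<union> ?d ` {1..k}. of_bool (b \<in> ?d ` {1..k})) = (\<Sum>b\<in>?d ` {1..k}. 1 :: int)"
      by (intro sum.mono_neutral_cong_right) auto
    finally have total: "(\<Sum>b | mono_exp ?m i b \<noteq> 0. mono_exp ?m i b)
        = of_bool (i = of_nat (r + 1)) * int k - of_bool (i = 0) * int k"
      by (simp only: sum_constant card_image[OF c(1)] card_image[OF d] card_atLeastAtMost) simp
    have "finite {b. mono_exp ?m i b \<noteq> 0}" using finite_subset[OF sub] by simp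
    with 0 show ?thesis
      unfolding total w by (simp add: varpi_def fund_weight_def)
  qed
  ultimately show ?thesis by (simp add: is_monomial_def)
qed

text \<open>Reindexing of the product over the support of the exponents by the tensor positions,
  which is the form of the eigenvalue on a tuple of columns.\<close>

lemma top_monomial_eigenvalue:
  assumes c: "inj_on c {1..k}"
  shows "mono_eigenvalue t (top_monomial t r k c :: 'n mod_ring monomial) i
    = (\<Prod>s\<in>{1..k}. if i = of_nat (r + 1) then psi t (c s * exp t)
        else if i = 0 then inverse (psi t (c s * exp t ^ (r + 1) * exp t)) else 1)"
proof -
  let ?m = "top_monomial t r k c :: 'n mod_ring monomial"
  let ?d = "\<lambda>s. c s * exp t ^ (r + 1)"
  have d: "inj_on ?d {1..k}" by (rule inj_on_times_const[OF c]) simp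
  consider "i = of_nat (r + 1)" "i \<noteq> 0" | "i = 0" "i \<noteq> of_nat (r + 1)" | "i \<noteq> of_nat (r + 1)" "i \<noteq> 0"
    using top_class_nonzero by metis
  then show ?thesis
  proof cases
    case 1
    then have e: "mono_exp ?m i b = of_bool (b \<in> c ` {1..k})" for b by (simp add: top_monomial_exp[OF c])
    then have "{b. mono_exp ?m i b \<noteq> 0} = c ` {1..k}" by auto
    then have "mono_eigenvalue t ?m i = (\<Prod>b\<in>c ` {1..k}. psi t (b * exp t))"
      unfolding mono_eigenvalue_def e by (auto intro: prod.cong)
    also have "\<dots> = (\<Prod>s\<in>{1..k}. psi t (c s * exp t))" by (rule prod.reindex[OF c, unfolded o_def])
    finally show ?thesis using 1 by simp
  next
    case 2
    then have e: "mono_exp ?m i b = - of_bool (b \<in> ?d ` {1..k})" for b by (simp add: top_monomial_exp[OF c])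
    then have "{b. mono_exp ?m i b \<noteq> 0} = ?d ` {1..k}" by auto
    then have "mono_eigenvalue t ?m i = (\<Prod>b\<in>?d ` {1..k}. inverse (psi t (b * exp t)))"
      unfolding mono_eigenvalue_def e by (auto intro!: prod.cong simp: power_int_minus)
    also have "\<dots> = (\<Prod>s\<in>{1..k}. inverse (psi t (?d s * exp t)))" by (rule prod.reindex[OF d, unfolded o_def])
    finally show ?thesis using 2 by simp
  next
    case 3
    then have "mono_exp ?m i b = 0" for b by (simp add: top_monomial_exp[OF c])
    then show ?thesis using 3 by (simp add: mono_eigenvalue_def)
  qed
qed

end

theorem theorem5p2:
  fixes t :: complex and r k :: nat and a :: "nat \<Rightarrow> complex"
    and Ms :: "('n::nontriv mod_ring, int list) loop_data list"
  assumes "r \<ge> 1" and "CARD('n) = 2 * r + 2"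
    and "\<forall>m::nat. m > 0 \<longrightarrow> exp t ^ m \<noteq> 1"
    and "k \<ge> 1"
    and "\<forall>i\<in>{1..k}. a i \<noteq> 0"
    and "\<forall>i\<in>{1..k}. \<forall>j\<in>{1..k}. i < j \<longrightarrow> (\<forall>l::int. a i / a j \<noteq> exp t powi (2 * l))"
    and "Ms = map (\<lambda>i. column_module t r (a i)) [1..<k + 1]"
  shows "coproduct_well_defined Ms \<and>
    (\<exists>\<rho>. has_action t (tensor Ms) \<rho> \<and>
         toroidal_module t (underlying_space (tensor Ms)) \<rho> \<and>
         irreducible_module (underlying_space (tensor Ms)) \<rho> \<and>
         thin_module (underlying_space (tensor Ms)) \<rho> \<and>
         extremal_loop_weight_module t (underlying_space (tensor Ms)) \<rho>
           (top_monomial t r k (\<lambda>i. a i * exp t powi (- int r))))"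
proof -
  interpret column_model r "TYPE('n)" using assms(1,2) by unfold_locales
  \<comment> \<open>The parameters are numbered from 1 in the theorem, while positions in a tensor
    are numbered from 0.\<close>
  define a' where "a' = (\<lambda>p. a (Suc p))"
  have a'_app: "a' p = a (Suc p)" for p by (simp add: a'_def)
  \<comment> \<open>The hypothesis compares indices i < j only; for j < i the ratio is inverted,
    which replaces l by -l.\<close>
  have generic: "a i \<noteq> a j * exp t powi (2 * l)" if ij: "i \<in> {1..k}" "j \<in> {1..k}" "i \<noteq> j" for i j and l :: int
  proof
    assume eq: "a i = a j * exp t powi (2 * l)"
    have nz: "a i \<noteq> 0" "a j \<noteq> 0" using assms(5) ij by auto
    consider "i < j" | "j < i" using ij(3) by linarith
    then show False
    proof cases
      case 1
      have "a i / a j \<noteq> exp t powi (2 * l)" by (rule assms(6)[rule_format, OF ij(1,2) 1])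
      then show False using eq nz by simp
    next
      case 2
      have "a j / a i \<noteq> exp t powi (2 * (- l))" by (rule assms(6)[rule_format, OF ij(2,1) 2])
      then show False using eq nz by (simp add: power_int_minus divide_inverse)
    qed
  qed
  interpret column_tensor "columns r" "col_u :: 'n mod_ring \<Rightarrow> _" col_e col_mv col_wt t k a'
  proof
    show "exp t ^ m \<noteq> 1" if "m > 0" for m using assms(3) that by blast
    show "a' p \<noteq> 0" if "p < k" for p using assms(5) that by (simp add: a'_def)
    show "a' p \<noteq> a' p' * exp t powi (2 * l)" if "p < k" "p' < k" "p \<noteq> p'" for p p' l
      using generic[of "Suc p" "Suc p'" l] that by (simp add: a'_def)
  qed
  have len: "length Ms = k" by (simp add: assms(7))
  have data: "column_data p (Ms ! p)" if "p < k" for p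
  proof -
    have "Ms ! p = column_module t r (a' p)" using that by (simp add: assms(7) a'_def del: upt_Suc)
    then show ?thesis
      unfolding column_data_def by (simp only:) (intro conjI ballI allI columns_basis column_wt column_phi column_x_coeff)
  qed
  define c where "c = (\<lambda>i. a i * exp t powi (- int r))"
  define m where "m = (top_monomial t r k c :: 'n mod_ring monomial)"
  note top = packed_columns[of 1 "r + 1"]
  have c_inj: "inj_on c {1..k}"
  proof (rule inj_onI)
    fix i j assume "i \<in> {1..k}" "j \<in> {1..k}" "c i = c j"
    then show "i = j" using generic[of i j 0] by (auto simp: c_def)
  qed
  have "is_monomial m"
    unfolding m_def by (rule top_monomial_is_monomial[OF c_inj]) (use assms(5) in \<open>simp add: c_def\<close>)
  moreover have "mono_weight m = twt (replicate k (packed 1 (r + 1)))"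
    by (rule ext) (simp only: twt_replicate packed_wt m_def top_monomial_def monomial.sel)
  moreover have "mono_eigenvalue t m i = teig i (replicate k (packed 1 (r + 1)))" for i
  proof -
    have psi_c: "psi t (c s * exp t) = phi_factor t 1 (a s * exp t powi (1 - int r))" for s
      unfolding psi_eq_phi_factor by (simp add: c_def power_int_diff power_int_minus divide_inverse mult_ac)
    have psi_c': "inverse (psi t (c s * exp t ^ (r + 1) * exp t)) = phi_factor t (-1) (a s * exp t powi 0)" for s
    proof (rule inverse_psi_eq_phi_factor)
      show "c s * exp t ^ (r + 1) * exp t = a s * exp t powi 0 * exp t ^ 2"
        by (simp add: c_def power_int_minus power2_eq_square field_simps)
    qed
    have factor: "(if i = of_nat (r + 1) then psi t (c s * exp t)
        else if i = 0 then inverse (psi t (c s * exp t ^ (r + 1) * exp t)) else 1)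
      = phi_factor t (col_u i (packed 1 (r + 1))) (a s * exp t powi col_e i (packed 1 (r + 1)))" for s
    proof -
      consider "i = of_nat (r + 1)" "i \<noteq> 0" | "i = 0" "i \<noteq> of_nat (r + 1)" | "i \<noteq> of_nat (r + 1)" "i \<noteq> 0"
        using top_class_nonzero by metis
      then show ?thesis
      proof cases
        case 1
        then have "col_u i (packed 1 (r + 1)) = 1" "col_e i (packed 1 (r + 1)) = 1 - int r"
          unfolding packed_u using packed_e by simp_all
        then show ?thesis using 1 by (simp only: psi_c if_True simp_thms)
      next
        case 2
        then have "col_u i (packed 1 (r + 1)) = -1" "col_e i (packed 1 (r + 1)) = 0"
          unfolding packed_u using packed_e by simp_all
        then show ?thesis using 2 by (simp only: psi_c' if_False if_True simp_thms)
      next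
        case 3
        then show ?thesis unfolding packed_u by simp
      qed
    qed
    have "mono_eigenvalue t m i = (\<Prod>s\<in>{1..k}. phi_factor t (col_u i (packed 1 (r + 1))) (a s * exp t powi col_e i (packed 1 (r + 1))))"
      unfolding m_def top_monomial_eigenvalue[OF c_inj] factor ..
    also have "{1..k} = Suc ` {..<k}" by (simp add: image_Suc_lessThan)
    also have "(\<Prod>s\<in>Suc ` {..<k}. phi_factor t (col_u i (packed 1 (r + 1))) (a s * exp t powi col_e i (packed 1 (r + 1))))
      = teig i (replicate k (packed 1 (r + 1)))"
      unfolding teig_def prod.reindex[OF inj_Suc[THEN inj_on_subset, OF subset_UNIV]] o_def
      by (intro prod.cong refl) (simp add: spec_def a'_app)
    finally show ?thesis .
  qed
  ultimately have "extremal_loop_weight_module t tspace taction m"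
    by (intro taction_extremal_loop_weight[OF top assms(4)])
  moreover have "irreducible_module tspace taction"
    using replicate_tbasis[OF top] by (intro taction_irreducible) blast
  moreover have "coproduct_well_defined Ms" "has_action t (tensor Ms) taction" "underlying_space (tensor Ms) = tspace"
    by (rule tensor_coproduct_well_defined[OF len] tensor_has_action[OF len] underlying_space_tensor[OF len], erule data)+
  ultimately show ?thesis
    using taction_toroidal_module taction_thin unfolding m_def c_def by (intro conjI exI[of _ taction]) simp_all
qed

end
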